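(* Let $\mathcal{A}$ be the operator on the Hilbert space $\mathcal{H}$ defined in the context. Then $0\in\sigma(\mathcal{A})$, and the stationary solutions of $\frac{d}{dt}U=\mathcal{A}U$ are characterized by $$\ker(\mathcal{A})=\operatorname{span}_{\mathcal H}\left\{[\zeta^1,\zeta^2,\zeta^3,0,0,0]'\right\},$$ where $$\zeta^1(x)=\frac{L_2-L_1-L_3}{L_1L_3}x+1\quad (x\in[L_1,L_2]),$$ $$\zeta^2(x)=\begin{cases}\frac{L_2-L_1}{L_1L_3}x & x\in[0,L_1],\\[2pt] \frac{L_2-L_1}{L_1L_3}x-\frac{L_2-L_1}{L_1}& x\in[L_2,L_3],\end{cases}$$ $$\zeta^3(x)=\frac{a(L_2-L_1-L_3)-b(L_2-L_1)}{mL_1L_3}\quad (x\in[L_1,L_2]).$$ Moreover, the imaginary axis without the origin is contained in the resolvent set $\rho(\mathcal{A})$, hence $i\mathbb{R}\cap\sigma(\mathcal{A})=\{0\}$.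
   Context: Fix real numbers $0<L_1<L_2<L_3$ and $a,b,m,k,\tau>0$. Put $I=(L_1,L_2)$ and $J=(0,L_1)\cup(L_2,L_3)$. All functions are complex valued; $H^s(J)$ consists of functions that are $H^s$ on each of the two components of $J$ separately, and point values of functions on $J$ at $0,L_1,L_2,L_3$ are the one-sided traces from within $J$. State space: $\mathcal{H}$ is the set of $[u^1,v^1,\theta,q,u^2,v^2]'\in H^1(I)\times H^1(J)\times L^2(I)\times L^2(I)\times L^2(I)\times L^2(J)$ with $v^1(0)=v^1(L_3)=0$ and $u^1(L_i)=v^1(L_i)$ for $i=1,2$, with inner product $$\langle U,\tilde U\rangle_{\mathcal{H}}=\int_I\left(a u^1_x\overline{\tilde u^1_x}+u^2\overline{\tilde u^2}+\theta\overline{\tilde\theta}+\tau q\overline{\tilde q}\right)dx+\int_J\left(b v^1_x\overline{\tilde v^1_x}+v^2\overline{\tilde v^2}\right)dx ,$$ which makes it a Hilbert space. Operator: $D(\mathcal{A})$ is the set of $U\in\mathcal{H}$ with $u^1\in H^2(I)$, $v^1\in H^2(J)$, $\theta,q,u^2\in H^1(I)$, $v^2\in H^1(J)$, $u^2(L_i)=v^2(L_i)$, $v^2(0)=v^2(L_3)=0$, $au^1_x(L_i)-m\theta(L_i)=bv^1_x(L_i)$, $q(L_i)=0$ for $i=1,2$, and $$\mathcal{A}U=\left[u^2,\ v^2,\ -(kq+mu^2)_x,\ -\tfrac{k}{\tau}\theta_x-\tfrac1\tau q,\ (au^1_x-m\theta)_x,\ bv^1_{xx}\right]'.$$ Stationary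 solutions are the elements of $\ker(\mathcal{A})$; $\sigma(\mathcal A)$ denotes the spectrum. *)

theory Defs
  imports "HOL-Analysis.Analysis"
begin

section \<open>Square-integrable functions modulo equality almost everywhere\<close>

definition square_integrable :: "(real \<Rightarrow> complex) \<Rightarrow> bool" where
  "square_integrable f \<longleftrightarrow>
     f \<in> borel_measurable lborel \<and> integrable lborel (\<lambda>x. (cmod (f x))\<^sup>2)"

definition l2_rel :: "(real \<Rightarrow> complex) \<Rightarrow> (real \<Rightarrow> complex) \<Rightarrow> bool" where
  "l2_rel f g \<longleftrightarrow>
     square_integrable f \<and> square_integrable g \<and> (AE x in lborel. f x = g x)"

lemma square_integrable_0: "square_integrable (\<lambda>x. 0)"
  by (simp add: square_integrable_def)

lemma square_integrable_add:
  assumes "square_integrable f" "square_integrable g"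
  shows "square_integrable (\<lambda>x. f x + g x)"
proof -
  have [measurable]: "f \<in> borel_measurable lborel" "g \<in> borel_measurable lborel"
    using assms by (auto simp: square_integrable_def)
  have le: "(cmod (y + z))\<^sup>2 \<le> 2 * (cmod y)\<^sup>2 + 2 * (cmod z)\<^sup>2" for y z
  proof -
    have "(cmod (y + z))\<^sup>2 \<le> (cmod y + cmod z)\<^sup>2"
      by (intro power_mono norm_triangle_ineq) auto
    also have "\<dots> \<le> 2 * (cmod y)\<^sup>2 + 2 * (cmod z)\<^sup>2"
      using sum_squares_bound[of "cmod y" "cmod z"] by (simp add: power2_sum)
    finally show ?thesis .
  qed
  have "integrable lborel (\<lambda>x. 2 * (cmod (f x))\<^sup>2 + 2 * (cmod (g x))\<^sup>2)"
    using assms by (auto simp: square_integrable_def)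
  then have "integrable lborel (\<lambda>x. (cmod (f x + g x))\<^sup>2)"
    by (rule Bochner_Integration.integrable_bound) (use le in auto)
  then show ?thesis by (simp add: square_integrable_def)
qed

lemma square_integrable_scale:
  assumes "square_integrable f"
  shows "square_integrable (\<lambda>x. c * f x)"
  using assms by (auto simp: square_integrable_def norm_mult power_mult_distrib)

quotient_type l2 = "real \<Rightarrow> complex" / partial: l2_rel
proof (rule part_equivpI)
  show "\<exists>f. l2_rel f f"
    using square_integrable_0 by (auto simp: l2_rel_def)
  show "symp l2_rel"
    by (auto simp: symp_def l2_rel_def)
  show "transp l2_rel"
    by (auto simp: transp_def l2_rel_def)
qed

instantiation l2 :: ab_group_add
begin

lift_definition zero_l2 :: l2 is "\<lambda>x. 0"
  by (simp add: l2_rel_def square_integrable_0)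

lift_definition plus_l2 :: "l2 \<Rightarrow> l2 \<Rightarrow> l2" is "\<lambda>f g x. f x + g x"
  by (auto simp: l2_rel_def intro: square_integrable_add)

lift_definition uminus_l2 :: "l2 \<Rightarrow> l2" is "\<lambda>f x. - f x"
  using square_integrable_scale[of _ "-1"] by (auto simp: l2_rel_def)

definition minus_l2 :: "l2 \<Rightarrow> l2 \<Rightarrow> l2" where
  "minus_l2 f g = f + - g"

instance
proof
  fix f g h :: l2
  show "f + g + h = f + (g + h)"
    by transfer (auto simp: l2_rel_def algebra_simps intro!: square_integrable_add)
  show "f + g = g + f"
    by transfer (auto simp: l2_rel_def algebra_simps intro!: square_integrable_add)
  show "0 + f = f"
    by transfer (auto simp: l2_rel_def)
  show "- f + f = 0"
    by transfer (auto simp: l2_rel_def square_integrable_0)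
  show "f - g = f + - g"
    by (simp add: minus_l2_def)
qed

end

lift_definition scale_l2 :: "complex \<Rightarrow> l2 \<Rightarrow> l2"  (infixr "*\<^sub>C" 75)
  is "\<lambda>c f x. c * f x"
  by (auto simp: l2_rel_def intro: square_integrable_scale)

lemma vector_space_l2: "vector_space scale_l2"
proof
  fix a b :: complex and f g :: l2
  show "a *\<^sub>C (f + g) = a *\<^sub>C f + a *\<^sub>C g"
    by transfer (auto simp: l2_rel_def algebra_simps
        intro!: square_integrable_add square_integrable_scale)
  show "(a + b) *\<^sub>C f = a *\<^sub>C f + b *\<^sub>C f"
    by transfer (auto simp: l2_rel_def distrib_right
        intro!: square_integrable_add square_integrable_scale
          square_integrable_scale[of _ "a + b", unfolded distrib_right])
  show "a *\<^sub>C b *\<^sub>C f = (a * b) *\<^sub>C f"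
    by transfer (auto simp: l2_rel_def mult.assoc intro!: square_integrable_scale)
  show "1 *\<^sub>C f = f"
    by transfer (auto simp: l2_rel_def)
qed

text \<open>
  \<open>L\<^sup>2(S)\<close> is identified with the elements of \<open>l2\<close> that vanish almost everywhere
  outside \<open>S\<close>; the class of a function on \<open>S\<close> is that of its extension by zero.
  For \<open>f :: l2\<close>, the function \<^term>\<open>rep_l2 f\<close> is some chosen square-integrable representative,
  so it may only be used where changes on null sets do not matter.
\<close>

definition L2_on :: "real set \<Rightarrow> l2 set" where
  "L2_on S = {f. AE x in lborel. x \<notin> S \<longrightarrow> rep_l2 f x = 0}"

definition class_on :: "real set \<Rightarrow> (real \<Rightarrow> complex) \<Rightarrow> l2" where
  "class_on S f = abs_l2 (\<lambda>x. if x \<in> S then f x else 0)"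


section \<open>Sobolev spaces and traces\<close>

text \<open>
  \<open>C\<^sub>c\<^sup>\<infinity>(S)\<close>; real-valued test functions suffice, since the pairings below are complex linear
  in the test function.
\<close>

definition test_functions :: "real set \<Rightarrow> (real \<Rightarrow> real) set" where
  "test_functions S =
     {\<phi>. (\<forall>n x. (deriv ^^ n) \<phi> field_differentiable at x) \<and>
          (\<exists>K. compact K \<and> K \<subseteq> S \<and> (\<forall>x. x \<notin> K \<longrightarrow> \<phi> x = 0))}"

definition has_weak_deriv :: "real set \<Rightarrow> l2 \<Rightarrow> l2 \<Rightarrow> bool" where
  "has_weak_deriv S f g \<longleftrightarrow>
     (\<forall>\<phi>\<in>test_functions S.
        (LINT x:S|lborel. rep_l2 f x * of_real (deriv \<phi> x)) =
        - (LINT x:S|lborel. rep_l2 g x * of_real (\<phi> x)))"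

text \<open>
  Here \<open>S\<close> is an open set. If \<open>S\<close> is a union of two disjoint open intervals, then test functions
  on \<open>S\<close> can be prescribed independently on the two intervals, so that
  \<open>H1_on S\<close> and \<open>H2_on S\<close> impose no condition linking the two components.
\<close>

definition H1_on :: "real set \<Rightarrow> l2 set" where
  "H1_on S = {f \<in> L2_on S. \<exists>g\<in>L2_on S. has_weak_deriv S f g}"

definition weak_deriv :: "real set \<Rightarrow> l2 \<Rightarrow> l2" where
  "weak_deriv S f = (THE g. g \<in> L2_on S \<and> has_weak_deriv S f g)"

definition H2_on :: "real set \<Rightarrow> l2 set" where
  "H2_on S = {f \<in> H1_on S. weak_deriv S f \<in> H1_on S}"

text \<open>
  The value at a boundary point \<open>p\<close> of \<open>S\<close> of an element of \<open>H\<^sup>1(S)\<close>: the limit, from within \<open>S\<close>,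
  of its continuous representative.
\<close>

definition trace_on :: "real set \<Rightarrow> l2 \<Rightarrow> real \<Rightarrow> complex" where
  "trace_on S f p =
     (THE c. \<exists>r. continuous_on S r \<and> (AE x in lborel. x \<in> S \<longrightarrow> r x = rep_l2 f x) \<and>
                 (r \<longlongrightarrow> c) (at p within S))"


section \<open>Resolvent set and spectrum of an unbounded operator\<close>

text \<open>
  \<open>A\<close> is an operator with domain \<open>D\<close> in the space \<open>H\<close> with norm \<open>nrm\<close>:
  \<open>z\<close> belongs to the resolvent set iff \<open>z - A : D \<rightarrow> H\<close> is bijective with bounded inverse.
\<close>

definition resolvent_set ::
  "(complex \<Rightarrow> 'a \<Rightarrow> 'a) \<Rightarrow> ('a \<Rightarrow> real) \<Rightarrow> 'a set \<Rightarrow> 'a set \<Rightarrow> ('a \<Rightarrow> 'a::ab_group_add) \<Rightarrow> complex set"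
  where
  "resolvent_set smul nrm H D A =
     {z. bij_betw (\<lambda>U. smul z U - A U) D H \<and>
          (\<exists>C. \<forall>F\<in>H. nrm (inv_into D (\<lambda>U. smul z U - A U) F) \<le> C * nrm F)}"

definition spectrum ::
  "(complex \<Rightarrow> 'a \<Rightarrow> 'a) \<Rightarrow> ('a \<Rightarrow> real) \<Rightarrow> 'a set \<Rightarrow> 'a set \<Rightarrow> ('a \<Rightarrow> 'a::ab_group_add) \<Rightarrow> complex set"
  where
  "spectrum smul nrm H D A = - resolvent_set smul nrm H D A"


section \<open>The transmission problem\<close>

text \<open>States are tuples \<open>[u\<^sup>1, v\<^sup>1, \<theta>, q, u\<^sup>2, v\<^sup>2]\<close>.\<close>

type_synonym state = "l2 \<times> l2 \<times> l2 \<times> l2 \<times> l2 \<times> l2"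

definition scale_state :: "complex \<Rightarrow> state \<Rightarrow> state" where
  "scale_state c = (\<lambda>(u1, v1, \<theta>, q, u2, v2).
     (c *\<^sub>C u1, c *\<^sub>C v1, c *\<^sub>C \<theta>, c *\<^sub>C q, c *\<^sub>C u2, c *\<^sub>C v2))"

interpretation state: vector_space scale_state
proof -
  interpret l2: vector_space scale_l2 by (rule vector_space_l2)
  show "vector_space scale_state"
    by standard
      (auto simp: scale_state_def l2.scale_right_distrib l2.scale_left_distrib)
qed

definition I_dom :: "real \<Rightarrow> real \<Rightarrow> real set" where
  "I_dom L1 L2 = {L1<..<L2}"

definition J_dom :: "real \<Rightarrow> real \<Rightarrow> real \<Rightarrow> real set" where
  "J_dom L1 L2 L3 = {0<..<L1} \<union> {L2<..<L3}"

definition state_space :: "real \<Rightarrow> real \<Rightarrow> real \<Rightarrow> state set" where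
  "state_space L1 L2 L3 = (let I = I_dom L1 L2; J = J_dom L1 L2 L3 in
     {(u1, v1, \<theta>, q, u2, v2).
        u1 \<in> H1_on I \<and> v1 \<in> H1_on J \<and> \<theta> \<in> L2_on I \<and> q \<in> L2_on I \<and> u2 \<in> L2_on I \<and> v2 \<in> L2_on J \<and>
        trace_on J v1 0 = 0 \<and> trace_on J v1 L3 = 0 \<and>
        (\<forall>p\<in>{L1, L2}. trace_on I u1 p = trace_on J v1 p)})"

definition state_inner ::
  "real \<Rightarrow> real \<Rightarrow> real \<Rightarrow> real \<Rightarrow> real \<Rightarrow> real \<Rightarrow> state \<Rightarrow> state \<Rightarrow> complex" where
  "state_inner L1 L2 L3 a b \<tau> = (let I = I_dom L1 L2; J = J_dom L1 L2 L3 in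
     (\<lambda>(u1, v1, \<theta>, q, u2, v2) (u1', v1', \<theta>', q', u2', v2').
       (LINT x:I|lborel.
          of_real a * rep_l2 (weak_deriv I u1) x * cnj (rep_l2 (weak_deriv I u1') x)
          + rep_l2 u2 x * cnj (rep_l2 u2' x)
          + rep_l2 \<theta> x * cnj (rep_l2 \<theta>' x)
          + of_real \<tau> * rep_l2 q x * cnj (rep_l2 q' x))
     + (LINT x:J|lborel.
          of_real b * rep_l2 (weak_deriv J v1) x * cnj (rep_l2 (weak_deriv J v1') x)
          + rep_l2 v2 x * cnj (rep_l2 v2' x))))"

definition state_norm ::
  "real \<Rightarrow> real \<Rightarrow> real \<Rightarrow> real \<Rightarrow> real \<Rightarrow> real \<Rightarrow> state \<Rightarrow> real" where
  "state_norm L1 L2 L3 a b \<tau> U = sqrt (Re (state_inner L1 L2 L3 a b \<tau> U U))"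

text \<open>
  \<open>gen\<close> is the operator \<open>\<A>\<close>; it is meaningful only on its domain \<open>gen_domain\<close>, where
  all weak derivatives below exist.
\<close>

definition gen_domain ::
  "real \<Rightarrow> real \<Rightarrow> real \<Rightarrow> real \<Rightarrow> real \<Rightarrow> real \<Rightarrow> state set" where
  "gen_domain L1 L2 L3 a b m = (let I = I_dom L1 L2; J = J_dom L1 L2 L3 in
     {(u1, v1, \<theta>, q, u2, v2) \<in> state_space L1 L2 L3.
        u1 \<in> H2_on I \<and> v1 \<in> H2_on J \<and>
        \<theta> \<in> H1_on I \<and> q \<in> H1_on I \<and> u2 \<in> H1_on I \<and> v2 \<in> H1_on J \<and>
        trace_on J v2 0 = 0 \<and> trace_on J v2 L3 = 0 \<and>
        (\<forall>p\<in>{L1, L2}.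
           trace_on I u2 p = trace_on J v2 p \<and>
           of_real a * trace_on I (weak_deriv I u1) p - of_real m * trace_on I \<theta> p
             = of_real b * trace_on J (weak_deriv J v1) p \<and>
           trace_on I q p = 0)})"

definition gen ::
  "real \<Rightarrow> real \<Rightarrow> real \<Rightarrow> real \<Rightarrow> real \<Rightarrow> real \<Rightarrow> real \<Rightarrow> real \<Rightarrow> state \<Rightarrow> state" where
  "gen L1 L2 L3 a b m k \<tau> = (let I = I_dom L1 L2; J = J_dom L1 L2 L3 in
     (\<lambda>(u1, v1, \<theta>, q, u2, v2).
       (u2,
        v2,
        - weak_deriv I (of_real k *\<^sub>C q + of_real m *\<^sub>C u2),
        - (of_real (k / \<tau>) *\<^sub>C weak_deriv I \<theta>) - of_real (1 / \<tau>) *\<^sub>C q,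
        weak_deriv I (of_real a *\<^sub>C weak_deriv I u1 - of_real m *\<^sub>C \<theta>),
        of_real b *\<^sub>C weak_deriv J (weak_deriv J v1))))"

definition gen_kernel ::
  "real \<Rightarrow> real \<Rightarrow> real \<Rightarrow> real \<Rightarrow> real \<Rightarrow> real \<Rightarrow> real \<Rightarrow> real \<Rightarrow> state set" where
  "gen_kernel L1 L2 L3 a b m k \<tau> =
     {U \<in> gen_domain L1 L2 L3 a b m. gen L1 L2 L3 a b m k \<tau> U = 0}"

definition gen_resolvent_set ::
  "real \<Rightarrow> real \<Rightarrow> real \<Rightarrow> real \<Rightarrow> real \<Rightarrow> real \<Rightarrow> real \<Rightarrow> real \<Rightarrow> complex set" where
  "gen_resolvent_set L1 L2 L3 a b m k \<tau> =
     resolvent_set scale_state (state_norm L1 L2 L3 a b \<tau>) (state_space L1 L2 L3)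
       (gen_domain L1 L2 L3 a b m) (gen L1 L2 L3 a b m k \<tau>)"

definition gen_spectrum ::
  "real \<Rightarrow> real \<Rightarrow> real \<Rightarrow> real \<Rightarrow> real \<Rightarrow> real \<Rightarrow> real \<Rightarrow> real \<Rightarrow> complex set" where
  "gen_spectrum L1 L2 L3 a b m k \<tau> =
     spectrum scale_state (state_norm L1 L2 L3 a b \<tau>) (state_space L1 L2 L3)
       (gen_domain L1 L2 L3 a b m) (gen L1 L2 L3 a b m k \<tau>)"

definition zeta1 :: "real \<Rightarrow> real \<Rightarrow> real \<Rightarrow> real \<Rightarrow> real" where
  "zeta1 L1 L2 L3 x = (L2 - L1 - L3) / (L1 * L3) * x + 1"

definition zeta2 :: "real \<Rightarrow> real \<Rightarrow> real \<Rightarrow> real \<Rightarrow> real" where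
  "zeta2 L1 L2 L3 x =
     (if x \<le> L1 then (L2 - L1) / (L1 * L3) * x
      else (L2 - L1) / (L1 * L3) * x - (L2 - L1) / L1)"

definition zeta3 :: "real \<Rightarrow> real \<Rightarrow> real \<Rightarrow> real \<Rightarrow> real \<Rightarrow> real \<Rightarrow> real \<Rightarrow> real" where
  "zeta3 L1 L2 L3 a b m x = (a * (L2 - L1 - L3) - b * (L2 - L1)) / (m * L1 * L3)"

definition zeta_state :: "real \<Rightarrow> real \<Rightarrow> real \<Rightarrow> real \<Rightarrow> real \<Rightarrow> real \<Rightarrow> state" where
  "zeta_state L1 L2 L3 a b m =
     (class_on (I_dom L1 L2) (\<lambda>x. of_real (zeta1 L1 L2 L3 x)),
      class_on (J_dom L1 L2 L3) (\<lambda>x. of_real (zeta2 L1 L2 L3 x)),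
      class_on (I_dom L1 L2) (\<lambda>x. of_real (zeta3 L1 L2 L3 a b m x)),
      0, 0, 0)"

end

theory Submission
  imports Defs "HOL-Computational_Algebra.Polynomial" "HOL-Real_Asymp.Real_Asymp"
begin

text \<open>
  By the du Bois-Reymond lemma the elements of \<open>H\<^sup>1\<close> are the classes of primitives of
  square-integrable functions. On the domain of the operator, \<open>u\<^sup>1\<close> and \<open>v\<^sup>1\<close>, the fluxes
  \<open>a u\<^sup>1\<^sub>x - m \<theta>\<close> and \<open>b v\<^sup>1\<^sub>x\<close>, and the pairs \<open>u\<^sup>2\<close>, \<open>v\<^sup>2\<close> therefore glue to continuous functions on
  \<open>[0, L3]\<close>, and the resolvent equation becomes a linear first-order system of four equations on
  \<open>[0, L3]\<close> with piecewise constant coefficients and four boundary conditions. For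
  \<open>z = i \<lambda> \<noteq> 0\<close> the homogeneous boundary value problem has only the trivial solution: the real part
  of the flux \<open>y2 cnj (z y1) - y4 cnj y3\<close> vanishes at both ends, is conserved on \<open>J\<close> and has derivative
  \<open>|q|\<^sup>2\<close> on \<open>I\<close>, so that \<open>q = 0\<close>, and then everything vanishes. By linearity (shooting from \<open>0\<close>) the
  inhomogeneous problem is uniquely solvable, with bounds. For \<open>z = 0\<close> the homogeneous system can
  be integrated by hand.
\<close>

section \<open>Smooth bump functions\<close>

text \<open>The unknowns are chosen so that every transmission condition becomes continuity: it is
  the flux \<open>a u1_x - m theta\<close>, not \<open>u1_x\<close>, that matches
  \<open>b v1_x\<close> at the interfaces. Constant extension of theta and q moves
  \<open>q(L1) = q(L2) = 0\<close> to the end points 0 and \<open>L3\<close>. The coefficients come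
  from eliminating \<open>u2 = z u1 - f1\<close>, and likewise for v: the flux has derivative
  \<open>z^2 u1 - z f1 - f5\<close>, the third component gives
  \<open>k q' = f3 - z theta - m u2'\<close>, and the fourth gives
  \<open>theta' = (tau/k) f4 - ((tau z + 1)/k) q\<close>. The data, among them the derivative of
  \<open>f1\<close> that enters through \<open>u2'\<close>, are merely square-integrable, so the
  system is posed as integral equations. Its solutions are differentiated only in the homogeneous
  case, where the right-hand sides are continuous on each piece. The norm of the state space
  measures \<open>u1\<close> and \<open>v1\<close> only through their derivatives. Bounds therefore
  pass through suprema: the norm controls integrals of the data, these control the supremum of the
  solution of the system, and that controls the norm of the state.\<close>

text \<open>Smoothness is reduced to exhibiting a family closed under differentiation: by induction
  all iterated derivatives stay in the family.\<close>

lemma funpow_deriv_differentiable: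
  fixes f :: "real \<Rightarrow> real"
  assumes "f \<in> \<F>"
    and step: "\<And>f. f \<in> \<F> \<Longrightarrow> \<exists>f'\<in>\<F>. \<forall>x. (f has_field_derivative f' x) (at x)"
  shows "(deriv ^^ n) f field_differentiable at x"
proof -
  have "(deriv ^^ n) f \<in> \<F>"
  proof (induction n)
    case (Suc n)
    then obtain f' where "f' \<in> \<F>" "\<forall>x. ((deriv ^^ n) f has_field_derivative f' x) (at x)"
      using step by blast
    moreover from this have "deriv ((deriv ^^ n) f) = f'"
      by (auto intro!: ext DERIV_imp_deriv)
    ultimately show ?case by simp
  qed (use assms in simp)
  then show ?thesis
    using step field_differentiable_def by blast
qed

text \<open>The standard flat function \<open>exp (-1/y)\<close> together with its quotients by
  powers of \<open>y\<close>: these quotients are what differentiation produces, so up to polynomial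
  factors the family is closed under it.\<close>

definition flat :: "nat \<Rightarrow> real \<Rightarrow> real" where
  "flat k y = (if y > 0 then exp (- 1 / y) / y ^ k else 0)"

text \<open>This is the difference quotient at 0. From the right, substituting the inverse turns it
  into a power divided by an exponential at infinity.\<close>

lemma flat_div_tendsto_0: "((\<lambda>h. flat k h / h) \<longlongrightarrow> 0) (at 0)"
proof -
  have "((\<lambda>h::real. (inverse h) ^ Suc k / exp (inverse h)) \<longlongrightarrow> 0) (at_right 0)"
    by (rule filterlim_compose[OF tendsto_power_div_exp_0 filterlim_inverse_at_top_right])
  then have "((\<lambda>h. flat k h / h) \<longlongrightarrow> 0) (at_right 0)"
    by (rule Lim_transform_eventually)
      (auto simp: eventually_at_right_less flat_def exp_minus field_simps
        intro!: eventually_mono[OF eventually_at_right_less[of 0]])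
  moreover have "((\<lambda>h. flat k h / h) \<longlongrightarrow> 0) (at_left 0)"
    by (rule tendsto_eventually)
      (auto simp: flat_def intro!: eventually_mono[OF eventually_at_left_real[of "-1" 0]])
  ultimately show ?thesis by (simp add: filterlim_at_split)
qed

lemma flat_has_field_derivative:
  "(flat k has_field_derivative (1 - real k * y) * flat (k + 2) y) (at y)"
proof -
  consider "y > 0" | "y < 0" | "y = 0" by linarith
  then show ?thesis
  proof cases
    case 1
    have "((\<lambda>y. exp (- 1 / y) / y ^ k) has_field_derivative (1 - real k * y) * flat (k + 2) y) (at y)"
    proof (cases k)
      case 0
      then show ?thesis using 1
        by (auto intro!: derivative_eq_intros simp: flat_def power2_eq_square field_simps)
    next
      case (Suc j)
      then show ?thesis using 1
        by (auto intro!: derivative_eq_intros simp: flat_def power2_eq_square divide_simps)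
          (cases j; simp add: algebra_simps)
    qed
    then show ?thesis
      by (rule DERIV_cong_ev[THEN iffD1, rotated -1])
        (use 1 in \<open>auto simp: flat_def intro!: eventually_mono[OF eventually_nhds_in_open[of "{0<..}"]]\<close>)
  next
    case 2
    have "((\<lambda>y. 0::real) has_field_derivative (1 - real k * y) * flat (k + 2) y) (at y)"
      using 2 by (simp add: flat_def)
    then show ?thesis
      by (rule DERIV_cong_ev[THEN iffD1, rotated -1])
        (use 2 in \<open>auto simp: flat_def intro!: eventually_mono[OF eventually_nhds_in_open[of "{..<0}"]]\<close>)
  next
    case 3
    then show ?thesis
      using flat_div_tendsto_0[of k] by (simp add: DERIV_def flat_def)
  qed
qed

text \<open>With \<open>P\<close> fixed, the functions of this shape for arbitrary \<open>R\<close>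
  and \<open>k\<close> form a family closed under differentiation.\<close>

lemma flat_poly_smooth:
  fixes P R :: "real poly"
  shows "(deriv ^^ n) (\<lambda>x. poly R x * flat k (poly P x)) field_differentiable at x"
proof (rule funpow_deriv_differentiable[where \<F> = "{f. \<exists>R k. f = (\<lambda>x. poly R x * flat k (poly P x))}"])
  fix f assume "f \<in> {f. \<exists>R k. f = (\<lambda>x. poly R x * flat k (poly P x))}"
  then obtain R k where f: "f = (\<lambda>x. poly R x * flat k (poly P x))" by blast
  \<comment> \<open>The product rule yields one term with \<open>flat k\<close> and one with
    \<open>flat (k + 2)\<close>; the factor \<open>P ^ 2\<close> raises the first to the index of
    the second.\<close>
  define S where "S = pderiv R * P ^ 2 + R * pderiv P * (1 - smult (real k) P)"
  have sq: "flat k y = y ^ 2 * flat (k + 2) y" for y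
    by (simp add: flat_def power_add power2_eq_square field_simps)
  have "(f has_field_derivative poly S x * flat (k + 2) (poly P x)) (at x)" for x
  proof -
    have "(f has_field_derivative
        poly (pderiv R) x * flat k (poly P x)
        + ((1 - real k * poly P x) * flat (k + 2) (poly P x) * poly (pderiv P) x) * poly R x) (at x)"
      unfolding f
      by (intro DERIV_mult poly_DERIV DERIV_chain2[OF flat_has_field_derivative])
    then show ?thesis
      by (rule DERIV_cong) (subst sq, unfold S_def poly_add poly_mult poly_diff poly_power poly_smult poly_1, algebra)
  qed
  then show "\<exists>f'\<in>{f. \<exists>R k. f = (\<lambda>x. poly R x * flat k (poly P x))}.
      \<forall>x. (f has_field_derivative f' x) (at x)"
    by (intro bexI[of _ "\<lambda>x. poly S x * flat (k + 2) (poly P x)"]) auto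
qed auto

text \<open>A bump centred at the midpoint of \<open>s\<close> and \<open>t\<close>. The radius is
  shrunk by the factor \<open>1 - 1/(n + 2)\<close>, so the support is compact inside the open
  interval; the factor \<open>n\<close> drives the argument of \<open>flat 0\<close> to infinity
  there, so the bumps tend to the indicator function.\<close>

definition bump :: "real \<Rightarrow> real \<Rightarrow> nat \<Rightarrow> real \<Rightarrow> real" where
  "bump s t n x = flat 0 (real n * ((((t - s) / 2) * (1 - 1 / (real n + 2)))\<^sup>2 - (x - (s + t) / 2)\<^sup>2))"

lemma bump_smooth: "(deriv ^^ j) (bump s t n) field_differentiable at x"
proof -
  define \<rho> where "\<rho> = ((t - s) / 2) * (1 - 1 / (real n + 2))"
  have "bump s t n = (\<lambda>x. poly 1 x * flat 0 (poly (smult (real n) ([:\<rho>\<^sup>2:] - [:- ((s + t) / 2), 1:] ^ 2)) x))"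
    by (simp only: fun_eq_iff bump_def \<rho>_def[symmetric]) (simp add: poly_power)
  then show ?thesis by (simp only: flat_poly_smooth)
qed

lemma bump_has_field_derivative: "(bump s t n has_field_derivative deriv (bump s t n) x) (at x)"
  using bump_smooth[of 0 s t n x] by (simp add: field_differentiable_derivI)

lemma bump_continuous: "continuous_on A (bump s t n)"
  by (meson DERIV_isCont bump_has_field_derivative continuous_at_imp_continuous_on)

lemma bump_bounds: "0 \<le> bump s t n x" "bump s t n x \<le> 1"
  by (auto simp: bump_def flat_def)

lemma bump_support:
  assumes "s < t"
  obtains p q where "s < p" "q < t" "\<And>x. x \<notin> {p..q} \<Longrightarrow> bump s t n x = 0"
proof -
  define \<rho> where "\<rho> = ((t - s) / 2) * (1 - 1 / (real n + 2))"
  have \<rho>: "0 < \<rho>" "\<rho> < (t - s) / 2"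
    using assms mult_strict_left_mono[of "1 - 1 / (real n + 2)" 1 "(t - s) / 2"]
    by (auto simp: \<rho>_def intro!: mult_pos_pos)
  have "bump s t n x = 0" if "x \<notin> {(s + t) / 2 - \<rho> .. (s + t) / 2 + \<rho>}" for x
  proof -
    have "\<rho> \<le> \<bar>x - (s + t) / 2\<bar>" using that by auto
    then have "\<rho>\<^sup>2 \<le> (x - (s + t) / 2)\<^sup>2"
      using \<rho> by (metis abs_ge_zero abs_le_square_iff abs_of_pos)
    then show ?thesis
      unfolding bump_def flat_def \<rho>_def[symmetric]
      by (simp add: mult_nonneg_nonpos not_less)
  qed
  moreover have "s < (s + t) / 2 - \<rho>" "(s + t) / 2 + \<rho> < t"
    using \<rho> by (auto simp: field_simps)
  ultimately show ?thesis using that by blast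
qed

lemma bump_eq_0: "s < t \<Longrightarrow> x \<notin> {s<..<t} \<Longrightarrow> bump s t n x = 0"
  by (rule bump_support[of s t n]) force+

text \<open>At an inner point the squared radius minus the squared distance to the midpoint has a
  positive limit; multiplied by \<open>n\<close> it tends to infinity, where
  \<open>exp (-1/y)\<close> tends to 1.\<close>

lemma bump_tendsto:
  assumes "s < t"
  shows "(\<lambda>n. bump s t n x) \<longlonglongrightarrow> indicator {s<..<t} x"
proof (cases "x \<in> {s<..<t}")
  case True
  define q where "q = (x - (s + t) / 2)\<^sup>2"
  have "\<bar>x - (s + t) / 2\<bar> < \<bar>(t - s) / 2\<bar>"
    using True by (auto simp: abs_if field_simps)
  then have q: "((t - s) / 2)\<^sup>2 - q > 0"
    unfolding q_def using abs_le_square_iff[of "(t - s) / 2" "x - (s + t) / 2"] by linarith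
  have "(\<lambda>n. 1 / (real n + 2)) \<longlonglongrightarrow> 0"
    by real_asymp
  then have "(\<lambda>n. (((t - s) / 2) * (1 - 1 / (real n + 2)))\<^sup>2 - q) \<longlonglongrightarrow> (((t - s) / 2) * (1 - 0))\<^sup>2 - q"
    by (intro tendsto_diff tendsto_power tendsto_mult tendsto_const)
  then have "filterlim (\<lambda>n. ((((t - s) / 2) * (1 - 1 / (real n + 2)))\<^sup>2 - q) * real n) at_top sequentially"
    using q by (intro filterlim_tendsto_pos_mult_at_top[OF _ _ filterlim_real_sequentially]) auto
  then have lim: "filterlim (\<lambda>n. real n * ((((t - s) / 2) * (1 - 1 / (real n + 2)))\<^sup>2 - q)) at_top sequentially"
    by (simp add: mult.commute)
  have "((\<lambda>y::real. exp (- (1 / y))) \<longlongrightarrow> exp (- 0)) at_top"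
    by (intro tendsto_intros real_tendsto_divide_at_top[OF tendsto_const] filterlim_ident)
  moreover have "\<forall>\<^sub>F y in at_top. flat 0 y = exp (- (1 / y))"
    using eventually_gt_at_top[of 0] by eventually_elim (simp add: flat_def)
  ultimately have "((\<lambda>y. flat 0 y) \<longlongrightarrow> 1) at_top"
    by (simp add: tendsto_cong)
  from filterlim_compose[OF this lim] show ?thesis
    using True by (simp add: bump_def q_def)
next
  case False
  then show ?thesis using bump_eq_0[OF assms False] by simp
qed

lemma bump_test_function:
  assumes "s < t" "{s<..<t} \<subseteq> S"
  shows "bump s t n \<in> test_functions S"
proof -
  obtain p q where pq: "s < p" "q < t" "\<And>x. x \<notin> {p..q} \<Longrightarrow> bump s t n x = 0"
    using bump_support[OF assms(1)] by blast
  then have "{p..q} \<subseteq> S" using assms(2) by force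
  then have "\<exists>K. compact K \<and> K \<subseteq> S \<and> (\<forall>x. x \<notin> K \<longrightarrow> bump s t n x = 0)"
    using pq(3) by (intro exI[of _ "{p..q}"]) auto
  then show ?thesis
    unfolding test_functions_def mem_Collect_eq using bump_smooth by (intro conjI allI)
qed

text \<open>The Borel sets over which the integral of \<open>f\<close> vanishes contain the compact
  intervals and are stable under complements and countable disjoint unions, hence are all Borel
  sets.\<close>

lemma AE_zero_if_interval_integrals_zero:
  fixes f :: "real \<Rightarrow> complex"
  assumes f: "integrable lborel f"
    and 0: "\<And>a b. a \<le> b \<Longrightarrow> (LINT x:{a..b}|lborel. f x) = 0"
  shows "AE x in lborel. f x = 0"
proof (rule sigma_finite_measure.density_zero[OF lborel.sigma_finite_measure_axioms f])
  have si: "set_integrable lborel A f" if "A \<in> sets borel" for A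
    using integrable_mult_indicator[OF _ f, of A] that by (simp add: set_integrable_def)
  \<comment> \<open>Complements need the integral over the whole line; exhaustion by growing
    intervals and dominated convergence supply it.\<close>
  have tot: "(LINT x|lborel. f x) = 0"
  proof -
    have "(\<lambda>n. LINT x:{- real n..real n}|lborel. f x) \<longlonglongrightarrow> (LINT x|lborel. f x)"
      unfolding set_lebesgue_integral_def
    proof (rule integral_dominated_convergence[where w = "\<lambda>x. norm (f x)"])
      show "AE x in lborel. (\<lambda>n. indicat_real {- real n..real n} x *\<^sub>R f x) \<longlonglongrightarrow> f x"
      proof (intro AE_I2 tendsto_eventually)
        fix x :: real
        obtain N where N: "\<bar>x\<bar> \<le> real N" using real_arch_simple by blast
        show "\<forall>\<^sub>F n in sequentially. indicat_real {- real n..real n} x *\<^sub>R f x = f x"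
          using eventually_ge_at_top[of N] by eventually_elim (use N in \<open>auto simp: indicator_def\<close>)
      qed
    qed (use f in \<open>auto simp: indicator_def\<close>)
    then show ?thesis using 0 by (simp add: LIMSEQ_const_iff)
  qed
  fix A :: "real set" assume "A \<in> sets lborel"
  then have "A \<in> sets borel" by simp
  then show "(LINT x:A|lborel. f x) = 0"
  proof (induction rule: borel_set_induct)
    case empty
    then show ?case by (simp add: set_lebesgue_integral_def)
  next
    case (interval a b)
    then show ?case using 0 by simp
  next
    case (compl A)
    have "(LINT x:(A \<union> -A)|lborel. f x) = (LINT x:A|lborel. f x) + (LINT x:-A|lborel. f x)"
      using compl by (intro set_integral_Un si) auto
    moreover have "(LINT x:(A \<union> -A)|lborel. f x) = (LINT x|lborel. f x)"
      by (simp add: set_lebesgue_integral_def)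
    ultimately show ?case using tot compl by simp
  next
    case (union A)
    have "(LINT x:(\<Union>i. A i)|lborel. f x) = (\<Sum>i. LINT x:A i|lborel. f x)"
      using union by (intro lebesgue_integral_countable_add si)
        (auto simp: disjoint_family_on_def)
    then show ?case using union by simp
  qed
qed

section \<open>Square-integrable classes\<close>

lemma square_integrable_rep: "square_integrable (rep_l2 f)"
  using Quotient_rep_reflp[OF Quotient_l2] by (simp add: l2_rel_def)

lemma abs_rep_l2: "abs_l2 (rep_l2 f) = f"
  using Quotient_abs_rep[OF Quotient_l2] .

lemma rep_abs_l2: "square_integrable f \<Longrightarrow> AE x in lborel. rep_l2 (abs_l2 f) x = f x"
  using Quotient_rep_abs[OF Quotient_l2, of f] by (simp add: l2_rel_def)

lemma l2_eqI: "(AE x in lborel. rep_l2 f x = rep_l2 g x) \<Longrightarrow> f = g"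
  using Quotient_rel_rep[OF Quotient_l2, of f g] square_integrable_rep by (simp add: l2_rel_def)

lemma rep_l2_measurable [measurable]: "rep_l2 f \<in> borel_measurable borel"
  using square_integrable_rep[of f] by (simp add: square_integrable_def)

lemma rep_add: "AE x in lborel. rep_l2 (f + g) x = rep_l2 f x + rep_l2 g x"
proof -
  have "f + g = abs_l2 (\<lambda>x. rep_l2 f x + rep_l2 g x)"
    using plus_l2.abs_eq[of "rep_l2 f" "rep_l2 g"] square_integrable_rep
    by (simp add: abs_rep_l2 l2_rel_def)
  then show ?thesis
    using rep_abs_l2[OF square_integrable_add[OF square_integrable_rep square_integrable_rep]] by simp
qed

lemma rep_scale: "AE x in lborel. rep_l2 (c *\<^sub>C f) x = c * rep_l2 f x"
proof -
  have "c *\<^sub>C f = abs_l2 (\<lambda>x. c * rep_l2 f x)"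
    using scale_l2.abs_eq[of "rep_l2 f" c] square_integrable_rep
    by (simp add: abs_rep_l2 l2_rel_def)
  then show ?thesis
    using rep_abs_l2[OF square_integrable_scale[OF square_integrable_rep]] by simp
qed

interpretation l2: vector_space scale_l2
  by (rule vector_space_l2)

lemma square_integrable_bound:
  assumes "f \<in> borel_measurable borel" "square_integrable g" "\<And>x. cmod (f x) \<le> cmod (g x)"
  shows "square_integrable f"
  unfolding square_integrable_def
proof
  show "integrable lborel (\<lambda>x. (cmod (f x))\<^sup>2)"
    by (rule Bochner_Integration.integrable_bound[of _ "\<lambda>x. (cmod (g x))\<^sup>2"])
      (use assms in \<open>auto simp: square_integrable_def intro!: power_mono\<close>)
qed (use assms in simp)

text \<open>On a set of finite measure \<open>1 + |y|^2\<close> is an integrable majorant of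
  \<open>|y|\<close>.\<close>

lemma square_integrable_set_integrable:
  assumes "square_integrable f" "S \<in> sets borel" "emeasure lborel S < \<infinity>"
  shows "set_integrable lborel S f"
proof -
  have [measurable]: "f \<in> borel_measurable borel" using assms by (simp add: square_integrable_def)
  have "cmod y \<le> 1 + (cmod y)\<^sup>2" for y
    using sum_squares_bound[of 1 "cmod y"] by simp (smt (verit) norm_ge_zero)
  then have le: "norm (indicat_real S x *\<^sub>R f x) \<le> norm (indicat_real S x + (cmod (f x))\<^sup>2)" for x
    by (auto simp: indicator_def)
  have "integrable lborel (\<lambda>x. indicat_real S x + (cmod (f x))\<^sup>2)"
    using assms by (auto simp: square_integrable_def)
  then show ?thesis
    unfolding set_integrable_def
    by (rule Bochner_Integration.integrable_bound) (use assms le in \<open>auto simp del: scaleR_complex.simps\<close>)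
qed

text \<open>Exactly the condition under which \<open>class_on S f\<close> is a meaningful class,
  since that class is formed from the extension by zero.\<close>

definition sq_on :: "real set \<Rightarrow> (real \<Rightarrow> complex) \<Rightarrow> bool" where
  "sq_on S f \<longleftrightarrow> square_integrable (\<lambda>x. if x \<in> S then f x else 0)"

lemma sq_on_add: "sq_on S f \<Longrightarrow> sq_on S g \<Longrightarrow> sq_on S (\<lambda>x. f x + g x)"
  unfolding sq_on_def
  by (drule (1) square_integrable_add) (erule back_subst[of square_integrable], auto)

lemma sq_on_scale: "sq_on S f \<Longrightarrow> sq_on S (\<lambda>x. c * f x)"
  unfolding sq_on_def
  by (drule square_integrable_scale[of _ c]) (auto elim!: back_subst[of square_integrable])

lemma sq_on_uminus: "sq_on S f \<Longrightarrow> sq_on S (\<lambda>x. - f x)"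
  using sq_on_scale[of S f "- 1"] by simp

lemma sq_on_diff: "sq_on S f \<Longrightarrow> sq_on S g \<Longrightarrow> sq_on S (\<lambda>x. f x - g x)"
  using sq_on_add[OF _ sq_on_uminus, of S f g] by simp

lemma sq_on_divide: "sq_on S f \<Longrightarrow> sq_on S (\<lambda>x. f x / c)"
  using sq_on_scale[of S f "1 / c"] by simp

lemma square_integrable_imp_sq_on:
  assumes "square_integrable f" "S \<in> sets borel"
  shows "sq_on S f"
  unfolding sq_on_def
  by (rule square_integrable_bound[OF _ assms(1)])
    (use assms in \<open>auto simp: square_integrable_def\<close>)

lemma sq_on_continuous:
  fixes r :: "real \<Rightarrow> complex"
  assumes r: "continuous_on {a..b} r" and S: "S \<in> sets borel" "S \<subseteq> {a..b}"
  shows "sq_on S r"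
proof -
  obtain B where B: "\<And>x. x \<in> {a..b} \<Longrightarrow> cmod (r x) \<le> B"
    using compact_imp_bounded[OF compact_continuous_image[OF r compact_Icc]]
    by (auto simp only: bounded_iff ball_simps)
  have meas: "(\<lambda>x. if x \<in> S then r x else 0) \<in> borel_measurable borel"
  proof -
    have "(\<lambda>x. indicator {a..b} x *\<^sub>R r x) \<in> borel_measurable borel"
      using borel_measurable_continuous_on_indicator[OF _ r] by simp
    then have "(\<lambda>x. if x \<in> S then indicator {a..b} x *\<^sub>R r x else 0) \<in> borel_measurable borel"
      using S by measurable
    moreover have "(\<lambda>x. if x \<in> S then indicator {a..b} x *\<^sub>R r x else 0) = (\<lambda>x. if x \<in> S then r x else 0)"
      using S by (auto simp: fun_eq_iff)
    ultimately show ?thesis by simp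
  qed
  have "(\<lambda>x. (cmod (indicator {a..b} x *\<^sub>R of_real B))\<^sup>2) = (\<lambda>x. indicat_real {a..b} x * B\<^sup>2)"
    by (auto simp: fun_eq_iff indicator_def)
  moreover have "integrable lborel (indicat_real {a..b})"
    by (simp add: integrable_indicator_iff emeasure_lborel_Icc_eq)
  ultimately have "square_integrable (\<lambda>x. indicator {a..b} x *\<^sub>R of_real B)"
    by (simp add: square_integrable_def)
  then show ?thesis
    unfolding sq_on_def
    by (rule square_integrable_bound[OF meas])
      (use B S in \<open>auto simp: indicator_def subset_iff intro: order_trans[OF _ abs_ge_self]\<close>)
qed

lemma rep_class_on:
  "sq_on S f \<Longrightarrow> AE x in lborel. rep_l2 (class_on S f) x = (if x \<in> S then f x else 0)"
  unfolding sq_on_def class_on_def by (rule rep_abs_l2)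

lemma class_on_L2: "sq_on S f \<Longrightarrow> class_on S f \<in> L2_on S"
  using rep_class_on[of S f] by (auto simp: L2_on_def)

lemma class_on_eqI:
  assumes "sq_on S f" "g \<in> L2_on S" "AE x in lborel. x \<in> S \<longrightarrow> rep_l2 g x = f x"
  shows "g = class_on S f"
  by (rule l2_eqI) (use assms(2,3) rep_class_on[OF assms(1)] in \<open>auto simp: L2_on_def\<close>)

lemma L2_eq_class_on: "g \<in> L2_on S \<Longrightarrow> S \<in> sets borel \<Longrightarrow> g = class_on S (rep_l2 g)"
  by (rule class_on_eqI) (auto intro: square_integrable_imp_sq_on square_integrable_rep)

lemma class_on_cong:
  assumes "sq_on S f" "sq_on S g" "AE x in lborel. x \<in> S \<longrightarrow> f x = g x"
  shows "class_on S f = class_on S g"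
  by (rule class_on_eqI[OF assms(2) class_on_L2[OF assms(1)]])
    (use assms(3) rep_class_on[OF assms(1)] in auto)

lemma class_on_eqD:
  assumes "class_on S f = class_on S g" "sq_on S f" "sq_on S g"
  shows "AE x in lborel. x \<in> S \<longrightarrow> f x = g x"
  using rep_class_on[OF assms(2)] rep_class_on[OF assms(3)] assms(1) by auto

lemma class_on_add:
  assumes "sq_on S f" "sq_on S g"
  shows "class_on S f + class_on S g = class_on S (\<lambda>x. f x + g x)"
  by (rule l2_eqI)
    (use rep_add[of "class_on S f" "class_on S g"] rep_class_on[OF assms(1)] rep_class_on[OF assms(2)]
      rep_class_on[OF sq_on_add[OF assms]] in auto)

lemma class_on_scale:
  assumes "sq_on S f"
  shows "c *\<^sub>C class_on S f = class_on S (\<lambda>x. c * f x)"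
  by (rule l2_eqI)
    (use rep_scale[of c "class_on S f"] rep_class_on[OF assms] rep_class_on[OF sq_on_scale[OF assms, of c]]
      in auto)

lemma class_on_uminus: "sq_on S f \<Longrightarrow> - class_on S f = class_on S (\<lambda>x. - f x)"
  using class_on_scale[of S f "- 1"] by simp

lemma class_on_diff:
  "sq_on S f \<Longrightarrow> sq_on S g \<Longrightarrow> class_on S f - class_on S g = class_on S (\<lambda>x. f x - g x)"
  using class_on_add[OF _ sq_on_uminus] by (simp add: class_on_uminus[symmetric] diff_conv_add_uminus del: add_uminus_conv_diff)

lemma class_on_0: "class_on S (\<lambda>x. 0) = 0"
  by (simp add: class_on_def zero_l2.abs_eq)

section \<open>Primitives and weak derivatives\<close>

text \<open>Stands in for absolute continuity with derivative \<open>g\<close>. The integral form is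
  insensitive to null sets in \<open>g\<close>, needs no pointwise derivative, and glues at common
  end points.\<close>

definition primitive_on :: "real \<Rightarrow> real \<Rightarrow> (real \<Rightarrow> 'a::banach) \<Rightarrow> (real \<Rightarrow> 'a) \<Rightarrow> bool" where
  "primitive_on c d r g \<longleftrightarrow>
     (\<forall>x y. c \<le> x \<longrightarrow> x \<le> y \<longrightarrow> y \<le> d \<longrightarrow> (g has_integral (r y - r x)) {x..y})"

lemma primitive_onD:
  "primitive_on c d r g \<Longrightarrow> c \<le> x \<Longrightarrow> x \<le> y \<Longrightarrow> y \<le> d \<Longrightarrow> (g has_integral (r y - r x)) {x..y}"
  by (simp add: primitive_on_def)

lemma primitive_on_subset:
  "primitive_on c d r g \<Longrightarrow> c \<le> c' \<Longrightarrow> d' \<le> d \<Longrightarrow> primitive_on c' d' r g"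
  unfolding primitive_on_def by (meson order_trans)

lemma primitive_on_eq:
  "primitive_on c d r g \<Longrightarrow> c \<le> x \<Longrightarrow> x \<le> d \<Longrightarrow> r x = r c + integral {c..x} g"
  using primitive_onD[of c d r g c x] by (simp add: integral_unique)

lemma primitive_on_integral:
  assumes "g integrable_on {c..d}"
  shows "primitive_on c d (\<lambda>x. C + integral {c..x} g) g"
  unfolding primitive_on_def
proof (intro allI impI)
  fix x y assume *: "c \<le> x" "x \<le> y" "y \<le> d"
  have "g integrable_on {c..y}" "g integrable_on {x..y}"
    using * by (auto intro: integrable_on_subinterval[OF assms])
  then show "(g has_integral (C + integral {c..y} g - (C + integral {c..x} g))) {x..y}"
    using Henstock_Kurzweil_Integration.integral_combine[of c x y g] * by (simp add: has_integral_iff algebra_simps)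
qed

lemma primitive_on_continuous:
  assumes "primitive_on c d r g"
  shows "continuous_on {c..d} r"
proof (cases "c \<le> d")
  case True
  have "g integrable_on {c..d}"
    using primitive_onD[OF assms order_refl True order_refl] by (rule has_integral_integrable)
  then have "continuous_on {c..d} (\<lambda>x. r c + integral {c..x} g)"
    by (intro continuous_intros indefinite_integral_continuous_1)
  then show ?thesis
    by (rule continuous_on_eq) (rule primitive_on_eq[OF assms, symmetric]; simp)
qed simp

lemma primitive_on_glue:
  assumes "primitive_on c e r g" "primitive_on e d r g"
  shows "primitive_on c d r g"
  unfolding primitive_on_def
proof (intro allI impI)
  fix x y assume *: "c \<le> x" "x \<le> y" "y \<le> d"
  consider "y \<le> e" | "e \<le> x" | "x \<le> e" "e \<le> y" by linarith
  then show "(g has_integral (r y - r x)) {x..y}"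
  proof cases
    case 1
    show ?thesis by (rule primitive_onD[OF assms(1) *(1,2) 1])
  next
    case 2
    show ?thesis by (rule primitive_onD[OF assms(2) 2 *(2,3)])
  next
    case 3
    have "(g has_integral ((r e - r x) + (r y - r e))) {x..y}"
      by (rule has_integral_combine[OF 3 primitive_onD[OF assms(1) *(1) 3(1) order_refl]
            primitive_onD[OF assms(2) order_refl 3(2) *(3)]])
    then show ?thesis by simp
  qed
qed

text \<open>The asymmetry is deliberate: a primitive is determined at every point, its derivative
  only up to null sets, and the end points are null.\<close>

lemma primitive_on_cong_AE:
  fixes r :: "real \<Rightarrow> 'a::euclidean_space"
  assumes r: "primitive_on c d r g"
    and r': "\<And>x. c \<le> x \<Longrightarrow> x \<le> d \<Longrightarrow> r' x = r x"
    and g': "AE x in lborel. x \<in> {c<..<d} \<longrightarrow> g' x = g x"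
  shows "primitive_on c d r' g'"
  unfolding primitive_on_def
proof (intro allI impI)
  fix x y assume *: "c \<le> x" "x \<le> y" "y \<le> d"
  have "AE t in lborel. t \<in> {x..y} \<longrightarrow> g t = g' t"
    using g' AE_lborel_singleton[of c] AE_lborel_singleton[of d]
    by eventually_elim (use * in auto)
  then have "(g has_integral (r y - r x)) {x..y} = (g' has_integral (r y - r x)) {x..y}"
    by (rule has_integral_AE)
  then show "(g' has_integral (r' y - r' x)) {x..y}"
    using primitive_onD[OF r *] r' * by simp
qed

lemma primitive_on_add:
  assumes "primitive_on c d r g" "primitive_on c d s h"
  shows "primitive_on c d (\<lambda>x. r x + s x) (\<lambda>x. g x + h x)"
  unfolding primitive_on_def
proof (intro allI impI)
  fix x y assume *: "c \<le> x" "x \<le> y" "y \<le> d"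
  show "((\<lambda>x. g x + h x) has_integral (r y + s y - (r x + s x))) {x..y}"
    using has_integral_add[OF primitive_onD[OF assms(1) *] primitive_onD[OF assms(2) *]]
    by (simp add: algebra_simps)
qed

lemma primitive_on_linear:
  assumes "primitive_on c d r g" "bounded_linear T"
  shows "primitive_on c d (\<lambda>x. T (r x)) (\<lambda>x. T (g x))"
  unfolding primitive_on_def
proof (intro allI impI)
  fix x y assume *: "c \<le> x" "x \<le> y" "y \<le> d"
  interpret bounded_linear T by fact
  show "((\<lambda>x. T (g x)) has_integral (T (r y) - T (r x))) {x..y}"
    using has_integral_linear[OF primitive_onD[OF assms(1) *] assms(2)] by (simp add: diff o_def)
qed

lemma primitive_on_scale:
  fixes r :: "real \<Rightarrow> complex"
  shows "primitive_on c d r g \<Longrightarrow> primitive_on c d (\<lambda>x. z * r x) (\<lambda>x. z * g x)"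
  by (erule primitive_on_linear) (rule bounded_linear_mult_right)

lemma primitive_on_diff:
  "primitive_on c d r g \<Longrightarrow> primitive_on c d s h \<Longrightarrow> primitive_on c d (\<lambda>x. r x - s x) (\<lambda>x. g x - h x)"
  using primitive_on_add[of c d r g "\<lambda>x. - s x" "\<lambda>x. - h x"]
    primitive_on_linear[OF _ bounded_linear_minus[OF bounded_linear_ident], of c d s h] by simp

lemma primitive_on_const: "primitive_on c d (\<lambda>x. C) (\<lambda>x. 0)"
  by (simp add: primitive_on_def)

text \<open>Bridge between the Lebesgue integrals over open intervals in the definition of weak
  derivatives and the gauge integrals over closed intervals behind
  \<open>primitive_on\<close>.\<close>

lemma Ioo_integral_eq:
  fixes f :: "real \<Rightarrow> complex"
  assumes "set_integrable lborel {c..d} f"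
  shows "set_integrable lborel {c<..<d} f" "(LINT x:{c<..<d}|lborel. f x) = integral {c..d} f"
proof -
  show *: "set_integrable lborel {c<..<d} f"
    by (rule set_integrable_subset[OF assms]) auto
  show "(LINT x:{c<..<d}|lborel. f x) = integral {c..d} f"
    using set_borel_integral_eq_integral(2)[OF *] integral_open_interval_real[of c d f] by simp
qed

lemma set_integrable_mult_continuous:
  fixes f :: "real \<Rightarrow> complex" and \<phi> :: "real \<Rightarrow> real"
  assumes f: "set_integrable lborel {c..d} f" and \<phi>: "continuous_on UNIV \<phi>"
  shows "set_integrable lborel {c..d} (\<lambda>x. f x * of_real (\<phi> x))"
proof -
  have "bounded (\<phi> ` {c..d})"
    by (rule compact_imp_bounded[OF compact_continuous_image[OF continuous_on_subset[OF \<phi>] compact_Icc]]) simp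
  then obtain B where B: "\<forall>x\<in>{c..d}. norm (\<phi> x) \<le> B" by (auto simp: bounded_iff)
  have \<phi>m: "\<phi> \<in> borel_measurable borel"
    using \<phi> by (rule borel_measurable_continuous_onI)
  have "integrable lborel (\<lambda>x. indicat_real {c..d} x *\<^sub>R f x * of_real (\<phi> x))"
  proof (rule Bochner_Integration.integrable_bound)
    show "integrable lborel (\<lambda>x. of_real B * (indicat_real {c..d} x *\<^sub>R f x))"
      using f unfolding set_integrable_def by (rule integrable_mult_right)
    show "(\<lambda>x. indicat_real {c..d} x *\<^sub>R f x * of_real (\<phi> x)) \<in> borel_measurable lborel"
      using borel_measurable_integrable[OF f[unfolded set_integrable_def]] \<phi>m
      by (intro borel_measurable_times) auto
    show "AE x in lborel. norm (indicat_real {c..d} x *\<^sub>R f x * of_real (\<phi> x))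
        \<le> norm (of_real B * (indicat_real {c..d} x *\<^sub>R f x))"
    proof (rule AE_I2)
      fix x
      show "norm (indicat_real {c..d} x *\<^sub>R f x * of_real (\<phi> x))
        \<le> norm (of_real B * (indicat_real {c..d} x *\<^sub>R f x))"
      proof (cases "x \<in> {c..d}")
        case True
        then have "norm (\<phi> x) \<le> \<bar>B\<bar>" using B by force
        then show ?thesis using True by (simp add: norm_mult mult.commute[of "cmod (f x)"] mult_right_mono)
      qed simp
    qed
  qed
  then show ?thesis by (simp add: set_integrable_def)
qed

lemma rep_l2_set_integrable: "set_integrable lborel {c..d} (rep_l2 f)"
  by (rule square_integrable_set_integrable[OF square_integrable_rep]) (auto simp: emeasure_lborel_Icc_eq)

lemma set_integrable_continuous_Icc:
  fixes r :: "real \<Rightarrow> complex"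
  assumes "continuous_on {c..d} r"
  shows "set_integrable lborel {c..d} r"
  unfolding set_integrable_def
  using borel_integrable_compact[OF compact_Icc assms] by (simp add: indicator_scaleR_eq_if)

lemma set_lebesgue_integral_restrict:
  assumes "T \<subseteq> S" "\<And>x. x \<in> S \<Longrightarrow> x \<notin> T \<Longrightarrow> f x = 0"
  shows "(LINT x:S|M. f x) = (LINT x:T|M. f x)"
  unfolding set_lebesgue_integral_def
  by (rule Bochner_Integration.integral_cong) (use assms in \<open>auto simp: indicator_def\<close>)

section \<open>Integration by parts: primitives have weak derivatives\<close>

lemma test_functionD:
  assumes "\<phi> \<in> test_functions S"
  shows test_function_deriv: "(\<phi> has_field_derivative deriv \<phi> x) (at x)"
    and test_function_deriv_continuous: "continuous_on A (deriv \<phi>)"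
    and test_function_continuous: "continuous_on A \<phi>"
    and test_function_outside: "x \<notin> S \<Longrightarrow> \<phi> x = 0"
proof -
  have d: "(deriv ^^ n) \<phi> field_differentiable at x" for n x
    using assms by (simp add: test_functions_def)
  show "(\<phi> has_field_derivative deriv \<phi> x) (at x)"
    using d[of 0 x] by (simp add: field_differentiable_derivI)
  show "continuous_on A (deriv \<phi>)"
    using d[of 1] by (auto intro!: continuous_at_imp_continuous_on field_differentiable_imp_continuous_at)
  show "continuous_on A \<phi>"
    using d[of 0] by (auto intro!: continuous_at_imp_continuous_on field_differentiable_imp_continuous_at)
  show "x \<notin> S \<Longrightarrow> \<phi> x = 0"
    using assms by (auto simp: test_functions_def)
qed

lemma integral_cong_AE_Ioo:
  fixes f g :: "real \<Rightarrow> complex"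
  assumes "AE x in lborel. x \<in> {c<..<d} \<longrightarrow> f x = g x"
  shows "integral {c..d} f = integral {c..d} g"
proof -
  have "AE x in lborel. x \<in> {c..d} \<longrightarrow> f x = g x"
    using assms AE_lborel_singleton[of c] AE_lborel_singleton[of d] by eventually_elim auto
  from has_integral_AE[OF this] show ?thesis
    by (simp add: integral_def integrable_on_def)
qed

text \<open>As \<open>r\<close> is only a primitive of an integrable function, the product rule is
  replaced by Fubini for \<open>\<phi>' x * g t\<close> on the triangle \<open>t <= x\<close>:
  integrating over \<open>t\<close> first gives \<open>\<phi>' x * (r x - r c)\<close>, integrating
  over \<open>x\<close> first gives \<open>g t * (\<phi> d - \<phi> t)\<close>.\<close>

lemma primitive_on_by_parts:
  fixes r g :: "real \<Rightarrow> complex" and \<phi> \<phi>' :: "real \<Rightarrow> real"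
  assumes r: "primitive_on c d r g" and g: "set_integrable lborel {c..d} g"
    and \<phi>: "\<And>x. (\<phi> has_field_derivative \<phi>' x) (at x)" and \<phi>': "continuous_on UNIV \<phi>'"
    and cd: "c \<le> d"
  shows "integral {c..d} (\<lambda>x. g x * of_real (\<phi> x)) + integral {c..d} (\<lambda>x. r x * of_real (\<phi>' x))
    = r d * of_real (\<phi> d) - r c * of_real (\<phi> c)"
proof -
  define u where "u t = indicat_real {c..d} t *\<^sub>R g t" for t
  define v where "v x = indicat_real {c..d} x *\<^sub>R complex_of_real (\<phi>' x)" for x
  \<comment> \<open>The integrand on the triangle; \<open>u\<close> and \<open>v\<close> are already
    cut off to \<open>{c..d}\<close>.\<close>
  define f where "f x t = v x * (if t \<le> x then u t else 0)" for x t
  have \<phi>'i: "set_integrable lborel {x..y} (\<lambda>x. complex_of_real (\<phi>' x))" for x y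
    by (intro set_integrable_continuous_Icc continuous_intros continuous_on_subset[OF \<phi>']) auto
  have u: "integrable lborel u" and v: "integrable lborel v"
    using g \<phi>'i by (simp_all add: set_integrable_def u_def[abs_def] v_def[abs_def])
  have [measurable]: "u \<in> borel_measurable borel" "v \<in> borel_measurable borel"
    using borel_measurable_integrable[OF u] borel_measurable_integrable[OF v] by simp_all
  have fi: "integrable (lborel \<Otimes>\<^sub>M lborel) (case_prod f)"
  proof (rule lborel_pair.Fubini_integrable)
    show "case_prod f \<in> borel_measurable (lborel \<Otimes>\<^sub>M lborel)"
      unfolding f_def[abs_def] by measurable
    show "AE x in lborel. integrable lborel (\<lambda>t. case_prod f (x, t))"
      unfolding f_def by (intro AE_I2, rule Bochner_Integration.integrable_bound[OF integrable_mult_right[OF u]]) auto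
    have "(LINT t|lborel. norm (f x t)) \<le> norm (v x) * (LINT t|lborel. norm (u t))" for x
      unfolding f_def integral_mult_right_zero[symmetric]
      by (rule integral_mono_AE') (use u in \<open>auto simp: norm_mult\<close>)
    then show "integrable lborel (\<lambda>x. LINT t|lborel. norm (case_prod f (x, t)))"
      by (intro Bochner_Integration.integrable_bound[OF integrable_mult_left[OF integrable_norm[OF v],
              of "LINT t|lborel. norm (u t)"]])
        (auto simp: f_def intro!: order_trans[OF _ abs_ge_self])
  qed
  have si: "set_integrable lborel {c..d} (\<lambda>x. r x * of_real (\<phi>' x))" "set_integrable lborel {c..d} (\<lambda>x. g x * of_real (\<phi> x))"
    by (intro set_integrable_mult_continuous \<phi>' g set_integrable_continuous_Icc primitive_on_continuous[OF r]
        continuous_at_imp_continuous_on ballI DERIV_isCont[OF \<phi>])+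
  have \<phi>int: "(LINT x:{s..t}|lborel. complex_of_real (\<phi>' x)) = of_real (\<phi> t - \<phi> s)" if "s \<le> t" for s t
    unfolding set_borel_integral_eq_integral(2)[OF \<phi>'i]
    by (intro integral_unique has_integral_of_real fundamental_theorem_of_calculus[OF that]
        has_real_derivative_iff_has_vector_derivative[THEN iffD1] has_field_derivative_at_within[OF \<phi>])
  have "(LINT t|lborel. f x t) = indicat_real {c..d} x *\<^sub>R (r x * of_real (\<phi>' x) - r c * of_real (\<phi>' x))" for x
  proof (cases "x \<in> {c..d}")
    case True
    have "(LINT t|lborel. f x t) = v x * (LINT t:{c..x}|lborel. g t)"
      unfolding f_def integral_mult_right_zero set_lebesgue_integral_def
      by (intro arg_cong2[of _ _ _ _ "(*)"] refl Bochner_Integration.integral_cong)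
        (use True in \<open>auto simp: u_def indicator_def\<close>)
    also have "(LINT t:{c..x}|lborel. g t) = r x - r c"
      using set_borel_integral_eq_integral(2)[OF set_integrable_subset[OF g, of "{c..x}"]]
        primitive_onD[OF r, of c x] True by (auto simp: integral_unique)
    finally show ?thesis using True by (simp add: v_def algebra_simps)
  qed (simp add: f_def v_def)
  then have 1: "(LINT x|lborel. LINT t|lborel. f x t) = (LINT x:{c..d}|lborel. r x * of_real (\<phi>' x) - r c * of_real (\<phi>' x))"
    by (simp add: set_lebesgue_integral_def)
  have "(LINT x|lborel. f x t) = indicat_real {c..d} t *\<^sub>R (g t * of_real (\<phi> d) - g t * of_real (\<phi> t))" for t
  proof (cases "t \<in> {c..d}")
    case True
    have "(LINT x|lborel. f x t) = u t * (LINT x:{t..d}|lborel. complex_of_real (\<phi>' x))"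
      unfolding integral_mult_right_zero[symmetric] set_lebesgue_integral_def
      by (intro Bochner_Integration.integral_cong) (use True in \<open>auto simp: f_def v_def indicator_def\<close>)
    then show ?thesis using True by (simp add: \<phi>int[of t d] u_def right_diff_distrib)
  next
    case False
    then have "u t = 0" by (simp add: u_def)
    then show ?thesis using False by (simp add: f_def cong: if_cong)
  qed
  then have 2: "(LINT t|lborel. LINT x|lborel. f x t) = (LINT t:{c..d}|lborel. g t * of_real (\<phi> d) - g t * of_real (\<phi> t))"
    by (simp add: set_lebesgue_integral_def)
  have "(LINT x:{c..d}|lborel. r x * of_real (\<phi>' x) - r c * of_real (\<phi>' x))
      = (LINT t:{c..d}|lborel. g t * of_real (\<phi> d) - g t * of_real (\<phi> t))"
    using lborel_pair.Fubini_integral[OF fi] unfolding 1 2 by simp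
  moreover have "(LINT t:{c..d}|lborel. g t) = r d - r c"
    using set_borel_integral_eq_integral(2)[OF g] primitive_onD[OF r order_refl cd order_refl]
    by (simp add: integral_unique)
  ultimately show ?thesis
    using \<phi>int[OF cd] si g \<phi>'i[of c d]
    by (simp add: set_integral_diff flip: set_borel_integral_eq_integral(2)) (simp add: algebra_simps)
qed

text \<open>A test function of \<open>S\<close> need not have its support in this one component, but
  it vanishes at \<open>c\<close> and \<open>d\<close>, which lie outside \<open>S\<close>; so the
  boundary terms of the integration by parts drop out.\<close>

lemma weak_deriv_component:
  assumes r: "primitive_on c d r (rep_l2 g)" and f: "AE x in lborel. x \<in> {c<..<d} \<longrightarrow> rep_l2 f x = r x"
    and \<phi>: "\<phi> \<in> test_functions S" and cd: "c \<le> d" "c \<notin> S" "d \<notin> S"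
  shows "(LINT x:{c<..<d}|lborel. rep_l2 f x * of_real (deriv \<phi> x))
    = - (LINT x:{c<..<d}|lborel. rep_l2 g x * of_real (\<phi> x))"
proof -
  note \<phi>D = test_functionD[OF \<phi>]
  have rc: "continuous_on {c..d} r" by (rule primitive_on_continuous[OF r])
  have "(LINT x:{c<..<d}|lborel. rep_l2 f x * of_real (deriv \<phi> x))
      = integral {c..d} (\<lambda>x. rep_l2 f x * of_real (deriv \<phi> x))"
    by (intro Ioo_integral_eq set_integrable_mult_continuous rep_l2_set_integrable \<phi>D)
  also have "\<dots> = integral {c..d} (\<lambda>x. r x * of_real (deriv \<phi> x))"
    by (rule integral_cong_AE_Ioo) (use f in auto)
  also have "\<dots> = - integral {c..d} (\<lambda>x. rep_l2 g x * of_real (\<phi> x))"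
    using primitive_on_by_parts[OF r rep_l2_set_integrable \<phi>D(1,2) cd(1)] \<phi>D(4)[OF cd(2)] \<phi>D(4)[OF cd(3)]
    by (simp add: add_eq_0_iff)
  also have "integral {c..d} (\<lambda>x. rep_l2 g x * of_real (\<phi> x))
      = (LINT x:{c<..<d}|lborel. rep_l2 g x * of_real (\<phi> x))"
    by (rule Ioo_integral_eq(2)[symmetric])
      (intro set_integrable_mult_continuous rep_l2_set_integrable \<phi>D)
  finally show ?thesis .
qed

lemma has_weak_deriv_Ioo:
  assumes "primitive_on c d r (rep_l2 g)" "AE x in lborel. x \<in> {c<..<d} \<longrightarrow> rep_l2 f x = r x" "c \<le> d"
  shows "has_weak_deriv {c<..<d} f g"
  unfolding has_weak_deriv_def
  using weak_deriv_component[OF assms(1,2) _ assms(3)] by auto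

lemma has_weak_deriv_two_Ioo:
  assumes "primitive_on c d r (rep_l2 g)" "AE x in lborel. x \<in> {c<..<d} \<longrightarrow> rep_l2 f x = r x" "c \<le> d"
    and "primitive_on c' d' r' (rep_l2 g)" "AE x in lborel. x \<in> {c'<..<d'} \<longrightarrow> rep_l2 f x = r' x" "c' \<le> d'"
    and "d \<le> c'"
  shows "has_weak_deriv ({c<..<d} \<union> {c'<..<d'}) f g"
  unfolding has_weak_deriv_def
proof
  fix \<phi> assume \<phi>: "\<phi> \<in> test_functions ({c<..<d} \<union> {c'<..<d'})"
  have split: "(LINT x:{c<..<d} \<union> {c'<..<d'}|lborel. rep_l2 h x * of_real (\<psi> x))
      = (LINT x:{c<..<d}|lborel. rep_l2 h x * of_real (\<psi> x))
      + (LINT x:{c'<..<d'}|lborel. rep_l2 h x * of_real (\<psi> x))"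
    if "continuous_on UNIV \<psi>" for h \<psi>
    by (rule set_integral_Un)
      (use assms(7) that in \<open>auto intro!: Ioo_integral_eq(1) set_integrable_mult_continuous rep_l2_set_integrable\<close>)
  show "(LINT x:{c<..<d} \<union> {c'<..<d'}|lborel. rep_l2 f x * of_real (deriv \<phi> x))
      = - (LINT x:{c<..<d} \<union> {c'<..<d'}|lborel. rep_l2 g x * of_real (\<phi> x))"
    using weak_deriv_component[OF assms(1,2) \<phi> assms(3)] weak_deriv_component[OF assms(4,5) \<phi> assms(6)]
      assms(3,6,7)
    by (simp add: split test_functionD[OF \<phi>])
qed

section \<open>Uniqueness of weak derivatives and the du Bois-Reymond lemma\<close>

lemma bump_integral_tendsto:
  fixes F :: "real \<Rightarrow> complex"
  assumes F: "set_integrable lborel {c..d} F" and st: "c \<le> s" "s < t" "t \<le> d"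
  shows "(\<lambda>n. LINT x:{c<..<d}|lborel. F x * of_real (bump s t n x)) \<longlonglongrightarrow> (LINT x:{s<..<t}|lborel. F x)"
  unfolding set_lebesgue_integral_def
proof (rule integral_dominated_convergence[where w = "\<lambda>x. norm (indicat_real {c..d} x *\<^sub>R F x)"])
  have Fi: "integrable lborel (\<lambda>x. indicat_real {c..d} x *\<^sub>R F x)"
    using F by (simp add: set_integrable_def)
  then show "integrable lborel (\<lambda>x. norm (indicat_real {c..d} x *\<^sub>R F x))" by (rule integrable_norm)
  have "set_integrable lborel {s<..<t} F"
    by (rule set_integrable_subset[OF F]) (use st in auto)
  then show "(\<lambda>x. indicat_real {s<..<t} x *\<^sub>R F x) \<in> borel_measurable lborel"
    unfolding set_integrable_def by (rule borel_measurable_integrable)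
  show "(\<lambda>x. indicat_real {c<..<d} x *\<^sub>R (F x * of_real (bump s t n x))) \<in> borel_measurable lborel" for n
    using Ioo_integral_eq(1)[OF set_integrable_mult_continuous[OF F bump_continuous]]
    unfolding set_integrable_def by (rule borel_measurable_integrable)
  show "AE x in lborel. (\<lambda>n. indicat_real {c<..<d} x *\<^sub>R (F x * of_real (bump s t n x)))
      \<longlonglongrightarrow> indicat_real {s<..<t} x *\<^sub>R F x"
  proof (rule AE_I2)
    fix x
    have "(\<lambda>n. indicat_real {c<..<d} x *\<^sub>R (F x * of_real (bump s t n x)))
      \<longlonglongrightarrow> indicat_real {c<..<d} x *\<^sub>R (F x * of_real (indicat_real {s<..<t} x))"
      by (intro tendsto_scaleR tendsto_mult tendsto_of_real tendsto_const bump_tendsto[OF st(2)])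
    then show "(\<lambda>n. indicat_real {c<..<d} x *\<^sub>R (F x * of_real (bump s t n x)))
      \<longlonglongrightarrow> indicat_real {s<..<t} x *\<^sub>R F x"
      by (rule back_subst[of "\<lambda>y. _ \<longlonglongrightarrow> y"]) (use st in \<open>auto simp: indicator_def\<close>)
  qed
  show "AE x in lborel. norm (indicat_real {c<..<d} x *\<^sub>R (F x * of_real (bump s t n x)))
      \<le> norm (indicat_real {c..d} x *\<^sub>R F x)" for n
    using bump_bounds[of s t n]
    by (intro AE_I2) (auto simp: indicator_def norm_mult intro!: mult_left_le)
qed

text \<open>Reduces to compact intervals on the line after cutting \<open>F\<close> off to the open
  interval: the intersection of the two is, up to end points, again an open subinterval.\<close>

lemma AE_zero_if_Ioo_integrals_zero:
  fixes F :: "real \<Rightarrow> complex"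
  assumes F: "set_integrable lborel {c..d} F"
    and 0: "\<And>s t. c \<le> s \<Longrightarrow> s < t \<Longrightarrow> t \<le> d \<Longrightarrow> (LINT x:{s<..<t}|lborel. F x) = 0"
  shows "AE x in lborel. x \<in> {c<..<d} \<longrightarrow> F x = 0"
proof -
  have "AE x in lborel. indicat_real {c<..<d} x *\<^sub>R F x = 0"
  proof (rule AE_zero_if_interval_integrals_zero)
    show "integrable lborel (\<lambda>x. indicat_real {c<..<d} x *\<^sub>R F x)"
      using Ioo_integral_eq(1)[OF F] by (simp add: set_integrable_def)
    fix a b :: real
    have "(LINT x:{a..b}|lborel. indicat_real {c<..<d} x *\<^sub>R F x) = (LINT x:{max a c<..<min b d}|lborel. F x)"
      unfolding set_lebesgue_integral_def
    proof (rule integral_cong_AE)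
      have 1: "(\<lambda>x. indicat_real {c<..<d} x *\<^sub>R F x) \<in> borel_measurable lborel"
        using Ioo_integral_eq(1)[OF F] by (simp add: set_integrable_def borel_measurable_integrable)
      then show "(\<lambda>x. indicat_real {a..b} x *\<^sub>R indicat_real {c<..<d} x *\<^sub>R F x) \<in> borel_measurable lborel"
        by (rule borel_measurable_scaleR[rotated]) simp
      have "(\<lambda>x. indicat_real {max a c<..<min b d} x *\<^sub>R indicat_real {c<..<d} x *\<^sub>R F x) \<in> borel_measurable lborel"
        by (rule borel_measurable_scaleR[OF _ 1]) simp
      then show "(\<lambda>x. indicat_real {max a c<..<min b d} x *\<^sub>R F x) \<in> borel_measurable lborel"
        by (rule back_subst[of "\<lambda>f. f \<in> _"]) (auto simp: fun_eq_iff indicator_def)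
      show "AE x in lborel. indicat_real {a..b} x *\<^sub>R indicat_real {c<..<d} x *\<^sub>R F x
          = indicat_real {max a c<..<min b d} x *\<^sub>R F x"
        using AE_lborel_singleton[of a] AE_lborel_singleton[of b]
        by eventually_elim (auto simp: indicator_def)
    qed
    also have "\<dots> = 0"
    proof (cases "max a c < min b d")
      case True
      then show ?thesis by (intro 0) auto
    next
      case False
      then have "{max a c<..<min b d} = {}" by (simp only: greaterThanLessThan_empty_iff not_less)
      then show ?thesis by (simp add: set_lebesgue_integral_def)
    qed
    finally show "(LINT x:{a..b}|lborel. indicat_real {c<..<d} x *\<^sub>R F x) = 0" .
  qed
  then show ?thesis by (auto simp: indicator_def elim!: eventually_mono)
qed

text \<open>Testing with bumps shows that the difference of the two candidates pairs to zero with
  each bump; in the limit its integral over every open subinterval is zero.\<close>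

lemma weak_deriv_unique_on_Ioo:
  assumes "has_weak_deriv S f g" "has_weak_deriv S f h" "{c<..<d} \<subseteq> S"
  shows "AE x in lborel. x \<in> {c<..<d} \<longrightarrow> rep_l2 g x = rep_l2 h x"
proof -
  note si = rep_l2_set_integrable[of c d]
  have gh: "set_integrable lborel {c..d} (\<lambda>x. rep_l2 g x - rep_l2 h x)"
    by (rule set_integral_diff(1)[OF si si])
  have "AE x in lborel. x \<in> {c<..<d} \<longrightarrow> rep_l2 g x - rep_l2 h x = 0"
  proof (rule AE_zero_if_Ioo_integrals_zero[OF gh])
    fix s t assume st: "c \<le> s" "s < t" "t \<le> d"
    have "(LINT x:{c<..<d}|lborel. (rep_l2 g x - rep_l2 h x) * of_real (bump s t n x)) = 0" for n
    proof -
      have 0: "bump s t n x = 0" if "x \<notin> {c<..<d}" for x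
        by (rule bump_eq_0) (use st that in auto)
      have res: "(LINT x:S|lborel. rep_l2 k x * of_real (bump s t n x))
          = (LINT x:{c<..<d}|lborel. rep_l2 k x * of_real (bump s t n x))" for k
        by (rule set_lebesgue_integral_restrict[OF assms(3)]) (simp add: 0)
      have "{s<..<t} \<subseteq> {c<..<d}" using st by auto
      then have bt: "bump s t n \<in> test_functions S"
        using bump_test_function[OF st(2)] assms(3) by blast
      have "(LINT x:S|lborel. rep_l2 g x * of_real (bump s t n x))
          = (LINT x:S|lborel. rep_l2 h x * of_real (bump s t n x))"
        using bspec[OF assms(1)[unfolded has_weak_deriv_def] bt] bspec[OF assms(2)[unfolded has_weak_deriv_def] bt]
        by simp
      then have "(LINT x:{c<..<d}|lborel. rep_l2 g x * of_real (bump s t n x))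
          = (LINT x:{c<..<d}|lborel. rep_l2 h x * of_real (bump s t n x))"
        unfolding res .
      then show ?thesis
        unfolding left_diff_distrib
        by (subst set_integral_diff(2)[OF Ioo_integral_eq(1) Ioo_integral_eq(1)])
          (auto intro!: set_integrable_mult_continuous si bump_continuous)
    qed
    with bump_integral_tendsto[OF gh st]
    show "(LINT x:{s<..<t}|lborel. rep_l2 g x - rep_l2 h x) = 0"
      by (simp add: LIMSEQ_const_iff)
  qed
  then show ?thesis by simp
qed

lemma smooth_diff_scale:
  fixes f g :: "real \<Rightarrow> real"
  assumes "\<And>n x. (deriv ^^ n) f field_differentiable at x" "\<And>n x. (deriv ^^ n) g field_differentiable at x"
  shows "(deriv ^^ n) (\<lambda>x. f x - k * g x) field_differentiable at x"
proof (rule funpow_deriv_differentiable[where \<F> = "{h. \<exists>f g. (\<forall>n x. (deriv ^^ n) f field_differentiable at x)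
    \<and> (\<forall>n x. (deriv ^^ n) g field_differentiable at x) \<and> h = (\<lambda>x. f x - k * g x)}"])
  fix h assume "h \<in> {h. \<exists>f g. (\<forall>n x. (deriv ^^ n) f field_differentiable at x)
    \<and> (\<forall>n x. (deriv ^^ n) g field_differentiable at x) \<and> h = (\<lambda>x. f x - k * g x)}"
  then obtain f g :: "real \<Rightarrow> real" where fg: "\<And>n x. (deriv ^^ n) f field_differentiable at x"
    "\<And>n x. (deriv ^^ n) g field_differentiable at x" and h: "h = (\<lambda>x. f x - k * g x)"
    by blast
  have "(deriv ^^ n) (deriv f) field_differentiable at x" "(deriv ^^ n) (deriv g) field_differentiable at x" for n x
    using fg[of "Suc n" x] by (simp_all add: funpow_swap1)
  moreover have "(h has_field_derivative deriv f x - k * deriv g x) (at x)" for x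
    unfolding h using fg[of 0 x]
    by (intro derivative_intros DERIV_cmult) (auto intro: field_differentiable_derivI)
  ultimately show "\<exists>h'\<in>{h. \<exists>f g. (\<forall>n x. (deriv ^^ n) f field_differentiable at x)
    \<and> (\<forall>n x. (deriv ^^ n) g field_differentiable at x) \<and> h = (\<lambda>x. f x - k * g x)}.
      \<forall>x. (h has_field_derivative h' x) (at x)"
    by (intro bexI[of _ "\<lambda>x. deriv f x - k * deriv g x"]) blast+
qed (use assms in blast)

text \<open>The primitive starting at \<open>c\<close> vanishes left of the support of
  \<open>\<psi>\<close>, and the zero mean makes it vanish right of the support as well, so its
  support is compact.\<close>

lemma test_function_antiderivative:
  fixes \<psi> :: "real \<Rightarrow> real"
  assumes smooth: "\<And>n x. (deriv ^^ n) \<psi> field_differentiable at x"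
    and pq: "c < p" "p \<le> q" "q < d" and supp: "\<And>x. x \<notin> {p..q} \<Longrightarrow> \<psi> x = 0"
    and mean: "integral {c..d} \<psi> = 0"
  obtains \<phi> where "\<phi> \<in> test_functions {c<..<d}" "deriv \<phi> = \<psi>"
proof -
  define \<phi> where "\<phi> x = (if x \<in> {c..d} then integral {c..x} \<psi> else 0)" for x
  have \<psi>c: "continuous_on A \<psi>" for A
    using smooth[of 0] by (auto intro!: continuous_at_imp_continuous_on field_differentiable_imp_continuous_at)
  have \<psi>i: "\<psi> integrable_on {x..y}" for x y
    by (rule integrable_continuous_real[OF \<psi>c])
  have z: "integral {x..y} \<psi> = 0" if "\<And>t. t \<in> {x..y} \<Longrightarrow> \<psi> t = 0" for x y
    using integral_cong[of "{x..y}" \<psi> "\<lambda>_. 0"] that by simp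
  have 0: "\<phi> x = 0" if "x < p \<or> q < x" for x
  proof (cases "x \<in> {c..d}")
    case True
    show ?thesis
    proof (cases "x < p")
      case True
      then show ?thesis by (auto simp: \<phi>_def intro!: z supp)
    next
      case False
      then have "q < x" using that by simp
      then have "integral {x..d} \<psi> = 0" by (auto intro!: z supp)
      then show ?thesis
        using Henstock_Kurzweil_Integration.integral_combine[of c x d \<psi>] True \<psi>i mean
        by (simp add: \<phi>_def)
    qed
  next
    case False
    then show ?thesis by (simp only: \<phi>_def if_False)
  qed
  have d: "(\<phi> has_field_derivative \<psi> x) (at x)" for x
  proof -
    consider "x < p" | "q < x" | "c < x" "x < d" using pq by linarith
    then show ?thesis
    proof cases
      case 1
      have "((\<lambda>_. 0) has_field_derivative 0) (at x)" by simp
      then have "(\<phi> has_field_derivative 0) (at x)"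
        by (rule has_field_derivative_transform_within[of _ _ _ _ "p - x"]) (use 1 in \<open>auto simp: dist_real_def intro!: 0\<close>)
      then show ?thesis using supp 1 by simp
    next
      case 2
      have "((\<lambda>_. 0) has_field_derivative 0) (at x)" by simp
      then have "(\<phi> has_field_derivative 0) (at x)"
        by (rule has_field_derivative_transform_within[of _ _ _ _ "x - q"]) (use 2 in \<open>auto simp: dist_real_def intro!: 0\<close>)
      then show ?thesis using supp 2 by simp
    next
      case 3
      have "((\<lambda>u. integral {c..u} \<psi>) has_field_derivative \<psi> x) (at x within {c..d})"
        by (rule integral_has_real_derivative[OF \<psi>c]) (use 3 in auto)
      then have "((\<lambda>u. integral {c..u} \<psi>) has_field_derivative \<psi> x) (at x)"
        using 3 by (simp add: at_within_Icc_at)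
      then show ?thesis
        by (rule has_field_derivative_transform_within[of _ _ _ _ "min (x - c) (d - x)"])
          (use 3 in \<open>auto simp: \<phi>_def dist_real_def\<close>)
    qed
  qed
  then have d\<phi>: "deriv \<phi> = \<psi>" by (auto intro: DERIV_imp_deriv)
  have "(deriv ^^ n) \<phi> field_differentiable at x" for n x
  proof (cases n)
    case 0
    then show ?thesis using d[of x] by (auto simp: field_differentiable_def)
  next
    case (Suc j)
    then show ?thesis using smooth[of j x] d\<phi> by (simp add: funpow_swap1)
  qed
  moreover have "compact {p..q}" "{p..q} \<subseteq> {c<..<d}" "\<And>x. x \<notin> {p..q} \<Longrightarrow> \<phi> x = 0"
    using pq 0 by (auto simp: not_le)
  ultimately have "\<phi> \<in> test_functions {c<..<d}"
    unfolding test_functions_def mem_Collect_eq by blast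
  then show ?thesis using d\<phi> that by blast
qed

lemma bump_integral_pos: "s < t \<Longrightarrow> 0 < integral {s..t} (bump s t 1)"
proof -
  assume st: "s < t"
  have "integral {s..t} (bump s t 1) \<noteq> 0"
  proof
    assume "integral {s..t} (bump s t 1) = 0"
    then have "bump s t 1 ((s + t) / 2) = 0"
      using integral_eq_0_iff[OF bump_continuous, of s t s t 1] st bump_bounds by auto
    then show False
      using st by (simp add: bump_def flat_def)
  qed
  moreover have "0 \<le> integral {s..t} (bump s t 1)"
    by (rule Henstock_Kurzweil_Integration.integral_nonneg)
      (auto intro!: integrable_continuous_real bump_continuous bump_bounds)
  ultimately show ?thesis by simp
qed

text \<open>Not every bump is the derivative of a test function, but a bump minus a suitable
  multiple of one fixed bump has mean zero and is. Hence \<open>F\<close> pairs with all bumps as a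
  constant does.\<close>

lemma du_bois_reymond:
  fixes F :: "real \<Rightarrow> complex"
  assumes F: "set_integrable lborel {c..d} F" and cd: "c < d"
    and 0: "\<And>\<phi>. \<phi> \<in> test_functions {c<..<d} \<Longrightarrow> (LINT x:{c<..<d}|lborel. F x * of_real (deriv \<phi> x)) = 0"
  shows "\<exists>C. AE x in lborel. x \<in> {c<..<d} \<longrightarrow> F x = C"
proof -
  define \<beta> where "\<beta> = integral {c..d} (bump c d 1)"
  have \<beta>: "\<beta> > 0" unfolding \<beta>_def using bump_integral_pos[OF cd] .
  define E where "E = (LINT x:{c<..<d}|lborel. F x * of_real (bump c d 1 x))"
  \<comment> \<open>The constant must be the mean of \<open>F\<close> weighted by the fixed bump
    \<open>bump c d 1\<close>.\<close>
  define C where "C = E / of_real \<beta>"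
  have FC: "set_integrable lborel {c..d} (\<lambda>x. F x - C)"
    by (intro set_integral_diff F set_integrable_continuous_Icc continuous_on_const)
  have "AE x in lborel. x \<in> {c<..<d} \<longrightarrow> F x - C = 0"
  proof (rule AE_zero_if_Ioo_integrals_zero[OF FC])
    fix s t assume st: "c \<le> s" "s < t" "t \<le> d"
    have "(LINT x:{c<..<d}|lborel. (F x - C) * of_real (bump s t n x)) = 0" for n
    proof -
      \<comment> \<open>Chosen so that \<open>bump s t n - \<kappa> * bump c d 1\<close> has mean
        zero.\<close>
      define \<kappa> where "\<kappa> = integral {c..d} (bump s t n) / \<beta>"
      obtain p q where pq: "s < p" "q < t" "\<And>x. x \<notin> {p..q} \<Longrightarrow> bump s t n x = 0"
        by (rule bump_support[OF st(2), of n]) (rule that; blast)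
      obtain p' q' where pq': "c < p'" "q' < d" "\<And>x. x \<notin> {p'..q'} \<Longrightarrow> bump c d 1 x = 0"
        by (rule bump_support[OF cd, of 1]) (rule that; blast)
      \<comment> \<open>The fixed bump is positive at the midpoint, which therefore lies in
        \<open>{p'..q'}\<close>.\<close>
      have p'q': "p' \<le> q'"
        using pq'(3)[of "(c + d) / 2"] cd by (fastforce simp: bump_def flat_def)
      obtain \<phi> where \<phi>: "\<phi> \<in> test_functions {c<..<d}" "deriv \<phi> = (\<lambda>x. bump s t n x - \<kappa> * bump c d 1 x)"
      proof (rule test_function_antiderivative)
        show "(deriv ^^ j) (\<lambda>x. bump s t n x - \<kappa> * bump c d 1 x) field_differentiable at x" for j x
          by (intro smooth_diff_scale bump_smooth)
        show "c < min p p'" "min p p' \<le> max q q'" "max q q' < d"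
          using pq pq' st p'q' by auto
        show "bump s t n x - \<kappa> * bump c d 1 x = 0" if "x \<notin> {min p p'..max q q'}" for x
        proof -
          have "x \<notin> {p..q}" "x \<notin> {p'..q'}" using that by auto
          then show ?thesis using pq(3) pq'(3) by simp
        qed
        have "integral {c..d} (\<lambda>x. bump s t n x - \<kappa> * bump c d 1 x)
            = integral {c..d} (bump s t n) - integral {c..d} (\<lambda>x. \<kappa> * bump c d 1 x)"
          by (rule Henstock_Kurzweil_Integration.integral_diff)
            (intro integrable_continuous_real continuous_intros bump_continuous)+
        also have "\<dots> = 0"
          using \<beta> by (simp add: \<kappa>_def \<beta>_def)
        finally show "integral {c..d} (\<lambda>x. bump s t n x - \<kappa> * bump c d 1 x) = 0" .
      qed
      note si = Ioo_integral_eq(1)[OF set_integrable_mult_continuous[OF _ bump_continuous]]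
      have "(LINT x:{c<..<d}|lborel. F x * of_real (bump s t n x))
          - of_real \<kappa> * E = (LINT x:{c<..<d}|lborel. F x * of_real (bump s t n x) - of_real \<kappa> * (F x * of_real (bump c d 1 x)))"
        unfolding E_def
        by (subst set_integral_diff(2)) (auto intro!: si F set_integrable_mult_right)
      also have "\<dots> = 0"
        using 0[OF \<phi>(1)] unfolding \<phi>(2) by (simp add: algebra_simps)
      finally have 1: "(LINT x:{c<..<d}|lborel. F x * of_real (bump s t n x)) = of_real \<kappa> * E" by simp
      have "(LINT x:{c<..<d}|lborel. C * of_real (bump s t n x)) = C * of_real (integral {c..d} (bump s t n))"
      proof -
        have "(LINT x:{c<..<d}|lborel. C * of_real (bump s t n x)) = integral {c..d} (\<lambda>x. C * of_real (bump s t n x))"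
          by (intro Ioo_integral_eq(2) set_integrable_mult_continuous bump_continuous
              set_integrable_continuous_Icc continuous_on_const)
        also have "\<dots> = C * of_real (integral {c..d} (bump s t n))"
          by (rule integral_unique) (intro has_integral_mult_right has_integral_of_real integrable_integral
              integrable_continuous_real bump_continuous)
        finally show ?thesis .
      qed
      with 1 show ?thesis
        unfolding left_diff_distrib
        by (subst set_integral_diff(2))
          (use \<beta> in \<open>auto intro!: si F set_integrable_continuous_Icc simp: C_def \<kappa>_def\<close>)
    qed
    with bump_integral_tendsto[OF FC st]
    show "(LINT x:{s<..<t}|lborel. F x - C) = 0"
      by (simp add: LIMSEQ_const_iff)
  qed
  then show ?thesis by auto
qed

text \<open>If \<open>G\<close> is a primitive of \<open>g\<close>, then \<open>f - G\<close> is
  orthogonal to derivatives of test functions on the interval, hence constant almost everywhere; the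
  constant is absorbed into the primitive.\<close>

lemma weak_deriv_imp_primitive:
  assumes w: "has_weak_deriv S f g" and cd: "c < d" "{c<..<d} \<subseteq> S"
  obtains r where "primitive_on c d r (rep_l2 g)"
    "AE x in lborel. x \<in> {c<..<d} \<longrightarrow> rep_l2 f x = r x"
proof -
  define G where "G x = integral {c..x} (rep_l2 g)" for x
  have gi: "rep_l2 g integrable_on {c..d}"
    by (rule set_borel_integral_eq_integral(1)[OF rep_l2_set_integrable])
  have G: "primitive_on c d G (rep_l2 g)"
    using primitive_on_integral[OF gi, of 0] by (simp add: G_def[abs_def])
  have Gi: "set_integrable lborel {c..d} G"
    by (rule set_integrable_continuous_Icc[OF primitive_on_continuous[OF G]])
  have "\<exists>C. AE x in lborel. x \<in> {c<..<d} \<longrightarrow> rep_l2 f x - G x = C"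
  proof (rule du_bois_reymond)
    show "set_integrable lborel {c..d} (\<lambda>x. rep_l2 f x - G x)"
      by (rule set_integral_diff(1)[OF rep_l2_set_integrable Gi])
    fix \<phi> assume \<phi>: "\<phi> \<in> test_functions {c<..<d}"
    note \<phi>D = test_functionD[OF \<phi>]
    have \<phi>S: "\<phi> \<in> test_functions S"
      using \<phi> cd(2) unfolding test_functions_def mem_Collect_eq by (meson order_trans)
    \<comment> \<open>The derivative vanishes too because \<open>\<phi>\<close> is zero on the open
      complement of its compact support. This permits shrinking integrals over \<open>S\<close> to
      the interval.\<close>
    have out: "\<phi> x = 0" "deriv \<phi> x = 0" if "x \<notin> {c<..<d}" for x
    proof -
      obtain K where K: "compact K" "K \<subseteq> {c<..<d}" "\<forall>x. x \<notin> K \<longrightarrow> \<phi> x = 0"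
        using \<phi> by (auto simp: test_functions_def)
      then show "\<phi> x = 0" using that by blast
      have "open (- K)" "x \<in> - K" using K that compact_imp_closed by auto
      then have "((\<lambda>_. 0) has_field_derivative 0) (at x) \<longleftrightarrow> (\<phi> has_field_derivative 0) (at x)"
        using K(3) by (intro DERIV_cong_ev) (auto simp: eventually_nhds)
      then have "(\<phi> has_field_derivative 0) (at x)" by simp
      then show "deriv \<phi> x = 0" by (rule DERIV_imp_deriv)
    qed
    have "(LINT x:S|lborel. rep_l2 f x * of_real (deriv \<phi> x)) = - (LINT x:S|lborel. rep_l2 g x * of_real (\<phi> x))"
      using w \<phi>S by (simp add: has_weak_deriv_def)
    moreover have "(LINT x:S|lborel. rep_l2 f x * of_real (deriv \<phi> x))
        = (LINT x:{c<..<d}|lborel. rep_l2 f x * of_real (deriv \<phi> x))"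
      by (rule set_lebesgue_integral_restrict[OF cd(2)]) (simp add: out)
    moreover have "(LINT x:S|lborel. rep_l2 g x * of_real (\<phi> x)) = (LINT x:{c<..<d}|lborel. rep_l2 g x * of_real (\<phi> x))"
      by (rule set_lebesgue_integral_restrict[OF cd(2)]) (simp add: out)
    moreover have "(LINT x:{c<..<d}|lborel. G x * of_real (deriv \<phi> x)) = - (LINT x:{c<..<d}|lborel. rep_l2 g x * of_real (\<phi> x))"
    proof -
      from primitive_on_by_parts[OF G rep_l2_set_integrable \<phi>D(1,2)] cd(1) out[of c] out[of d] show ?thesis
        by (simp add: Ioo_integral_eq(2)[OF set_integrable_mult_continuous[OF Gi \<phi>D(2)]]
            Ioo_integral_eq(2)[OF set_integrable_mult_continuous[OF rep_l2_set_integrable \<phi>D(3)]] add_eq_0_iff2)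
    qed
    ultimately show "(LINT x:{c<..<d}|lborel. (rep_l2 f x - G x) * of_real (deriv \<phi> x)) = 0"
      unfolding left_diff_distrib
      by (subst set_integral_diff(2)[OF Ioo_integral_eq(1) Ioo_integral_eq(1)])
        (auto intro!: set_integrable_mult_continuous rep_l2_set_integrable Gi \<phi>D)
  qed (rule cd(1))
  then obtain C where C: "AE x in lborel. x \<in> {c<..<d} \<longrightarrow> rep_l2 f x - G x = C" by blast
  show ?thesis
  proof (rule that)
    show "primitive_on c d (\<lambda>x. C + G x) (rep_l2 g)"
      using primitive_on_integral[OF gi, of C] by (simp add: G_def)
    show "AE x in lborel. x \<in> {c<..<d} \<longrightarrow> rep_l2 f x = C + G x"
      using C by eventually_elim (auto simp: algebra_simps)
  qed
qed

section \<open>Traces and weak derivatives of explicit classes\<close>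

lemma continuous_AE_zero:
  fixes u :: "real \<Rightarrow> complex"
  assumes u: "continuous_on S u" and S: "open S" and ae: "AE x in lborel. x \<in> S \<longrightarrow> u x = 0" and x: "x \<in> S"
  shows "u x = 0"
proof (rule ccontr)
  assume "u x \<noteq> 0"
  define T where "T = {x \<in> S. u x \<noteq> 0}"
  have "open T"
  proof -
    have "T = S \<inter> u -` (- {0})" by (auto simp: T_def)
    then show ?thesis using continuous_open_preimage[OF u S, of "- {0}"] by auto
  qed
  moreover have "T \<noteq> {}" using x \<open>u x \<noteq> 0\<close> by (auto simp: T_def)
  ultimately have "\<not> negligible T" by (rule open_not_negligible)
  moreover have "negligible T"
  proof -
    obtain N where N: "N \<in> null_sets lborel" "{x \<in> space lborel. \<not> (x \<in> S \<longrightarrow> u x = 0)} \<subseteq> N"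
      using ae by (rule AE_E3) auto
    have "N \<in> null_sets lebesgue" using N(1) by (rule null_sets_completionI)
    then have "negligible N" by (simp add: negligible_iff_null_sets)
    then show ?thesis by (rule negligible_subset) (use N(2) in \<open>auto simp: T_def\<close>)
  qed
  ultimately show False by simp
qed

text \<open>Two continuous representatives agree almost everywhere on the open set \<open>S\<close>,
  hence everywhere on it, so they have the same limit at \<open>p\<close>; that limit is unique
  because \<open>p\<close> is a limit point of \<open>S\<close>.\<close>

lemma trace_on_class_on:
  fixes r :: "real \<Rightarrow> complex"
  assumes r: "continuous_on {a..b} r" and S: "S \<subseteq> {a..b}" "open S" and p: "p \<in> {a..b}" "p islimpt S"
  shows "trace_on S (class_on S r) p = r p"
  unfolding trace_on_def
proof (rule the_equality)
  have sq: "sq_on S r" using sq_on_continuous[OF r] S by auto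
  have rS: "continuous_on S r" by (rule continuous_on_subset[OF r S(1)])
  have rp: "(r \<longlongrightarrow> r p) (at p within S)"
    using r p(1) S(1) unfolding continuous_on_def by (meson tendsto_within_subset)
  have ae: "AE x in lborel. x \<in> S \<longrightarrow> r x = rep_l2 (class_on S r) x"
    using rep_class_on[OF sq] by eventually_elim auto
  show "\<exists>r'. continuous_on S r' \<and> (AE x in lborel. x \<in> S \<longrightarrow> r' x = rep_l2 (class_on S r) x) \<and>
      (r' \<longlongrightarrow> r p) (at p within S)"
    using rS ae rp by blast
  fix c assume "\<exists>r'. continuous_on S r' \<and> (AE x in lborel. x \<in> S \<longrightarrow> r' x = rep_l2 (class_on S r) x) \<and>
      (r' \<longlongrightarrow> c) (at p within S)"
  then obtain r' where r': "continuous_on S r'" "AE x in lborel. x \<in> S \<longrightarrow> r' x = rep_l2 (class_on S r) x"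
    "(r' \<longlongrightarrow> c) (at p within S)" by blast
  have "r' x - r x = 0" if "x \<in> S" for x
  proof (rule continuous_AE_zero[OF _ S(2) _ that])
    show "continuous_on S (\<lambda>x. r' x - r x)" by (intro continuous_intros r' rS)
    show "AE x in lborel. x \<in> S \<longrightarrow> r' x - r x = 0"
      using ae r'(2) by eventually_elim auto
  qed
  then have "\<forall>\<^sub>F x in at p within S. r' x = r x"
    by (auto simp: eventually_at_filter)
  with r'(3) have "(r \<longlongrightarrow> c) (at p within S)"
    by (rule Lim_transform_eventually)
  then show "c = r p"
    using rp p(2) by (intro tendsto_unique[of "at p within S"]) (auto simp: trivial_limit_within)
qed

text \<open>Two intervals are allowed for the sake of \<open>J\<close>; the single interval
  \<open>I\<close> is covered by taking the second one empty.\<close>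

lemma weak_deriv_eqI:
  assumes S: "S = {c<..<d} \<union> {c'<..<d'}"
    and g: "has_weak_deriv S f g" "g \<in> L2_on S"
  shows "weak_deriv S f = g"
  unfolding weak_deriv_def
proof (rule the_equality)
  fix h assume h: "h \<in> L2_on S \<and> has_weak_deriv S f h"
  show "h = g"
  proof (rule l2_eqI)
    have "AE x in lborel. x \<in> {c<..<d} \<longrightarrow> rep_l2 h x = rep_l2 g x"
      "AE x in lborel. x \<in> {c'<..<d'} \<longrightarrow> rep_l2 h x = rep_l2 g x"
      by (rule weak_deriv_unique_on_Ioo[of S f]; use h g S in simp)+
    moreover have "AE x in lborel. x \<notin> S \<longrightarrow> rep_l2 h x = rep_l2 g x"
      using h g(2) unfolding L2_on_def mem_Collect_eq by (auto elim: AE_mp)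
    ultimately show "AE x in lborel. rep_l2 h x = rep_l2 g x"
      by eventually_elim (auto simp: S)
  qed
qed (use g in auto)

section \<open>Glued functions on the two domains\<close>

locale transmission_interval =
  fixes L1 L2 L3 :: real
  assumes L_less: "0 < L1" "L1 < L2" "L2 < L3"
begin

abbreviation "I \<equiv> I_dom L1 L2"
abbreviation "J \<equiv> J_dom L1 L2 L3"

text \<open>One function on all of \<open>[0, L3]\<close> represents elements of \<open>H1\<close>
  on \<open>I\<close> and on \<open>J\<close> alike; traces become its values and weak derivatives
  the classes of \<open>g\<close>.\<close>

definition ac_pair :: "(real \<Rightarrow> complex) \<Rightarrow> (real \<Rightarrow> complex) \<Rightarrow> bool" where
  "ac_pair r g \<longleftrightarrow> primitive_on 0 L3 r g \<and> sq_on {0..L3} g"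

lemma IJ_simps: "I = {L1<..<L2}" "J = {0<..<L1} \<union> {L2<..<L3}"
  by (auto simp: I_dom_def J_dom_def)

lemma IJ_borel [simp, measurable]: "I \<in> sets borel" "J \<in> sets borel"
  by (auto simp: IJ_simps)

lemma IJ_subset: "S \<in> {I, J} \<Longrightarrow> S \<subseteq> {0..L3}"
  using L_less by (auto simp: IJ_simps)

lemma sq_on_subset:
  assumes "sq_on {0..L3} g" "S \<in> {I, J}"
  shows "sq_on S g"
proof -
  have "(\<lambda>x. if x \<in> S then if x \<in> {0..L3} then g x else 0 else 0) = (\<lambda>x. if x \<in> S then g x else 0)"
    using IJ_subset[OF assms(2)] by (intro ext) (simp add: subset_iff)
  moreover have "S \<in> sets borel" using assms(2) by auto
  ultimately show ?thesis
    using square_integrable_imp_sq_on[OF assms(1)[unfolded sq_on_def], of S]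
    unfolding sq_on_def by (simp only:)
qed

lemma ac_pair_continuous: "ac_pair r g \<Longrightarrow> continuous_on {0..L3} r"
  by (auto simp: ac_pair_def intro: primitive_on_continuous)

lemma ac_pair_sq:
  assumes "ac_pair r g" "S \<in> {I, J}"
  shows "sq_on S r" "sq_on S g"
  using assms sq_on_continuous[OF ac_pair_continuous[OF assms(1)] _ IJ_subset[OF assms(2)]] sq_on_subset[of g S]
  by (auto simp: ac_pair_def)

lemma ac_pair_sq_IJ:
  assumes "ac_pair r g"
  shows "sq_on I r" "sq_on J r" "sq_on I g" "sq_on J g"
  using ac_pair_sq[OF assms] by auto

lemma ac_pair_add: "ac_pair r g \<Longrightarrow> ac_pair s h \<Longrightarrow> ac_pair (\<lambda>x. r x + s x) (\<lambda>x. g x + h x)"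
  by (simp add: ac_pair_def primitive_on_add sq_on_add)

lemma ac_pair_scale: "ac_pair r g \<Longrightarrow> ac_pair (\<lambda>x. c * r x) (\<lambda>x. c * g x)"
  by (simp add: ac_pair_def primitive_on_scale sq_on_scale)

lemma ac_pair_diff: "ac_pair r g \<Longrightarrow> ac_pair s h \<Longrightarrow> ac_pair (\<lambda>x. r x - s x) (\<lambda>x. g x - h x)"
  by (simp add: ac_pair_def primitive_on_diff sq_on_diff)

lemma trace_class:
  assumes "continuous_on {0..L3} r"
  shows "p \<in> {L1, L2} \<Longrightarrow> trace_on I (class_on I r) p = r p"
    and "p \<in> {0, L1, L2, L3} \<Longrightarrow> trace_on J (class_on J r) p = r p"
proof -
  have I: "L1 islimpt I" "L2 islimpt I"
    using L_less by (auto simp: IJ_simps islimpt_greaterThanLessThan1 islimpt_greaterThanLessThan2)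
  have J: "0 islimpt J" "L1 islimpt J" "L2 islimpt J" "L3 islimpt J"
    using L_less by (auto simp: IJ_simps islimpt_Un islimpt_greaterThanLessThan1 islimpt_greaterThanLessThan2)
  have o: "open I" "open J" by (auto simp: IJ_simps)
  show "p \<in> {L1, L2} \<Longrightarrow> trace_on I (class_on I r) p = r p"
    by (rule trace_on_class_on[OF assms IJ_subset o(1)]) (use L_less I in auto)
  show "p \<in> {0, L1, L2, L3} \<Longrightarrow> trace_on J (class_on J r) p = r p"
    by (rule trace_on_class_on[OF assms IJ_subset o(2)]) (use L_less J in auto)
qed

lemma ac_pair_H1:
  assumes "ac_pair r g" and S: "S \<in> {I, J}"
  shows "class_on S r \<in> H1_on S" "weak_deriv S (class_on S r) = class_on S g"
proof -
  have p: "primitive_on 0 L3 r g" using assms(1) by (simp add: ac_pair_def)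
  note sq = ac_pair_sq[OF assms]
  have r: "AE x in lborel. x \<in> S \<longrightarrow> rep_l2 (class_on S r) x = r x"
    using rep_class_on[OF sq(1)] by auto
  have P: "primitive_on c d r (rep_l2 (class_on S g))" if "{c<..<d} \<subseteq> S" "0 \<le> c" "d \<le> L3" for c d
  proof (rule primitive_on_cong_AE)
    show "primitive_on c d r g" by (rule primitive_on_subset[OF p that(2,3)])
    show "AE x in lborel. x \<in> {c<..<d} \<longrightarrow> rep_l2 (class_on S g) x = g x"
      using rep_class_on[OF sq(2)] by eventually_elim (use that in auto)
  qed simp
  consider "S = I" | "S = J" using S by auto
  then have w: "has_weak_deriv S (class_on S r) (class_on S g)"
  proof cases
    case 1
    show ?thesis
      unfolding 1 using P[of L1 L2] r L_less
      by (auto simp: 1 IJ_simps intro!: has_weak_deriv_Ioo)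
  next
    case 2
    have "has_weak_deriv ({0<..<L1} \<union> {L2<..<L3}) (class_on S r) (class_on S g)"
    proof (rule has_weak_deriv_two_Ioo)
      show "primitive_on 0 L1 r (rep_l2 (class_on S g))" "primitive_on L2 L3 r (rep_l2 (class_on S g))"
        using P L_less by (auto simp: 2 IJ_simps)
      show "AE x in lborel. x \<in> {0<..<L1} \<longrightarrow> rep_l2 (class_on S r) x = r x"
        "AE x in lborel. x \<in> {L2<..<L3} \<longrightarrow> rep_l2 (class_on S r) x = r x"
        using r by (eventually_elim, simp add: 2 IJ_simps)+
    qed (use L_less in auto)
    then show ?thesis by (simp add: 2 IJ_simps)
  qed
  show "class_on S r \<in> H1_on S"
    using w class_on_L2[OF sq(1)] class_on_L2[OF sq(2)] by (auto simp: H1_on_def)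
  have "S = {L1<..<L2} \<union> {L2<..<L2} \<or> S = {0<..<L1} \<union> {L2<..<L3}"
    using S by (auto simp: IJ_simps)
  then obtain c d c' d' where "S = {c<..<d} \<union> {c'<..<d'}" by blast
  then show "weak_deriv S (class_on S r) = class_on S g"
    by (rule weak_deriv_eqI[OF _ w class_on_L2[OF sq(2)]])
qed

text \<open>On each component the du Bois-Reymond lemma provides a primitive; it remains to extend
  it to the rest of \<open>[0, L3]\<close> without losing continuity.\<close>

lemma H1_ac_pair:
  assumes f: "f \<in> H1_on S" and S: "S \<in> {I, J}"
  obtains r g where "ac_pair r g" "f = class_on S r"
proof -
  obtain g where g: "g \<in> L2_on S" "has_weak_deriv S f g" and fL: "f \<in> L2_on S"
    using f by (auto simp: H1_on_def)
  have sqg: "sq_on {0..L3} (rep_l2 g)"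
    by (rule square_integrable_imp_sq_on[OF square_integrable_rep]) simp
  have ext: "primitive_on c d r h" if "\<And>x. c \<le> x \<Longrightarrow> x \<le> d \<Longrightarrow> r x = k"
    "AE x in lborel. x \<in> {c<..<d} \<longrightarrow> h x = 0" for c d r h and k :: complex
    by (rule primitive_on_cong_AE[OF primitive_on_const]) (use that in auto)
  consider "S = I" | "S = J" using S by auto
  then have "\<exists>r h. ac_pair r h \<and> (AE x in lborel. x \<in> S \<longrightarrow> rep_l2 f x = r x)"
  proof cases
    case 1
    obtain r where r: "primitive_on L1 L2 r (rep_l2 g)" "AE x in lborel. x \<in> {L1<..<L2} \<longrightarrow> rep_l2 f x = r x"
      by (rule weak_deriv_imp_primitive[OF g(2) L_less(2)]) (auto simp: 1 IJ_simps)
    \<comment> \<open>Constant extension: its derivative can remain \<open>rep_l2 g\<close>, which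
      vanishes almost everywhere outside \<open>I\<close>.\<close>
    define R where "R x = (if x \<le> L1 then r L1 else if x \<ge> L2 then r L2 else r x)" for x
    have "primitive_on 0 L3 R (rep_l2 g)"
    proof (rule primitive_on_glue[OF primitive_on_glue])
      have z: "AE x in lborel. x \<notin> I \<longrightarrow> rep_l2 g x = 0"
        using g(1) 1 by (simp add: L2_on_def)
      show "primitive_on 0 L1 R (rep_l2 g)"
        by (rule ext[of _ _ _ "r L1"]) (use z in \<open>auto simp: R_def IJ_simps elim!: AE_mp\<close>)
      show "primitive_on L2 L3 R (rep_l2 g)"
        by (rule ext[of _ _ _ "r L2"]) (use z L_less in \<open>auto simp: R_def IJ_simps elim!: AE_mp\<close>)
      show "primitive_on L1 L2 R (rep_l2 g)"
        by (rule primitive_on_cong_AE[OF r(1)]) (use L_less in \<open>auto simp: R_def\<close>)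
    qed
    moreover have "AE x in lborel. x \<in> S \<longrightarrow> rep_l2 f x = R x"
      using r(2) by eventually_elim (auto simp: 1 IJ_simps R_def)
    ultimately show ?thesis using sqg by (auto simp: ac_pair_def)
  next
    case 2
    obtain r where r: "primitive_on 0 L1 r (rep_l2 g)" "AE x in lborel. x \<in> {0<..<L1} \<longrightarrow> rep_l2 f x = r x"
      by (rule weak_deriv_imp_primitive[OF g(2) L_less(1)]) (auto simp: 2 IJ_simps)
    obtain r' where r': "primitive_on L2 L3 r' (rep_l2 g)" "AE x in lborel. x \<in> {L2<..<L3} \<longrightarrow> rep_l2 f x = r' x"
      by (rule weak_deriv_imp_primitive[OF g(2) L_less(3)]) (auto simp: 2 IJ_simps)
    \<comment> \<open>The slope of the affine bridge across the gap \<open>[L1, L2]\<close> between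
      the two components of \<open>J\<close>.\<close>
    define k where "k = (r' L2 - r L1) / of_real (L2 - L1)"
    define R where "R x = (if x \<le> L1 then r x else if x \<ge> L2 then r' x else r L1 + (x - L1) *\<^sub>R k)" for x
    define h where "h x = (if x \<in> {L1..L2} then k else rep_l2 g x)" for x
    have "primitive_on 0 L3 R h"
    proof (rule primitive_on_glue[OF primitive_on_glue])
      show "primitive_on 0 L1 R h"
        by (rule primitive_on_cong_AE[OF r(1)]) (auto simp: R_def h_def)
      show "primitive_on L2 L3 R h"
        by (rule primitive_on_cong_AE[OF r'(1)]) (use L_less in \<open>auto simp: R_def h_def\<close>)
      have R: "R x = r L1 + (x - L1) *\<^sub>R k" if "L1 \<le> x" "x \<le> L2" for x
      proof -
        have "(L2 - L1) *\<^sub>R k = r' L2 - r L1"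
          using L_less by (simp add: k_def scaleR_conv_of_real del: of_real_diff)
        then show ?thesis using that by (auto simp: R_def)
      qed
      show "primitive_on L1 L2 R h"
      proof (rule primitive_on_cong_AE)
        show "primitive_on L1 L2 (\<lambda>x. r L1 + (x - L1) *\<^sub>R k) (\<lambda>x. k)"
          unfolding primitive_on_def
        proof (intro allI impI)
          fix x y assume "L1 \<le> x" "x \<le> y" "y \<le> L2"
          then show "((\<lambda>x. k) has_integral r L1 + (y - L1) *\<^sub>R k - (r L1 + (x - L1) *\<^sub>R k)) {x..y}"
            using has_integral_const_real[of k x y] by (simp add: algebra_simps)
        qed
      qed (use R in \<open>auto simp: h_def\<close>)
    qed
    moreover have "sq_on {0..L3} h"
    proof -
      have "h = (\<lambda>x. (if x \<in> {L1..L2} then k - rep_l2 g x else 0) + rep_l2 g x)"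
        by (auto simp: h_def)
      moreover have "sq_on {L1..L2} (\<lambda>x. k - rep_l2 g x)"
        by (intro sq_on_diff sq_on_continuous[of L1 L2] square_integrable_imp_sq_on[OF square_integrable_rep]) auto
      then have "sq_on {0..L3} (\<lambda>x. if x \<in> {L1..L2} then k - rep_l2 g x else 0)"
        unfolding sq_on_def[of "{L1..L2}"] by (rule square_integrable_imp_sq_on) simp
      ultimately show ?thesis using sq_on_add[OF _ sqg] by simp
    qed
    moreover have "AE x in lborel. x \<in> S \<longrightarrow> rep_l2 f x = R x"
      using r(2) r'(2) by eventually_elim (use L_less in \<open>auto simp: 2 IJ_simps R_def\<close>)
    ultimately show ?thesis by (auto simp: ac_pair_def)
  qed
  then obtain r h where rh: "ac_pair r h" "AE x in lborel. x \<in> S \<longrightarrow> rep_l2 f x = r x" by blast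
  show ?thesis
    by (rule that[OF rh(1) class_on_eqI[OF ac_pair_sq(1)[OF rh(1) S] fL rh(2)]])
qed

text \<open>Agreement at the two interfaces is precisely what the pieces need to form one primitive
  on \<open>[0, L3]\<close>. Both transmission conditions of the problem are used in this
  form.\<close>

lemma ac_pair_glue:
  assumes u: "ac_pair u g" and v: "ac_pair v h" and eq: "u L1 = v L1" "u L2 = v L2"
  obtains r k where "ac_pair r k" "class_on I u = class_on I r" "class_on J v = class_on J r"
    "\<And>x. x \<in> {L1..L2} \<Longrightarrow> r x = u x" "\<And>x. x \<in> {0..L1} \<union> {L2..L3} \<Longrightarrow> r x = v x"
    "\<And>x. x \<in> I \<Longrightarrow> k x = g x" "\<And>x. x \<in> J \<Longrightarrow> k x = h x"
proof -
  define r where "r x = (if x \<in> {L1..L2} then u x else v x)" for x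
  define k where "k x = (if x \<in> {L1..L2} then g x else h x)" for x
  have "primitive_on 0 L3 r k"
  proof (rule primitive_on_glue[OF primitive_on_glue])
    show "primitive_on 0 L1 r k"
      by (rule primitive_on_cong_AE[OF primitive_on_subset[of 0 L3 v h]])
        (use v eq L_less in \<open>auto simp: ac_pair_def r_def k_def\<close>)
    show "primitive_on L1 L2 r k"
      by (rule primitive_on_cong_AE[OF primitive_on_subset[of 0 L3 u g]])
        (use u eq L_less in \<open>auto simp: ac_pair_def r_def k_def\<close>)
    show "primitive_on L2 L3 r k"
      by (rule primitive_on_cong_AE[OF primitive_on_subset[of 0 L3 v h]])
        (use v eq L_less in \<open>auto simp: ac_pair_def r_def k_def\<close>)
  qed
  moreover have "sq_on {0..L3} k"
  proof -
    have "(\<lambda>x. if x \<in> {0..L3} then g x - h x else 0) = (\<lambda>x. (if x \<in> {0..L3} then g x else 0) - (if x \<in> {0..L3} then h x else 0))"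
      by auto
    have gh: "sq_on {0..L3} (\<lambda>x. g x - h x)"
      using u v by (auto simp: ac_pair_def intro: sq_on_diff)
    have "sq_on {L1..L2} (\<lambda>x. if x \<in> {0..L3} then g x - h x else 0)"
      by (rule square_integrable_imp_sq_on[OF gh[unfolded sq_on_def]]) simp
    then have "sq_on {0..L3} (\<lambda>x. if x \<in> {L1..L2} then if x \<in> {0..L3} then g x - h x else 0 else 0)"
      unfolding sq_on_def[of "{L1..L2}"] by (rule square_integrable_imp_sq_on) simp
    moreover have "k = (\<lambda>x. (if x \<in> {L1..L2} then if x \<in> {0..L3} then g x - h x else 0 else 0) + h x)"
      using L_less by (auto simp: k_def fun_eq_iff)
    ultimately show ?thesis
      using sq_on_add[of "{0..L3}" _ h] v by (simp add: ac_pair_def)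
  qed
  ultimately have ac: "ac_pair r k" by (simp add: ac_pair_def)
  show ?thesis
  proof (rule that[OF ac])
    show "class_on I u = class_on I r"
      unfolding class_on_def r_def by (intro arg_cong[of _ _ abs_l2]) (auto simp: IJ_simps)
    show "class_on J v = class_on J r"
      unfolding class_on_def r_def by (intro arg_cong[of _ _ abs_l2]) (use L_less in \<open>auto simp: IJ_simps\<close>)
  qed (use L_less eq in \<open>auto simp: r_def k_def IJ_simps\<close>)
qed

end

text \<open>The terms of the Neumann series: the \<open>n\<close>-th power of the Volterra operator
  applied to \<open>h\<close>.\<close>

primrec volterra_term :: "(real \<Rightarrow> 'a::euclidean_space \<Rightarrow> 'a) \<Rightarrow> (real \<Rightarrow> 'a) \<Rightarrow> nat \<Rightarrow> real \<Rightarrow> 'a" where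
  "volterra_term T h 0 x = h x"
| "volterra_term T h (Suc n) x = integral {0..x} (\<lambda>t. T t (volterra_term T h n t))"

section \<open>Linear Volterra equations\<close>

text \<open>Continuity of \<open>T\<close> in \<open>t\<close> is not assumed, only integrability
  along continuous functions, because the coefficients jump at the interfaces.\<close>

locale volterra =
  fixes T :: "real \<Rightarrow> 'a::euclidean_space \<Rightarrow> 'a" and L K :: real
  assumes L: "0 \<le> L" and K: "0 \<le> K"
    and T_bound: "\<And>t v. norm (T t v) \<le> K * norm v"
    and T_linear: "\<And>t. linear (T t)"
    and T_integrable: "\<And>y. continuous_on {0..L} y \<Longrightarrow> (\<lambda>t. T t (y t)) integrable_on {0..L}"
begin

lemma T_integrable_sub:
  "continuous_on {0..L} y \<Longrightarrow> x \<le> L \<Longrightarrow> (\<lambda>t. T t (y t)) integrable_on {0..x}"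
  by (rule integrable_on_subinterval[OF T_integrable]) auto

lemma continuous_step:
  "continuous_on {0..L} y \<Longrightarrow> continuous_on {0..L} (\<lambda>x. integral {0..x} (\<lambda>t. T t (y t)))"
  by (intro indefinite_integral_continuous_1 T_integrable)

text \<open>The induction step for the factorial decay of the Neumann series: integrating
  \<open>K * (K t)^n / n!\<close> gives \<open>(K x)^(n + 1) / (n + 1)!\<close>.\<close>

lemma power_integral_bound:
  assumes y: "continuous_on {0..L} y" and x: "x \<in> {0..L}"
    and b: "\<And>t. t \<in> {0..L} \<Longrightarrow> norm (y t) \<le> B * (K * t) ^ n / fact n"
  shows "norm (integral {0..x} (\<lambda>t. T t (y t))) \<le> B * (K * x) ^ Suc n / fact (Suc n)"
proof -
  have d: "((\<lambda>t. B * (K * t) ^ Suc n / fact (Suc n)) has_vector_derivative K * (B * (K * t) ^ n / fact n)) (at t within {0..x})" for t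
  proof -
    have "((\<lambda>t. (K * t) ^ Suc n) has_field_derivative real (Suc n) * (K * (K * t) ^ (Suc n - Suc 0))) (at t within {0..x})"
      by (rule DERIV_power) (auto intro!: derivative_eq_intros)
    from DERIV_cdivide[OF DERIV_cmult[OF this, of B], of "fact (Suc n)"]
    have "((\<lambda>t. B * (K * t) ^ Suc n / fact (Suc n)) has_field_derivative
        B * (real (Suc n) * (K * t) ^ n * K) / fact (Suc n)) (at t within {0..x})"
      by (simp only: diff_Suc_Suc diff_zero mult_ac)
    also have "B * (real (Suc n) * (K * t) ^ n * K) / fact (Suc n) = K * (B * (K * t) ^ n / fact n)"
      by (simp del: of_nat_Suc add: field_simps)
    finally show ?thesis by (simp add: has_real_derivative_iff_has_vector_derivative)
  qed
  have I: "((\<lambda>t. K * (B * (K * t) ^ n / fact n)) has_integral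
      (B * (K * x) ^ Suc n / fact (Suc n) - B * (K * 0) ^ Suc n / fact (Suc n))) {0..x}"
    by (rule fundamental_theorem_of_calculus[OF _ d]) (use x in auto)
  have "norm (integral {0..x} (\<lambda>t. T t (y t))) \<le> integral {0..x} (\<lambda>t. K * (B * (K * t) ^ n / fact n))"
  proof (rule integral_norm_bound_integral)
    fix t assume "t \<in> {0..x}"
    then have "norm (y t) \<le> B * (K * t) ^ n / fact n" using b x by auto
    then show "norm (T t (y t)) \<le> K * (B * (K * t) ^ n / fact n)"
      using order_trans[OF T_bound mult_left_mono[OF _ K]] by blast
  qed (use x y I in \<open>auto intro: T_integrable_sub\<close>)
  then show ?thesis using integral_unique[OF I] by simp
qed

lemma volterra_term_continuous:
  "continuous_on {0..L} h \<Longrightarrow> continuous_on {0..L} (volterra_term T h n)"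
  by (induction n) (auto intro: continuous_step simp: fun_eq_iff cong: continuous_on_cong)

lemma volterra_term_bound:
  assumes h: "continuous_on {0..L} h" "\<And>t. t \<in> {0..L} \<Longrightarrow> norm (h t) \<le> B"
  shows "x \<in> {0..L} \<Longrightarrow> norm (volterra_term T h n x) \<le> B * (K * x) ^ n / fact n"
proof (induction n arbitrary: x)
  case (Suc n)
  then show ?case
    using power_integral_bound[OF volterra_term_continuous[OF h(1)] Suc.prems Suc.IH] by simp
qed (use h in simp)

text \<open>The Neumann series is dominated by the exponential series, which gives uniform
  convergence, a continuous sum and the bound \<open>B * exp (K * L)\<close>.\<close>

lemma solution:
  assumes h: "continuous_on {0..L} h" "\<And>t. t \<in> {0..L} \<Longrightarrow> norm (h t) \<le> B"
  shows "\<exists>y. continuous_on {0..L} y \<and>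
    (\<forall>x\<in>{0..L}. y x = h x + integral {0..x} (\<lambda>t. T t (y t)) \<and> norm (y x) \<le> B * exp (K * L))"
proof -
  note cont = volterra_term_continuous[OF h(1)]
  have bound: "norm (volterra_term T h n x) \<le> B * (K * x) ^ n / fact n" if "x \<in> {0..L}" for n x
    by (rule volterra_term_bound[OF h(1) _ that]) (rule h(2))
  have B: "0 \<le> B" using h(2)[of 0] L norm_ge_zero[of "h 0"] by (meson atLeastAtMost_iff order_refl order_trans)
  have bL: "norm (volterra_term T h n x) \<le> B * ((K * L) ^ n / fact n)" if "x \<in> {0..L}" for n x
  proof -
    have "B * (K * x) ^ n / fact n \<le> B * (K * L) ^ n / fact n"
      using that K B by (intro divide_right_mono mult_left_mono power_mono) auto
    then show ?thesis using bound[OF that, of n] by simp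
  qed
  have sums: "(\<lambda>n. B * ((K * L) ^ n / fact n)) sums (B * exp (K * L))"
    using exp_converges[of "K * L"] by (intro sums_mult) (simp add: divide_inverse mult.commute)
  define y where "y x = (\<Sum>n. volterra_term T h n x)" for x
  have unif: "uniform_limit {0..L} (\<lambda>n x. \<Sum>i<n. volterra_term T h i x) y sequentially"
    unfolding y_def by (rule Weierstrass_m_test[OF bL sums_summable[OF sums]])
  have sc: "continuous_on {0..L} (\<lambda>x. \<Sum>i<n. volterra_term T h i x)" for n
    by (intro continuous_on_sum cont)
  have yc: "continuous_on {0..L} y"
    by (rule uniform_limit_theorem[OF _ unif]) (auto simp: sc)
  have summ: "summable (\<lambda>n. volterra_term T h n x)" if "x \<in> {0..L}" for x
    by (rule summable_comparison_test'[OF sums_summable[OF sums]]) (use bL that in auto)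
  show ?thesis
  proof (intro exI[of _ y] conjI ballI yc)
    fix x assume x: "x \<in> {0..L}"
    have "norm (y x) \<le> (\<Sum>n. B * ((K * L) ^ n / fact n))"
      unfolding y_def by (rule norm_suminf_le[OF bL[OF x] sums_summable[OF sums]])
    then show "norm (y x) \<le> B * exp (K * L)" using sums_unique[OF sums] by simp
    let ?s = "\<lambda>n t. \<Sum>i<n. volterra_term T h i t"
    have sub: "t \<in> {0..L}" if "t \<in> {0..x}" for t using that x by auto
    \<comment> \<open>Passing to the limit here turns the recursion for the terms, which shifts the
      index by one, into the equation for \<open>y\<close>.\<close>
    have "(\<lambda>n. integral {0..x} (\<lambda>t. T t (?s n t))) \<longlonglongrightarrow> integral {0..x} (\<lambda>t. T t (y t))"
    proof (rule dominated_convergence(2)[where h = "\<lambda>_. K * (B * exp (K * L))"])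
      show "(\<lambda>t. T t (?s n t)) integrable_on {0..x}" for n
        by (rule T_integrable_sub[OF sc]) (use x in simp)
      fix n t assume t: "t \<in> {0..x}"
      have "norm (?s n t) \<le> (\<Sum>i<n. B * ((K * L) ^ i / fact i))"
        by (rule sum_norm_le) (rule bL[OF sub[OF t]])
      also have "\<dots> \<le> B * exp (K * L)"
        unfolding sums_unique[OF sums] using B K L by (intro sum_le_suminf sums_summable[OF sums]) auto
      finally show "norm (T t (?s n t)) \<le> K * (B * exp (K * L))"
        using T_bound[of t "?s n t"] K by (meson mult_left_mono order_trans)
    next
      fix t assume t: "t \<in> {0..x}"
      show "(\<lambda>n. T t (?s n t)) \<longlonglongrightarrow> T t (y t)"
        unfolding y_def
        by (intro bounded_linear.tendsto[OF T_linear[unfolded linear_conv_bounded_linear]] summable_LIMSEQ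
            summ sub[OF t])
    qed (rule integrable_const_ivl)
    moreover have "integral {0..x} (\<lambda>t. T t (?s n t)) = (\<Sum>i<n. volterra_term T h (Suc i) x)" for n
      using Henstock_Kurzweil_Integration.integral_sum[of "{..<n}" "\<lambda>i t. T t (volterra_term T h i t)" "{0..x}"]
        T_integrable_sub[OF cont] x by (simp add: linear_sum[OF T_linear])
    ultimately have lim: "(\<lambda>n. \<Sum>i<n. volterra_term T h (Suc i) x) \<longlonglongrightarrow> integral {0..x} (\<lambda>t. T t (y t))"
      by simp
    have "(\<lambda>n. \<Sum>i<n. volterra_term T h (Suc i) x) \<longlonglongrightarrow> (\<Sum>n. volterra_term T h (Suc n) x)"
      by (rule summable_LIMSEQ[OF summable_Suc_iff[of "\<lambda>n. volterra_term T h n x", THEN iffD2, OF summ[OF x]]])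
    then have "integral {0..x} (\<lambda>t. T t (y t)) = (\<Sum>n. volterra_term T h (Suc n) x)"
      using LIMSEQ_unique[OF lim] by simp
    then show "y x = h x + integral {0..x} (\<lambda>t. T t (y t))"
      unfolding y_def using suminf_split_head[OF summ[OF x]] by simp
  qed
qed

end

section \<open>Piecewise integrands and derivatives on closed intervals\<close>

lemma integrable_piecewise:
  fixes u v :: "real \<Rightarrow> 'a::euclidean_space"
  assumes u: "continuous_on {A..B} u" and v: "continuous_on {A..B} v" and cd: "A \<le> c" "c \<le> d" "d \<le> B"
  shows "(\<lambda>t. if t \<in> {c<..<d} then u t else v t) integrable_on {A..B}" (is "?f integrable_on _")
proof -
  have "?f integrable_on {A..c}"
    by (rule integrable_eq[OF integrable_continuous_real[OF continuous_on_subset[OF v]]]) (use cd in auto)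
  moreover have "?f integrable_on {c..d}"
    by (rule integrable_spike_finite[OF _ _ integrable_continuous_real[OF continuous_on_subset[OF u]], of "{c, d}"])
      (use cd in auto)
  ultimately have "?f integrable_on {A..d}"
    using cd by (intro Henstock_Kurzweil_Integration.integrable_combine[of A c d]) auto
  moreover have "?f integrable_on {d..B}"
    by (rule integrable_eq[OF integrable_continuous_real[OF continuous_on_subset[OF v]]]) (use cd in auto)
  ultimately show ?thesis
    using cd by (intro Henstock_Kurzweil_Integration.integrable_combine[of A d B]) auto
qed

lemma primitive_on_has_vector_derivative:
  assumes r: "primitive_on c d r g" and g: "continuous_on {c..d} g" and x: "x \<in> {c..d}"
  shows "(r has_vector_derivative g x) (at x within {c..d})"
proof -
  have "((\<lambda>u. r c + integral {c..u} g) has_vector_derivative 0 + g x) (at x within {c..d})"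
    by (intro has_vector_derivative_add has_vector_derivative_const integral_has_vector_derivative[OF g x])
  from has_vector_derivative_transform[OF x _ this, of r] show ?thesis
    using primitive_on_eq[OF r] unfolding add_0 atLeastAtMost_iff by blast
qed

lemma zero_vector_derivative_eq:
  assumes "\<And>x. x \<in> {c..d} \<Longrightarrow> (f has_vector_derivative 0) (at x within {c..d})" "x \<in> {c..d}" "y \<in> {c..d}"
  shows "f x = f y"
  using has_vector_derivative_zero_constant[of "{c..d}" f] assms by (metis convex_real_interval(5))

text \<open>Allows an identity between functions on \<open>[c, d]\<close> to be differentiated, end
  points included; the cascade that kills homogeneous solutions consists of such steps.\<close>

lemma vector_derivative_within_unique:
  fixes f :: "real \<Rightarrow> 'a::euclidean_space"
  assumes "c < d" "x \<in> {c..d}" "(f has_vector_derivative f') (at x within {c..d})"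
    "(g has_vector_derivative g') (at x within {c..d})" "\<And>x. x \<in> {c..d} \<Longrightarrow> f x = g x"
  shows "f' = g'"
proof -
  have "(f has_vector_derivative g') (at x within {c..d})"
    by (rule has_vector_derivative_transform[OF assms(2) _ assms(4)]) (use assms(5) in auto)
  then show ?thesis
    using vector_derivative_unique_within_closed_interval[of c d x f f' g'] assms by simp
qed

section \<open>The first-order system\<close>

locale transmission = transmission_interval L1 L2 L3 for L1 L2 L3 +
  fixes a b m k \<tau> :: real
  assumes pos: "a > 0" "b > 0" "m > 0" "k > 0" "\<tau> > 0"
begin

text \<open>
  For \<open>[u\<^sup>1, v\<^sup>1, \<theta>, q, u\<^sup>2, v\<^sup>2]\<close> in the domain, \<open>y1\<close> is \<open>u\<^sup>1\<close> glued with \<open>v\<^sup>1\<close>, \<open>y2\<close> is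
  \<open>a u\<^sup>1\<^sub>x - m \<theta>\<close> glued with \<open>b v\<^sup>1\<^sub>x\<close>, \<open>y3\<close> is \<open>\<theta>\<close> and \<open>y4\<close> is \<open>k q\<close>; all four are
  continuous on \<open>[0, L3]\<close>, and \<open>y3\<close>, \<open>y4\<close> are extended as constants outside \<open>I\<close>.
\<close>

definition sys where
  "sys z g2 g3 g4 y1 y2 y3 y4 \<longleftrightarrow>
     primitive_on 0 L3 y1 (\<lambda>t. if t \<in> I then (y2 t + of_real m * y3 t) / of_real a else y2 t / of_real b) \<and>
     primitive_on 0 L3 y2 (\<lambda>t. z * z * y1 t + g2 t) \<and>
     primitive_on 0 L3 y3 (\<lambda>t. if t \<in> I then - ((of_real \<tau> * z + 1) / (of_real k * of_real k)) * y4 t + g3 t else 0) \<and>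
     primitive_on 0 L3 y4 (\<lambda>t. if t \<in> I
       then - z * (y3 t + of_real m * (y2 t + of_real m * y3 t) / of_real a) + g4 t else (0::complex))"

abbreviation "hom_sys z \<equiv> sys z (\<lambda>_. 0) (\<lambda>_. 0) (\<lambda>_. 0)"

lemma sys_comb:
  assumes "sys z g2 g3 g4 y1 y2 y3 y4" "hom_sys z w1 w2 w3 w4"
  shows "sys z g2 g3 g4 (\<lambda>t. y1 t + c * w1 t) (\<lambda>t. y2 t + c * w2 t) (\<lambda>t. y3 t + c * w3 t) (\<lambda>t. y4 t + c * w4 t)"
proof -
  note lin = primitive_on_cong_AE[OF primitive_on_add[OF _ primitive_on_scale] refl AE_I2]
  show ?thesis
    using assms unfolding sys_def
    by - (elim conjE, intro conjI; rule lin, assumption, assumption,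
      simp add: algebra_simps add_divide_distrib)
qed

definition opI :: "complex \<Rightarrow> complex \<times> complex \<times> complex \<times> complex \<Rightarrow> complex \<times> complex \<times> complex \<times> complex" where
  "opI z = (\<lambda>(y1, y2, y3, y4). ((y2 + of_real m * y3) / of_real a, z * z * y1,
     - ((of_real \<tau> * z + 1) / (of_real k * of_real k)) * y4,
     - z * (y3 + of_real m * (y2 + of_real m * y3) / of_real a)))"

definition opJ :: "complex \<Rightarrow> complex \<times> complex \<times> complex \<times> complex \<Rightarrow> complex \<times> complex \<times> complex \<times> complex" where
  "opJ z = (\<lambda>(y1, y2, y3, y4). (y2 / of_real b, z * z * y1, 0, 0))"

lemma op_linear: "linear (opI z)" "linear (opJ z)"
  by (rule linearI; force simp: opI_def opJ_def algebra_simps add_divide_distrib scaleR_conv_of_real)+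

abbreviation bounded4 :: "real \<Rightarrow> (real \<Rightarrow> complex) \<Rightarrow> (real \<Rightarrow> complex) \<Rightarrow> (real \<Rightarrow> complex) \<Rightarrow> (real \<Rightarrow> complex) \<Rightarrow> real \<Rightarrow> bool" where
  "bounded4 M y1 y2 y3 y4 x \<equiv> norm (y1 x) \<le> M \<and> norm (y2 x) \<le> M \<and> norm (y3 x) \<le> M \<and> norm (y4 x) \<le> M"

text \<open>The source of the system as one vector. The equation for \<open>y1\<close> has no
  source, and \<open>y3\<close>, \<open>y4\<close> are driven only inside \<open>I\<close>.\<close>

definition datum :: "(real \<Rightarrow> complex) \<Rightarrow> (real \<Rightarrow> complex) \<Rightarrow> (real \<Rightarrow> complex) \<Rightarrow> real \<Rightarrow>
    complex \<times> complex \<times> complex \<times> complex" where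
  "datum g2 g3 g4 t = (0, g2 t, if t \<in> I then g3 t else 0, if t \<in> I then g4 t else 0)"

text \<open>The initial value problem is a Volterra equation with free term
  \<open>p + integral {0..x} (datum g2 g3 g4)\<close>. The constant is \<open>exp (K * L3)\<close>,
  independent of the data, and the data enter only through the supremum of their integral.\<close>

lemma sys_solution:
  "\<exists>C\<ge>0. \<forall>p g2 g3 g4 B. datum g2 g3 g4 integrable_on {0..L3} \<longrightarrow>
    (\<forall>x\<in>{0..L3}. norm (p + integral {0..x} (datum g2 g3 g4)) \<le> B) \<longrightarrow>
    (\<exists>y1 y2 y3 y4. sys z g2 g3 g4 y1 y2 y3 y4 \<and> (y1 0, y2 0, y3 0, y4 0) = p \<and>
      (\<forall>x\<in>{0..L3}. bounded4 (B * C) y1 y2 y3 y4 x))"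
proof -
  define T where "T t = (if t \<in> {L1<..<L2} then opI z else opJ z)" for t
  have bl: "bounded_linear (opI z)" "bounded_linear (opJ z)"
    using op_linear by (auto simp: linear_conv_bounded_linear)
  obtain KI where KI: "0 < KI" "\<And>x. norm (opI z x) \<le> norm x * KI"
    using bounded_linear.pos_bounded[OF bl(1)] by blast
  obtain KJ where KJ: "0 < KJ" "\<And>x. norm (opJ z x) \<le> norm x * KJ"
    using bounded_linear.pos_bounded[OF bl(2)] by blast
  define K where "K = max KI KJ"
  interpret volterra T L3 K
  proof (rule volterra.intro)
    show "norm (T t v) \<le> K * norm v" for t v
    proof -
      have "norm v * KI \<le> K * norm v" "norm v * KJ \<le> K * norm v"
        by (simp_all add: K_def mult.commute[of "norm v"] mult_right_mono)
      then show ?thesis using KI(2)[of v] KJ(2)[of v] by (auto simp: T_def)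
    qed
    show "linear (T t)" for t using op_linear by (simp add: T_def)
    fix y :: "real \<Rightarrow> complex \<times> complex \<times> complex \<times> complex" assume y: "continuous_on {0..L3} y"
    have "(\<lambda>t. if t \<in> {L1<..<L2} then opI z (y t) else opJ z (y t)) integrable_on {0..L3}"
      by (rule integrable_piecewise[OF bounded_linear.continuous_on[OF bl(1) y] bounded_linear.continuous_on[OF bl(2) y]]) (use L_less in auto)
    then show "(\<lambda>t. T t (y t)) integrable_on {0..L3}"
      by (rule integrable_eq) (simp add: T_def)
  qed (use L_less KI(1) in \<open>auto simp: K_def\<close>)
  show ?thesis
  proof (intro exI[of _ "exp (K * L3)"] conjI allI impI)
    fix p g2 g3 g4 B
    define G where "G = datum g2 g3 g4"
    assume "datum g2 g3 g4 integrable_on {0..L3}"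
    then have Gi: "G integrable_on {0..L3}" by (simp add: G_def)
    assume "\<forall>x\<in>{0..L3}. norm (p + integral {0..x} (datum g2 g3 g4)) \<le> B"
    then have B: "\<And>x. x \<in> {0..L3} \<Longrightarrow> norm (p + integral {0..x} G) \<le> B" by (simp add: G_def)
    have hc: "continuous_on {0..L3} (\<lambda>x. p + integral {0..x} G)"
      by (intro continuous_intros indefinite_integral_continuous_1 Gi)
    obtain y where y: "continuous_on {0..L3} y"
      "\<And>x. x \<in> {0..L3} \<Longrightarrow> y x = p + integral {0..x} G + integral {0..x} (\<lambda>t. T t (y t))"
      "\<And>x. x \<in> {0..L3} \<Longrightarrow> norm (y x) \<le> B * exp (K * L3)"
      using solution[OF hc, of B] B by blast
    have P: "primitive_on 0 L3 y (\<lambda>t. T t (y t) + G t)"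
    proof (rule primitive_on_cong_AE)
      show "primitive_on 0 L3 (\<lambda>x. p + integral {0..x} (\<lambda>t. T t (y t) + G t)) (\<lambda>t. T t (y t) + G t)"
        by (intro primitive_on_integral integrable_add T_integrable y(1) Gi)
      fix x assume x: "0 \<le> x" "x \<le> L3"
      have "integral {0..x} (\<lambda>t. T t (y t) + G t) = integral {0..x} (\<lambda>t. T t (y t)) + integral {0..x} G"
        by (rule Henstock_Kurzweil_Integration.integral_add)
          (use x in \<open>auto intro: T_integrable_sub y(1) integrable_on_subinterval[OF Gi]\<close>)
      then show "y x = p + integral {0..x} (\<lambda>t. T t (y t) + G t)" using y(2)[of x] x by simp
    qed simp
    define y1 y2 y3 y4 where "y1 = (\<lambda>t. fst (y t))" and "y2 = (\<lambda>t. fst (snd (y t)))"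
      and "y3 = (\<lambda>t. fst (snd (snd (y t))))" and "y4 = (\<lambda>t. snd (snd (snd (y t))))"
    have yeq: "y t = (y1 t, y2 t, y3 t, y4 t)" for t
      by (simp add: y1_def y2_def y3_def y4_def)
    have P': "primitive_on 0 L3 (\<lambda>t. (y1 t, y2 t, y3 t, y4 t)) (\<lambda>t. T t (y1 t, y2 t, y3 t, y4 t) + G t)"
      using P by (simp only: yeq[symmetric])
    note blc = bounded_linear_compose
    note f = bounded_linear_fst and s = bounded_linear_snd
    have "sys z g2 g3 g4 y1 y2 y3 y4"
      unfolding sys_def
    proof (intro conjI)
      show "primitive_on 0 L3 y1 (\<lambda>t. if t \<in> I then (y2 t + of_real m * y3 t) / of_real a else y2 t / of_real b)"
        by (rule primitive_on_cong_AE[OF primitive_on_linear[OF P' f] _ AE_I2])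
          (auto simp: T_def opI_def opJ_def G_def datum_def IJ_simps)
      show "primitive_on 0 L3 y2 (\<lambda>t. z * z * y1 t + g2 t)"
        by (rule primitive_on_cong_AE[OF primitive_on_linear[OF P' blc[OF f s]] _ AE_I2])
          (auto simp: T_def opI_def opJ_def G_def datum_def IJ_simps)
      show "primitive_on 0 L3 y3 (\<lambda>t. if t \<in> I then - ((of_real \<tau> * z + 1) / (of_real k * of_real k)) * y4 t + g3 t else 0)"
        by (rule primitive_on_cong_AE[OF primitive_on_linear[OF P' blc[OF f blc[OF s s]]] _ AE_I2])
          (auto simp: T_def opI_def opJ_def G_def datum_def IJ_simps)
      show "primitive_on 0 L3 y4 (\<lambda>t. if t \<in> I
         then - z * (y3 t + of_real m * (y2 t + of_real m * y3 t) / of_real a) + g4 t else 0)"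
        by (rule primitive_on_cong_AE[OF primitive_on_linear[OF P' blc[OF s blc[OF s s]]] _ AE_I2])
          (auto simp: T_def opI_def opJ_def G_def datum_def IJ_simps)
    qed
    moreover have "(y1 0, y2 0, y3 0, y4 0) = p"
      using y(2)[of 0] L_less unfolding yeq[symmetric] by simp
    moreover have "bounded4 (B * exp (K * L3)) y1 y2 y3 y4 x" if "x \<in> {0..L3}" for x
    proof -
      have "norm (y1 x) \<le> norm (y x)" "norm (y2 x) \<le> norm (y x)" "norm (y3 x) \<le> norm (y x)" "norm (y4 x) \<le> norm (y x)"
        unfolding yeq
        using norm_fst_le[of "y1 x" "(y2 x, y3 x, y4 x)"] norm_snd_le[of "(y2 x, y3 x, y4 x)" "y1 x"]
          norm_fst_le[of "y2 x" "(y3 x, y4 x)"] norm_snd_le[of "(y3 x, y4 x)" "y2 x"]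
          norm_fst_le[of "y3 x" "y4 x"] norm_snd_le[of "y4 x" "y3 x"]
        by linarith+
      then show ?thesis using y(3)[OF that] by auto
    qed
    ultimately show "\<exists>y1 y2 y3 y4. sys z g2 g3 g4 y1 y2 y3 y4 \<and> (y1 0, y2 0, y3 0, y4 0) = p \<and>
      (\<forall>x\<in>{0..L3}. bounded4 (B * exp (K * L3)) y1 y2 y3 y4 x)"
      by blast
  qed simp
qed

section \<open>Uniqueness for the homogeneous boundary value problem\<close>

lemma sys_continuous:
  assumes "sys z g2 g3 g4 y1 y2 y3 y4"
  shows "continuous_on {0..L3} y1" "continuous_on {0..L3} y2" "continuous_on {0..L3} y3" "continuous_on {0..L3} y4"
  using assms by (auto simp: sys_def intro: primitive_on_continuous)

lemma hom_sysD:
  assumes "hom_sys z y1 y2 y3 y4"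
  shows "primitive_on 0 L3 y1 (\<lambda>t. if t \<in> I then (y2 t + of_real m * y3 t) / of_real a else y2 t / of_real b)"
    "primitive_on 0 L3 y2 (\<lambda>t. z * z * y1 t)"
    "primitive_on 0 L3 y3 (\<lambda>t. if t \<in> I then - ((of_real \<tau> * z + 1) / (of_real k * of_real k)) * y4 t else 0)"
    "primitive_on 0 L3 y4 (\<lambda>t. if t \<in> I
         then - z * (y3 t + of_real m * (y2 t + of_real m * y3 t) / of_real a) else 0)"
  using assms unfolding sys_def add_0_right by blast+

text \<open>Since \<open>z\<close> is imaginary, \<open>w\<close> and \<open>z * w\<close> are
  orthogonal for the real inner product, so the flux has derivative zero where the coefficients are
  those of \<open>J\<close>. The second claim propagates zeros from any point \<open>p\<close> of
  the interval, which is applied from \<open>L1\<close> to the left and from \<open>L2\<close> to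
  the right.\<close>

lemma conservation_J:
  assumes z: "Re z = 0" and cd: "{c..d} \<subseteq> {0..L3}" "{c<..<d} \<inter> I = {}" "c \<le> d"
    and y: "hom_sys z y1 y2 y3 y4"
  shows "inner (y2 c) (z * y1 c) - inner (y4 c) (y3 c) = inner (y2 d) (z * y1 d) - inner (y4 d) (y3 d)"
    and "z \<noteq> 0 \<Longrightarrow> p \<in> {c..d} \<Longrightarrow> y1 p = 0 \<Longrightarrow> y2 p = 0 \<Longrightarrow> y3 p = 0 \<Longrightarrow> y4 p = 0 \<Longrightarrow> x \<in> {c..d} \<Longrightarrow>
      y1 x = 0 \<and> y2 x = 0 \<and> y3 x = 0 \<and> y4 x = 0"
proof -
  note yc = continuous_on_subset[OF sys_continuous(1)[OF y] cd(1)] continuous_on_subset[OF sys_continuous(2)[OF y] cd(1)]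
  have cd': "0 \<le> c" "d \<le> L3" using cd by auto
  note P = hom_sysD[OF y]
  note sub = primitive_on_cong_AE[OF primitive_on_subset[OF _ cd'] refl AE_I2]
  have out: "t \<notin> I" if "c < t" "t < d" for t using cd(2) that by auto
  have p1: "primitive_on c d y1 (\<lambda>t. y2 t / of_real b)"
    and p2: "primitive_on c d y2 (\<lambda>t. z * z * y1 t)"
    and p3: "primitive_on c d y3 (\<lambda>t. 0)" and p4: "primitive_on c d y4 (\<lambda>t. 0)"
    using out by (auto intro!: sub[OF P(1)] sub[OF P(2)] sub[OF P(3)] sub[OF P(4)])
  have d1: "(y1 has_vector_derivative y2 x / of_real b) (at x within {c..d})" if "x \<in> {c..d}" for x
    by (rule primitive_on_has_vector_derivative[OF p1 _ that]) (intro continuous_intros yc; use pos in simp)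
  have d2: "(y2 has_vector_derivative z * z * y1 x) (at x within {c..d})" if "x \<in> {c..d}" for x
    by (rule primitive_on_has_vector_derivative[OF p2 _ that]) (intro continuous_intros yc)
  have d3: "(y3 has_vector_derivative 0) (at x within {c..d})" if "x \<in> {c..d}" for x
    by (rule primitive_on_has_vector_derivative[OF p3 _ that]) (intro continuous_intros)
  have d4: "(y4 has_vector_derivative 0) (at x within {c..d})" if "x \<in> {c..d}" for x
    by (rule primitive_on_has_vector_derivative[OF p4 _ that]) (intro continuous_intros)
  note inner_d = bounded_bilinear.has_vector_derivative[OF bounded_bilinear_inner]
  have "((\<lambda>x. inner (y2 x) (z * y1 x) - inner (y4 x) (y3 x)) has_vector_derivative 0) (at x within {c..d})"
    if x: "x \<in> {c..d}" for x
  proof -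
    have "((\<lambda>x. inner (y2 x) (z * y1 x) - inner (y4 x) (y3 x)) has_vector_derivative
      (inner (y2 x) (z * (y2 x / of_real b)) + inner (z * z * y1 x) (z * y1 x)) - (inner (y4 x) 0 + inner 0 (y3 x)))
      (at x within {c..d})"
      by (intro has_vector_derivative_diff inner_d has_vector_derivative_mult_right d1 d2 d3 d4 x)
    moreover have "inner (y2 x) (z * (y2 x / of_real b)) = 0" "inner (z * z * y1 x) (z * y1 x) = 0"
      using z by (simp_all add: inner_complex_def algebra_simps)
    ultimately show ?thesis by simp
  qed
  from zero_vector_derivative_eq[OF this] cd(3)
  show "inner (y2 c) (z * y1 c) - inner (y4 c) (y3 c) = inner (y2 d) (z * y1 d) - inner (y4 d) (y3 d)"
    by auto
  assume z0: "z \<noteq> 0" and p: "p \<in> {c..d}" "y1 p = 0" "y2 p = 0" "y3 p = 0" "y4 p = 0" and x: "x \<in> {c..d}"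
  \<comment> \<open>A second conserved quantity, positive definite in \<open>y1\<close> and
    \<open>y2\<close> because \<open>z * z = - (Im z)^2\<close>; its vanishing at one point does the
    work of a uniqueness theorem.\<close>
  define N where "N x = (Im z)\<^sup>2 * inner (y1 x) (y1 x) + inner (y2 x) (y2 x) / b" for x
  have "(N has_vector_derivative 0) (at x within {c..d})" if x: "x \<in> {c..d}" for x
  proof -
    have "(N has_vector_derivative
      (Im z)\<^sup>2 * (inner (y1 x) (y2 x / of_real b) + inner (y2 x / of_real b) (y1 x))
      + (inner (y2 x) (z * z * y1 x) + inner (z * z * y1 x) (y2 x)) / b) (at x within {c..d})"
      unfolding N_def
      by (intro has_vector_derivative_add has_vector_derivative_divide has_vector_derivative_mult_right inner_d d1 d2 x)
    moreover have "z * z = - of_real ((Im z)\<^sup>2)"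
      using z by (simp add: complex_eq_iff power2_eq_square)
    ultimately show ?thesis
      by (simp add: inner_complex_def algebra_simps add_divide_distrib diff_divide_distrib)
  qed
  from zero_vector_derivative_eq[OF this x p(1)] have "N x = 0" by (simp add: N_def p)
  moreover have "0 < (Im z)\<^sup>2" using z z0 by (simp add: complex_eq_iff)
  ultimately have "y1 x = 0 \<and> y2 x = 0"
    using pos by (simp add: N_def add_nonneg_eq_0_iff)
  moreover have "y3 x = 0" "y4 x = 0"
    using zero_vector_derivative_eq[OF d3 x p(1)] zero_vector_derivative_eq[OF d4 x p(1)] p by auto
  ultimately show "y1 x = 0 \<and> y2 x = 0 \<and> y3 x = 0 \<and> y4 x = 0" by simp
qed

text \<open>On \<open>I\<close> the cascade is: \<open>y4 = 0\<close> forces the right-hand side of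
  its own equation to vanish, which makes \<open>y2\<close> a multiple of \<open>y3\<close>;
  \<open>y3\<close> has derivative zero, so \<open>z * z * y1 = 0\<close>; then the equation for
  \<open>y1\<close> gives \<open>y2 + m * y3 = 0\<close>, and so \<open>y3 = y2 = 0\<close>. The
  zeros at \<open>L1\<close> and \<open>L2\<close> spread over \<open>J\<close>.\<close>

lemma hom_sys_zero:
  assumes z: "Re z = 0" "z \<noteq> 0" and y: "hom_sys z y1 y2 y3 y4"
    and bc: "y1 0 = 0" "y4 0 = 0" "y1 L3 = 0" "y4 L3 = 0" and x: "x \<in> {0..L3}"
  shows "y1 x = 0 \<and> y2 x = 0 \<and> y3 x = 0 \<and> y4 x = 0"
proof -
  have J1: "{0..L1} \<subseteq> {0..L3}" "{0<..<L1} \<inter> I = {}" "0 \<le> L1"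
    and J2: "{L2..L3} \<subseteq> {0..L3}" "{L2<..<L3} \<inter> I = {}" "L2 \<le> L3"
    using L_less by (auto simp: IJ_simps)
  have sub: "{L1..L2} \<subseteq> {0..L3}" using L_less by auto
  note yc = sys_continuous[OF y, THEN continuous_on_subset, OF sub]
  note P = hom_sysD[OF y]
  have L': "0 \<le> L1" "L2 \<le> L3" using L_less by auto
  note subI = primitive_on_cong_AE[OF primitive_on_subset[OF _ L'] refl AE_I2]
  have d1: "(y1 has_vector_derivative (y2 x + of_real m * y3 x) / of_real a) (at x within {L1..L2})" if "x \<in> {L1..L2}" for x
    by (rule primitive_on_has_vector_derivative[OF subI[OF P(1)] _ that])
      (use pos in \<open>auto simp: IJ_simps intro!: continuous_intros yc\<close>)
  have d2: "(y2 has_vector_derivative z * z * y1 x) (at x within {L1..L2})" if "x \<in> {L1..L2}" for x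
    by (rule primitive_on_has_vector_derivative[OF subI[OF P(2)] _ that])
      (auto simp: IJ_simps intro!: continuous_intros yc)
  have d3: "(y3 has_vector_derivative - ((of_real \<tau> * z + 1) / (of_real k * of_real k)) * y4 x) (at x within {L1..L2})"
    if "x \<in> {L1..L2}" for x
    by (rule primitive_on_has_vector_derivative[OF subI[OF P(3)] _ that])
      (use pos in \<open>auto simp: IJ_simps intro!: continuous_intros yc\<close>)
  have d4: "(y4 has_vector_derivative - z * (y3 x + of_real m * (y2 x + of_real m * y3 x) / of_real a)) (at x within {L1..L2})"
    if "x \<in> {L1..L2}" for x
    by (rule primitive_on_has_vector_derivative[OF subI[OF P(4)] _ that])
      (use pos in \<open>auto simp: IJ_simps intro!: continuous_intros yc\<close>)
  note inner_d = bounded_bilinear.has_vector_derivative[OF bounded_bilinear_inner]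
  define E where "E x = inner (y2 x) (z * y1 x) - inner (y4 x) (y3 x)" for x
  have dE: "(E has_vector_derivative (norm (y4 x))\<^sup>2 / k\<^sup>2) (at x within {L1..L2})" if x: "x \<in> {L1..L2}" for x
  proof -
    have "(E has_vector_derivative
      (inner (y2 x) (z * ((y2 x + of_real m * y3 x) / of_real a)) + inner (z * z * y1 x) (z * y1 x))
      - (inner (y4 x) (- ((of_real \<tau> * z + 1) / (of_real k * of_real k)) * y4 x)
        + inner (- z * (y3 x + of_real m * (y2 x + of_real m * y3 x) / of_real a)) (y3 x)))
      (at x within {L1..L2})"
      unfolding E_def
      by (intro has_vector_derivative_diff inner_d has_vector_derivative_mult_right d1 d2 d3 d4 x)
    moreover have "(inner (y2 x) (z * ((y2 x + of_real m * y3 x) / of_real a)) + inner (z * z * y1 x) (z * y1 x))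
      - (inner (y4 x) (- ((of_real \<tau> * z + 1) / (of_real k * of_real k)) * y4 x)
        + inner (- z * (y3 x + of_real m * (y2 x + of_real m * y3 x) / of_real a)) (y3 x)) = (norm (y4 x))\<^sup>2 / k\<^sup>2"
    proof -
      have i0: "inner (w::complex) (z * w) = 0" "inner (z * w) w = 0" for w
        using z by (simp_all add: inner_complex_def algebra_simps)
      \<comment> \<open>Multiplication by an imaginary number is skew-adjoint: this cancels the two
        cross terms of \<open>y2\<close> and \<open>y3\<close> with factor
        \<open>m / a\<close>.\<close>
      have sk: "inner (v::complex) (z * w) = - inner (z * v) w" for v w
        using z by (simp add: inner_complex_def algebra_simps)
      have 1: "z * ((y2 x + of_real m * y3 x) / of_real a) = (1 / a) *\<^sub>R (z * y2 x) + (m / a) *\<^sub>R (z * y3 x)"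
        by (simp add: scaleR_conv_of_real algebra_simps add_divide_distrib)
      have 2: "- z * (y3 x + of_real m * (y2 x + of_real m * y3 x) / of_real a)
        = - (z * y3 x) - (m / a) *\<^sub>R (z * y2 x) - (m * m / a) *\<^sub>R (z * y3 x)"
        by (simp add: scaleR_conv_of_real algebra_simps add_divide_distrib)
      have 3: "- ((of_real \<tau> * z + 1) / (of_real k * of_real k)) * y4 x
        = - ((\<tau> / (k * k)) *\<^sub>R (z * y4 x)) - (1 / (k * k)) *\<^sub>R y4 x"
        by (simp add: scaleR_conv_of_real algebra_simps add_divide_distrib)
      have 4: "inner (z * z * y1 x) (z * y1 x) = 0" using i0(2)[of "z * y1 x"] by (simp add: mult.assoc)
      show ?thesis
        unfolding 1 2 3 4
        by (simp add: inner_diff_left inner_diff_right inner_add_right i0 sk[of "y2 x" "y3 x"] flip: power2_norm_eq_inner power2_eq_square)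
    qed
    ultimately show ?thesis by simp
  qed
  have E1: "E L1 = 0" using conservation_J(1)[OF z(1) J1 y] bc by (simp add: E_def)
  have E2: "E L2 = 0" using conservation_J(1)[OF z(1) J2 y] bc by (simp add: E_def)
  have mono: "E u \<le> E v" if "u \<in> {L1..L2}" "v \<in> {L1..L2}" "u \<le> v" for u v
  proof -
    have "((\<lambda>x. (norm (y4 x))\<^sup>2 / k\<^sup>2) has_integral (E v - E u)) {u..v}"
      by (rule fundamental_theorem_of_calculus[OF that(3)])
        (rule has_vector_derivative_within_subset[OF dE]; use that in auto)
    then have "0 \<le> E v - E u" by (rule has_integral_nonneg) simp
    then show ?thesis by simp
  qed
  \<comment> \<open>A nondecreasing function that is zero at both ends of \<open>[L1, L2]\<close> is
    zero between them, so its derivative \<open>|y4|^2 / k^2\<close> vanishes too.\<close>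
  have E0: "E x = 0" if "x \<in> {L1..L2}" for x
    using mono[of L1 x] mono[of x L2] that E1 E2 L_less by auto
  note uniq = vector_derivative_within_unique[OF L_less(2)]
  have q: "y4 x = 0" if "x \<in> {L1..L2}" for x
    using uniq[OF that dE[OF that] has_vector_derivative_const[of 0] E0] pos by simp
  have th: "y3 x + of_real m * (y2 x + of_real m * y3 x) / of_real a = 0" if "x \<in> {L1..L2}" for x
    using uniq[OF that d4[OF that] has_vector_derivative_const[of 0] q] z by simp
  define \<kappa> where "\<kappa> = - (complex_of_real a / of_real m + of_real m)"
  have y23: "y2 x = \<kappa> * y3 x" if "x \<in> {L1..L2}" for x
    using th[OF that] pos by (simp add: \<kappa>_def field_simps add_eq_0_iff)
  \<comment> \<open>Differentiating \<open>y2 = \<kappa> * y3\<close> gives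
    \<open>z * z * y1\<close> on the left and a multiple of \<open>y4 = 0\<close> on the
    right.\<close>
  have y1: "y1 x = 0" if "x \<in> {L1..L2}" for x
    using uniq[OF that d2[OF that] has_vector_derivative_mult_right[OF d3[OF that]] y23] z q[OF that] by simp
  have s: "y2 x + of_real m * y3 x = 0" if "x \<in> {L1..L2}" for x
    using uniq[OF that d1[OF that] has_vector_derivative_const[of 0] y1] pos by simp
  have y3: "y3 x = 0" if "x \<in> {L1..L2}" for x
    using th[OF that] s[OF that] by simp
  have y2: "y2 x = 0" if "x \<in> {L1..L2}" for x
    using s[OF that] y3[OF that] by simp
  have e: "L1 \<in> {L1..L2}" "L2 \<in> {L1..L2}" using L_less by auto
  consider "x \<in> {0..L1}" | "x \<in> {L1..L2}" | "x \<in> {L2..L3}" using x by fastforce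
  then show ?thesis
  proof cases
    case 1
    show ?thesis
      by (rule conservation_J(2)[OF z(1) J1 y z(2) _ y1[OF e(1)] y2[OF e(1)] y3[OF e(1)] q[OF e(1)] 1]) (use L_less in simp)
  next
    case 2
    then show ?thesis using y1 y2 y3 q by simp
  next
    case 3
    show ?thesis
      by (rule conservation_J(2)[OF z(1) J2 y z(2) _ y1[OF e(2)] y2[OF e(2)] y3[OF e(2)] q[OF e(2)] 3]) (use L_less in simp)
  qed
qed

text \<open>The combination \<open>c * w + d * v\<close> is a homogeneous solution satisfying all
  four end conditions, and its second and third initial values are \<open>c\<close> and
  \<open>d\<close>.\<close>

lemma hom_sys_comb_zero:
  assumes z: "Re z = 0" "z \<noteq> 0"
    and w: "hom_sys z w1 w2 w3 w4" "(w1 0, w2 0, w3 0, w4 0) = (0, 1, 0, 0)"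
    and v: "hom_sys z v1 v2 v3 v4" "(v1 0, v2 0, v3 0, v4 0) = (0, 0, 1, 0)"
    and e: "c * w1 L3 + d * v1 L3 = 0" "c * w4 L3 + d * v4 L3 = 0"
  shows "c = 0 \<and> d = 0"
proof -
  have "hom_sys z (\<lambda>t. 0) (\<lambda>t. 0) (\<lambda>t. 0) (\<lambda>t. 0)"
    unfolding sys_def by (intro conjI primitive_on_cong_AE[OF primitive_on_const refl AE_I2]) auto
  from sys_comb[OF sys_comb[OF this w(1), of c] v(1), of d]
  have "hom_sys z (\<lambda>t. c * w1 t + d * v1 t) (\<lambda>t. c * w2 t + d * v2 t)
      (\<lambda>t. c * w3 t + d * v3 t) (\<lambda>t. c * w4 t + d * v4 t)" by simp
  from hom_sys_zero[OF z this, of 0] w(2) v(2) e L_less show ?thesis by simp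
qed

text \<open>
  Shooting: with \<open>y1(0) = y4(0) = 0\<close> prescribed, the end conditions \<open>y1(L3) = y4(L3) = 0\<close> are
  two linear equations for \<open>y2(0)\<close> and \<open>y3(0)\<close>.
\<close>

lemma boundary_value_solution:
  assumes z: "Re z = 0" "z \<noteq> 0"
  shows "\<exists>C\<ge>0. \<forall>g2 g3 g4 B. datum g2 g3 g4 integrable_on {0..L3} \<longrightarrow>
    (\<forall>x\<in>{0..L3}. norm (integral {0..x} (datum g2 g3 g4)) \<le> B) \<longrightarrow>
    (\<exists>y1 y2 y3 y4. sys z g2 g3 g4 y1 y2 y3 y4 \<and> y1 0 = 0 \<and> y4 0 = 0 \<and> y1 L3 = 0 \<and> y4 L3 = 0 \<and>
      (\<forall>x\<in>{0..L3}. bounded4 (B * C) y1 y2 y3 y4 x))"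
proof -
  obtain C where C: "C \<ge> 0" "\<forall>p g2 g3 g4 B. datum g2 g3 g4 integrable_on {0..L3} \<longrightarrow>
    (\<forall>x\<in>{0..L3}. norm (p + integral {0..x} (datum g2 g3 g4)) \<le> B) \<longrightarrow>
    (\<exists>y1 y2 y3 y4. sys z g2 g3 g4 y1 y2 y3 y4 \<and> (y1 0, y2 0, y3 0, y4 0) = p \<and>
      (\<forall>x\<in>{0..L3}. bounded4 (B * C) y1 y2 y3 y4 x))"
    using sys_solution[of z] by blast
  have d0: "datum (\<lambda>_. 0) (\<lambda>_. 0) (\<lambda>_. 0) = (\<lambda>_. 0)"
    by (auto simp: datum_def fun_eq_iff zero_prod_def)
  have hom: "\<exists>y1 y2 y3 y4. hom_sys z y1 y2 y3 y4 \<and> (y1 0, y2 0, y3 0, y4 0) = p \<and>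
      (\<forall>x\<in>{0..L3}. bounded4 (norm p * C) y1 y2 y3 y4 x)" for p
    by (rule C(2)[rule_format]) (simp_all add: d0 integrable_0)
  obtain w1 w2 w3 w4 where w: "hom_sys z w1 w2 w3 w4" "(w1 0, w2 0, w3 0, w4 0) = (0, 1, 0, 0)"
    and wb: "\<forall>x\<in>{0..L3}. bounded4 (C) w1 w2 w3 w4 x"
    using hom[of "(0, 1, 0, 0)"] by (auto simp: norm_Pair)
  obtain v1 v2 v3 v4 where v: "hom_sys z v1 v2 v3 v4" "(v1 0, v2 0, v3 0, v4 0) = (0, 0, 1, 0)"
    and vb: "\<forall>x\<in>{0..L3}. bounded4 (C) v1 v2 v3 v4 x"
    using hom[of "(0, 0, 1, 0)"] by (auto simp: norm_Pair)
  \<comment> \<open>Determinant of the shooting map from \<open>(y2 0, y3 0)\<close> to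
    \<open>(y1 L3, y4 L3)\<close>.\<close>
  define \<Delta> where "\<Delta> = w1 L3 * v4 L3 - v1 L3 * w4 L3"
  note nz = hom_sys_comb_zero[OF z w v]
  have \<Delta>: "\<Delta> \<noteq> 0"
  proof
    assume "\<Delta> = 0"
    \<comment> \<open>If the determinant vanishes, the vectors built from its rows lie in the kernel
      of the shooting map, hence are zero; then that map is zero and even \<open>(1, 0)\<close> is
      in its kernel.\<close>
    then have "v1 L3 = 0 \<and> - w1 L3 = 0" "v4 L3 = 0 \<and> - w4 L3 = 0"
      by (intro nz; simp add: \<Delta>_def algebra_simps)+
    then show False using nz[of 1 0] by simp
  qed
  \<comment> \<open>By Cramer's rule the shooting coefficients are quotients by
    \<open>\<Delta>\<close> of a difference of two products, each at most
    \<open>C * (B * C)\<close>; so they are at most \<open>B * C * E\<close>.\<close>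
  define E where "E = 2 * C / norm \<Delta>"
  have E: "E \<ge> 0" using C(1) by (simp add: E_def)
  have L3: "L3 \<in> {0..L3}" "0 \<le> L3" using L_less by auto
  show ?thesis
  proof (intro exI[of _ "C + 2 * (C * E * C)"] conjI allI impI)
    show "0 \<le> C + 2 * (C * E * C)" using C(1) E by simp
    fix g2 g3 g4 B assume "datum g2 g3 g4 integrable_on {0..L3}"
      "\<forall>x\<in>{0..L3}. norm (integral {0..x} (datum g2 g3 g4)) \<le> B"
    then obtain s1 s2 s3 s4 where s: "sys z g2 g3 g4 s1 s2 s3 s4" "(s1 0, s2 0, s3 0, s4 0) = 0"
      and sb: "\<And>x. x \<in> {0..L3} \<Longrightarrow> norm (s1 x) \<le> B * C \<and> norm (s2 x) \<le> B * C \<and> norm (s3 x) \<le> B * C \<and> norm (s4 x) \<le> B * C"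
      using C(2)[rule_format, of g2 g3 g4 0 B] unfolding add_0 by blast
    have BC: "0 \<le> B * C" using sb[OF L3(1)] norm_ge_zero order_trans by blast
    \<comment> \<open>Cramer's rule for the correction that cancels the end values of the particular
      solution with zero initial data.\<close>
    define c where "c = (v1 L3 * s4 L3 - s1 L3 * v4 L3) / \<Delta>"
    define d where "d = (w4 L3 * s1 L3 - w1 L3 * s4 L3) / \<Delta>"
    have cd: "norm c \<le> B * C * E" "norm d \<le> B * C * E"
    proof -
      have "norm (v1 L3 * s4 L3 - s1 L3 * v4 L3) \<le> C * (B * C) + (B * C) * C"
        unfolding norm_mult[symmetric]
        by (intro order_trans[OF norm_triangle_ineq4] add_mono; unfold norm_mult; intro mult_mono)
          (use sb[OF L3(1)] vb L3 C(1) BC in auto)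
      then show "norm c \<le> B * C * E"
        using \<Delta> by (simp add: c_def norm_divide E_def divide_right_mono field_simps)
      have "norm (w4 L3 * s1 L3 - w1 L3 * s4 L3) \<le> C * (B * C) + C * (B * C)"
        by (intro order_trans[OF norm_triangle_ineq4] add_mono; unfold norm_mult; intro mult_mono)
          (use sb[OF L3(1)] wb L3 C(1) BC in auto)
      then show "norm d \<le> B * C * E"
        using \<Delta> by (simp add: d_def norm_divide E_def divide_right_mono field_simps)
    qed
    let ?y = "\<lambda>s w v t. s t + c * w t + d * v t"
    have b: "norm (?y s w v x) \<le> B * (C + 2 * (C * E * C))"
      if "norm (s x) \<le> B * C" "norm (w x) \<le> C" "norm (v x) \<le> C" for s w v :: "real \<Rightarrow> complex" and x
    proof -
      have "norm (c * w x) \<le> B * C * E * C" "norm (d * v x) \<le> B * C * E * C"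
        unfolding norm_mult by (intro mult_mono cd that; use BC E in simp)+
      then have "norm (?y s w v x) \<le> B * C + B * C * E * C + B * C * E * C"
        by (intro norm_triangle_mono that(1))
      also have "\<dots> = B * (C + 2 * (C * E * C))" by (simp add: algebra_simps)
      finally show ?thesis .
    qed
    have e: "?y s1 w1 v1 L3 = 0" "?y s4 w4 v4 L3 = 0"
    proof -
      have "\<Delta> * (s1 L3 + c * w1 L3 + d * v1 L3) = 0" "\<Delta> * (s4 L3 + c * w4 L3 + d * v4 L3) = 0"
      proof -
        have "\<Delta> * c = v1 L3 * s4 L3 - s1 L3 * v4 L3" "\<Delta> * d = w4 L3 * s1 L3 - w1 L3 * s4 L3"
          using \<Delta> by (simp_all add: c_def d_def)
        then show "\<Delta> * (s1 L3 + c * w1 L3 + d * v1 L3) = 0" "\<Delta> * (s4 L3 + c * w4 L3 + d * v4 L3) = 0"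
          unfolding \<Delta>_def by algebra+
      qed
      then show "?y s1 w1 v1 L3 = 0" "?y s4 w4 v4 L3 = 0" using \<Delta> by simp_all
    qed
    have i: "?y s1 w1 v1 0 = 0" "?y s4 w4 v4 0 = 0"
      using s(2) w(2) v(2) by (simp_all add: zero_prod_def)
    have S: "sys z g2 g3 g4 (?y s1 w1 v1) (?y s2 w2 v2) (?y s3 w3 v3) (?y s4 w4 v4)"
      by (rule sys_comb[OF sys_comb[OF s(1) w(1)] v(1)])
    let ?C = "C + 2 * (C * E * C)"
    have N: "norm (?y s1 w1 v1 x) \<le> B * ?C \<and> norm (?y s2 w2 v2 x) \<le> B * ?C \<and>
        norm (?y s3 w3 v3 x) \<le> B * ?C \<and> norm (?y s4 w4 v4 x) \<le> B * ?C" if "x \<in> {0..L3}" for x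
      using b[of s1 x w1 v1] b[of s2 x w2 v2] b[of s3 x w3 v3] b[of s4 x w4 v4]
        sb[OF that] bspec[OF wb that] bspec[OF vb that] by simp
    show "\<exists>y1 y2 y3 y4. sys z g2 g3 g4 y1 y2 y3 y4 \<and> y1 0 = 0 \<and> y4 0 = 0 \<and> y1 L3 = 0 \<and> y4 L3 = 0 \<and>
      (\<forall>x\<in>{0..L3}. bounded4 (B * ?C) y1 y2 y3 y4 x)"
      by (intro exI conjI, rule S, rule i, rule i, rule e, rule e) (intro ballI N)
  qed
qed

section \<open>The domain of the operator\<close>

abbreviation "H \<equiv> state_space L1 L2 L3"
abbreviation "D \<equiv> gen_domain L1 L2 L3 a b m"
abbreviation "\<A> \<equiv> gen L1 L2 L3 a b m k \<tau>"
abbreviation "nrm \<equiv> state_norm L1 L2 L3 a b \<tau>"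
abbreviation "\<zeta> \<equiv> zeta_state L1 L2 L3 a b m"
abbreviation "\<zeta>3 \<equiv> zeta3 L1 L2 L3 a b m"
abbreviation "shifted z U \<equiv> scale_state z U - \<A> U"

lemma ac_pair_glue_class:
  assumes u: "u \<in> H1_on I" and v: "v \<in> H1_on J" and tr: "\<forall>p\<in>{L1, L2}. trace_on I u p = trace_on J v p"
  obtains r g where "ac_pair r g" "u = class_on I r" "v = class_on J r"
proof -
  obtain r g where r: "ac_pair r g" "u = class_on I r" by (rule H1_ac_pair[OF u]) auto
  obtain s h where s: "ac_pair s h" "v = class_on J s" by (rule H1_ac_pair[OF v]) auto
  have "r L1 = s L1" "r L2 = s L2"
    using tr trace_class[OF ac_pair_continuous[OF r(1)]] trace_class[OF ac_pair_continuous[OF s(1)]]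
    by (auto simp: r s)
  from ac_pair_glue[OF r(1) s(1) this] that r(2) s(2) show ?thesis by metis
qed

lemma state_spaceI:
  assumes "ac_pair r g" "r 0 = 0" "r L3 = 0" "f3 \<in> L2_on I" "f4 \<in> L2_on I" "f5 \<in> L2_on I" "f6 \<in> L2_on J"
  shows "(class_on I r, class_on J r, f3, f4, f5, f6) \<in> H"
  using assms trace_class[OF ac_pair_continuous[OF assms(1)]] ac_pair_H1[OF assms(1)]
  by (simp add: state_space_def Let_def)

lemma state_spaceE:
  assumes "(f1, f2, f3, f4, f5, f6) \<in> H"
  obtains r g where "ac_pair r g" "r 0 = 0" "r L3 = 0" "f1 = class_on I r" "f2 = class_on J r"
    "f3 \<in> L2_on I" "f4 \<in> L2_on I" "f5 \<in> L2_on I" "f6 \<in> L2_on J"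
proof -
  have *: "f1 \<in> H1_on I" "f2 \<in> H1_on J" "f3 \<in> L2_on I" "f4 \<in> L2_on I" "f5 \<in> L2_on I" "f6 \<in> L2_on J"
    "trace_on J f2 0 = 0" "trace_on J f2 L3 = 0" "\<forall>p\<in>{L1, L2}. trace_on I f1 p = trace_on J f2 p"
    using assms by (auto simp: state_space_def Let_def)
  obtain r g where r: "ac_pair r g" "f1 = class_on I r" "f2 = class_on J r"
    by (rule ac_pair_glue_class[OF *(1,2,9)])
  then have "r 0 = 0" "r L3 = 0"
    using *(7,8) trace_class(2)[OF ac_pair_continuous[OF r(1)]] by auto
  then show ?thesis using that r * by blast
qed

text \<open>
  Functions describing an element of the domain: \<open>r\<close> is \<open>u\<^sup>1\<close>, \<open>v\<^sup>1\<close>, \<open>s\<close> is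
  \<open>a u\<^sup>1\<^sub>x - m \<theta>\<close>, \<open>b v\<^sup>1\<^sub>x\<close>, \<open>t\<close> is \<open>\<theta>\<close>, \<open>y\<close> is \<open>q\<close> and \<open>w\<close> is \<open>u\<^sup>2\<close>, \<open>v\<^sup>2\<close>;
  primes denote derivatives.
\<close>

definition dom_data where
  "dom_data r r' s s' t t' y y' w w' \<longleftrightarrow>
     ac_pair r r' \<and> ac_pair s s' \<and> ac_pair t t' \<and> ac_pair y y' \<and> ac_pair w w' \<and>
     r 0 = 0 \<and> r L3 = 0 \<and> w 0 = 0 \<and> w L3 = 0 \<and> y L1 = 0 \<and> y L2 = 0 \<and>
     (AE x in lborel. x \<in> I \<longrightarrow> r' x = (s x + of_real m * t x) / of_real a) \<and>
     (AE x in lborel. x \<in> J \<longrightarrow> r' x = s x / of_real b)"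

definition dom_state :: "(real \<Rightarrow> complex) \<Rightarrow> (real \<Rightarrow> complex) \<Rightarrow> (real \<Rightarrow> complex) \<Rightarrow> (real \<Rightarrow> complex) \<Rightarrow> state" where
  "dom_state r t y w = (class_on I r, class_on J r, class_on I t, class_on I y, class_on I w, class_on J w)"

lemma dom_data_comb:
  assumes "dom_data r r' s s' t t' y y' w w'" "dom_data r2 r2' s2 s2' t2 t2' y2 y2' w2 w2'"
  shows "dom_data (\<lambda>x. r x + c * r2 x) (\<lambda>x. r' x + c * r2' x) (\<lambda>x. s x + c * s2 x) (\<lambda>x. s' x + c * s2' x)
    (\<lambda>x. t x + c * t2 x) (\<lambda>x. t' x + c * t2' x) (\<lambda>x. y x + c * y2 x) (\<lambda>x. y' x + c * y2' x)
    (\<lambda>x. w x + c * w2 x) (\<lambda>x. w' x + c * w2' x)"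
proof -
  have "AE x in lborel. x \<in> I \<longrightarrow> r' x + c * r2' x = (s x + c * s2 x + of_real m * (t x + c * t2 x)) / of_real a"
  proof -
    have "AE x in lborel. x \<in> I \<longrightarrow> r' x = (s x + of_real m * t x) / of_real a"
      "AE x in lborel. x \<in> I \<longrightarrow> r2' x = (s2 x + of_real m * t2 x) / of_real a"
      using assms by (auto simp: dom_data_def)
    then show ?thesis by eventually_elim (auto simp: algebra_simps add_divide_distrib)
  qed
  moreover have "AE x in lborel. x \<in> J \<longrightarrow> r' x + c * r2' x = (s x + c * s2 x) / of_real b"
  proof -
    have "AE x in lborel. x \<in> J \<longrightarrow> r' x = s x / of_real b" "AE x in lborel. x \<in> J \<longrightarrow> r2' x = s2 x / of_real b"
      using assms by (auto simp: dom_data_def)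
    then show ?thesis by eventually_elim (auto simp: algebra_simps add_divide_distrib)
  qed
  ultimately show ?thesis
    using assms unfolding dom_data_def by (simp add: ac_pair_add ac_pair_scale)
qed

lemma dom_data_classes:
  assumes d: "dom_data r r' s s' t t' y y' w w'"
  shows "weak_deriv I (class_on I r) = class_on I (\<lambda>x. (1 / of_real a) * (s x + of_real m * t x))"
    and "weak_deriv J (class_on J r) = class_on J (\<lambda>x. (1 / of_real b) * s x)"
    and "of_real a *\<^sub>C weak_deriv I (class_on I r) - of_real m *\<^sub>C class_on I t = class_on I s"
proof -
  have ac: "ac_pair r r'" "ac_pair s s'" "ac_pair t t'"
    and I: "AE x in lborel. x \<in> I \<longrightarrow> r' x = (s x + of_real m * t x) / of_real a"
    and J: "AE x in lborel. x \<in> J \<longrightarrow> r' x = s x / of_real b"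
    using d by (auto simp: dom_data_def)
  have IJ: "I \<in> {I, J}" "J \<in> {I, J}" by auto
  note sq = ac_pair_sq[OF ac(1) IJ(1)] ac_pair_sq[OF ac(2) IJ(1)] ac_pair_sq[OF ac(3) IJ(1)]
    ac_pair_sq[OF ac(1) IJ(2)] ac_pair_sq[OF ac(2) IJ(2)]
  have aI: "sq_on I (\<lambda>x. (1 / of_real a) * (s x + of_real m * t x))"
    by (intro sq_on_scale sq_on_add sq)
  show 1: "weak_deriv I (class_on I r) = class_on I (\<lambda>x. (1 / of_real a) * (s x + of_real m * t x))"
    unfolding ac_pair_H1(2)[OF ac(1) IJ(1)]
    by (rule class_on_cong[OF sq(2) aI]) (use I in auto)
  show "weak_deriv J (class_on J r) = class_on J (\<lambda>x. (1 / of_real b) * s x)"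
    unfolding ac_pair_H1(2)[OF ac(1) IJ(2)]
    by (rule class_on_cong[OF sq(8) sq_on_scale[OF sq(9)]]) (use J in auto)
  have "of_real a *\<^sub>C weak_deriv I (class_on I r) - of_real m *\<^sub>C class_on I t
      = class_on I (\<lambda>x. of_real a * ((1 / of_real a) * (s x + of_real m * t x)) - of_real m * t x)"
    unfolding 1 by (simp only: class_on_scale[OF aI] class_on_scale[OF sq(5)]
        class_on_diff[OF sq_on_scale[OF aI] sq_on_scale[OF sq(5)]])
  also have "(\<lambda>x. of_real a * ((1 / of_real a) * (s x + of_real m * t x)) - of_real m * t x) = s"
    using pos by auto
  finally show "of_real a *\<^sub>C weak_deriv I (class_on I r) - of_real m *\<^sub>C class_on I t = class_on I s" .
qed

lemma dom_data_domain:
  assumes d: "dom_data r r' s s' t t' y y' w w'"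
  shows "dom_state r t y w \<in> D"
proof -
  have ac: "ac_pair r r'" "ac_pair s s'" "ac_pair t t'" "ac_pair y y'" "ac_pair w w'"
    and bc: "r 0 = 0" "r L3 = 0" "w 0 = 0" "w L3 = 0" "y L1 = 0" "y L2 = 0"
    using d by (auto simp: dom_data_def)
  have IJ: "I \<in> {I, J}" "J \<in> {I, J}" by auto
  note h1I = ac_pair_H1(1)[OF _ IJ(1)] and h1J = ac_pair_H1(1)[OF _ IJ(2)]
  note tr = trace_class[OF ac_pair_continuous]
  have sI: "ac_pair (\<lambda>x. (1 / of_real a) * (s x + of_real m * t x)) (\<lambda>x. (1 / of_real a) * (s' x + of_real m * t' x))"
    by (intro ac_pair_scale ac_pair_add ac)
  have sJ: "ac_pair (\<lambda>x. (1 / of_real b) * s x) (\<lambda>x. (1 / of_real b) * s' x)"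
    by (intro ac_pair_scale ac)
  note cl = dom_data_classes(1,2)[OF d]
  have h: "dom_state r t y w \<in> H"
    unfolding dom_state_def
    by (intro state_spaceI[OF ac(1) bc(1,2)] class_on_L2 ac_pair_sq(1)[OF ac(3) IJ(1)] ac_pair_sq(1)[OF ac(4) IJ(1)]
        ac_pair_sq(1)[OF ac(5) IJ(1)] ac_pair_sq(1)[OF ac(5) IJ(2)])
  have "of_real a * trace_on I (weak_deriv I (class_on I r)) p - of_real m * trace_on I (class_on I t) p
      = of_real b * trace_on J (weak_deriv J (class_on J r)) p" if "p \<in> {L1, L2}" for p
  proof -
    have p: "p \<in> {0, L1, L2, L3}" using that by auto
    show ?thesis
      unfolding cl tr(1)[OF sI that] tr(1)[OF ac(3) that] tr(2)[OF sJ p]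
      using pos by simp
  qed
  moreover have "class_on I r \<in> H2_on I" "class_on J r \<in> H2_on J"
    using h1I[OF ac(1)] h1J[OF ac(1)] h1I[OF sI] h1J[OF sJ] by (simp_all add: H2_on_def cl)
  ultimately show ?thesis
    using h h1I[OF ac(3)] h1I[OF ac(4)] h1I[OF ac(5)] h1J[OF ac(5)] tr(1)[OF ac(5)] tr(2)[OF ac(5)] tr(1)[OF ac(4)] bc
    unfolding dom_state_def gen_domain_def Let_def by simp
qed

text \<open>The trace condition on \<open>a u1_x - m theta\<close> and \<open>b v1_x\<close> is
  exactly what glues the two into one function \<open>s\<close>. The two equations for
  \<open>r'\<close> come from comparing the derivative of \<open>r\<close> with the representatives
  of the weak derivatives.\<close>

lemma domain_dom_data:
  assumes "U \<in> D"
  obtains r r' s s' t t' y y' w w' where "dom_data r r' s s' t t' y y' w w'" "U = dom_state r t y w"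
proof -
  obtain u1 v1 \<theta> q u2 v2 where U: "U = (u1, v1, \<theta>, q, u2, v2)" by (cases U)
  have *: "(u1, v1, \<theta>, q, u2, v2) \<in> H" "u1 \<in> H2_on I" "v1 \<in> H2_on J" "\<theta> \<in> H1_on I" "q \<in> H1_on I"
      "u2 \<in> H1_on I" "v2 \<in> H1_on J" "trace_on J v2 0 = 0" "trace_on J v2 L3 = 0"
      "\<forall>p\<in>{L1, L2}. trace_on I u2 p = trace_on J v2 p"
      "\<And>p. p \<in> {L1, L2} \<Longrightarrow> of_real a * trace_on I (weak_deriv I u1) p - of_real m * trace_on I \<theta> p
             = of_real b * trace_on J (weak_deriv J v1) p"
      "\<And>p. p \<in> {L1, L2} \<Longrightarrow> trace_on I q p = 0"
    using assms unfolding gen_domain_def Let_def U by auto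
  have IJ: "I \<in> {I, J}" "J \<in> {I, J}" by auto
  note tr = trace_class[OF ac_pair_continuous]
  obtain r r' where r: "ac_pair r r'" "r 0 = 0" "r L3 = 0" "u1 = class_on I r" "v1 = class_on J r"
    by (rule state_spaceE[OF *(1)])
  obtain w w' where w: "ac_pair w w'" "u2 = class_on I w" "v2 = class_on J w"
    by (rule ac_pair_glue_class[OF *(6,7,10)])
  have w0: "w 0 = 0" "w L3 = 0" using *(8,9) tr(2)[OF w(1)] by (auto simp: w)
  obtain t t' where t: "ac_pair t t'" "\<theta> = class_on I t" by (rule H1_ac_pair[OF *(4) IJ(1)])
  obtain y y' where y: "ac_pair y y'" "q = class_on I y" by (rule H1_ac_pair[OF *(5) IJ(1)])
  have y0: "y L1 = 0" "y L2 = 0" using *(12) tr(1)[OF y(1)] by (auto simp: y)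
  have "weak_deriv I u1 \<in> H1_on I" "weak_deriv J v1 \<in> H1_on J" using *(2,3) by (auto simp: H2_on_def)
  then obtain g g' h h' where g: "ac_pair g g'" "weak_deriv I u1 = class_on I g"
    and h: "ac_pair h h'" "weak_deriv J v1 = class_on J h"
    using H1_ac_pair[OF _ IJ(1)] H1_ac_pair[OF _ IJ(2)] by metis
  have p1: "ac_pair (\<lambda>x. of_real a * g x - of_real m * t x) (\<lambda>x. of_real a * g' x - of_real m * t' x)"
    by (intro ac_pair_diff ac_pair_scale g t)
  have p2: "ac_pair (\<lambda>x. of_real b * h x) (\<lambda>x. of_real b * h' x)"
    by (intro ac_pair_scale h)
  have eq: "of_real a * g p - of_real m * t p = of_real b * h p" if "p \<in> {L1, L2}" for p
  proof -
    have p: "p \<in> {0, L1, L2, L3}" using that by auto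
    show ?thesis
      using *(11)[OF that] unfolding g(2) h(2) t(2) tr(1)[OF g(1) that] tr(1)[OF t(1) that] tr(2)[OF h(1) p] .
  qed
  obtain s s' where s: "ac_pair s s'" "\<And>x. x \<in> {L1..L2} \<Longrightarrow> s x = of_real a * g x - of_real m * t x"
    "\<And>x. x \<in> {0..L1} \<union> {L2..L3} \<Longrightarrow> s x = of_real b * h x"
    by (rule ac_pair_glue[OF p1 p2 eq eq]) auto
  have cI: "class_on I r' = class_on I g"
    using ac_pair_H1(2)[OF r(1) IJ(1)] g(2) r(4) by simp
  have cJ: "class_on J r' = class_on J h"
    using ac_pair_H1(2)[OF r(1) IJ(2)] h(2) r(5) by simp
  have "AE x in lborel. x \<in> I \<longrightarrow> r' x = (s x + of_real m * t x) / of_real a"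
    using class_on_eqD[OF cI ac_pair_sq(2)[OF r(1) IJ(1)] ac_pair_sq(1)[OF g(1) IJ(1)]]
    by eventually_elim (use s(2) pos in \<open>auto simp: IJ_simps field_simps\<close>)
  moreover have "AE x in lborel. x \<in> J \<longrightarrow> r' x = s x / of_real b"
    using class_on_eqD[OF cJ ac_pair_sq(2)[OF r(1) IJ(2)] ac_pair_sq(1)[OF h(1) IJ(2)]]
    by eventually_elim (use s(3) pos in \<open>auto simp: IJ_simps field_simps\<close>)
  ultimately have "dom_data r r' s s' t t' y y' w w'"
    unfolding dom_data_def using r s(1) t(1) y(1) w(1) w0 y0 by blast
  then show ?thesis
    by (rule that) (simp add: U dom_state_def r(4,5) t(2) y(2) w(2,3))
qed

text \<open>All classes are formed from explicit functions here, so the resolvent equation can be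
  read as identities almost everywhere.\<close>

lemma resolvent_dom_state:
  assumes d: "dom_data r r' s s' t t' y y' w w'"
  shows "shifted z (dom_state r t y w) =
    (class_on I (\<lambda>x. z * r x - w x), class_on J (\<lambda>x. z * r x - w x),
     class_on I (\<lambda>x. z * t x + (of_real k * y' x + of_real m * w' x)),
     class_on I (\<lambda>x. z * y x + (of_real (k / \<tau>) * t' x + of_real (1 / \<tau>) * y x)),
     class_on I (\<lambda>x. z * w x - s' x), class_on J (\<lambda>x. z * w x - s' x))"
proof -
  have ac: "ac_pair r r'" "ac_pair s s'" "ac_pair t t'" "ac_pair y y'" "ac_pair w w'"
    using d by (auto simp: dom_data_def)
  have IJ: "I \<in> {I, J}" "J \<in> {I, J}" by auto
  note sqI = ac_pair_sq[OF ac(1) IJ(1)] ac_pair_sq[OF ac(2) IJ(1)] ac_pair_sq[OF ac(3) IJ(1)]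
    ac_pair_sq[OF ac(4) IJ(1)] ac_pair_sq[OF ac(5) IJ(1)]
  note sqJ = ac_pair_sq[OF ac(1) IJ(2)] ac_pair_sq[OF ac(2) IJ(2)] ac_pair_sq[OF ac(5) IJ(2)]
  note wdI = ac_pair_H1(2)[OF _ IJ(1)] and wdJ = ac_pair_H1(2)[OF _ IJ(2)]
  have 1: "weak_deriv I (of_real k *\<^sub>C class_on I y + of_real m *\<^sub>C class_on I w)
      = class_on I (\<lambda>x. of_real k * y' x + of_real m * w' x)"
    unfolding class_on_scale[OF sqI(7)] class_on_scale[OF sqI(9)]
      class_on_add[OF sq_on_scale[OF sqI(7)] sq_on_scale[OF sqI(9)]]
    by (intro wdI ac_pair_add ac_pair_scale ac)
  have 2: "weak_deriv I (of_real a *\<^sub>C weak_deriv I (class_on I r) - of_real m *\<^sub>C class_on I t) = class_on I s'"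
    unfolding dom_data_classes(3)[OF d] by (rule wdI[OF ac(2)])
  have "of_real b *\<^sub>C weak_deriv J (weak_deriv J (class_on J r)) = of_real b *\<^sub>C class_on J (\<lambda>x. (1 / of_real b) * s' x)"
    unfolding dom_data_classes(2)[OF d] by (subst wdJ[OF ac_pair_scale[OF ac(2)]]) simp
  also have "\<dots> = class_on J (\<lambda>x. of_real b * ((1 / of_real b) * s' x))"
    by (rule class_on_scale[OF sq_on_scale[OF sqJ(4)]])
  also have "(\<lambda>x. of_real b * ((1 / of_real b) * s' x)) = s'" using pos by simp
  finally have 3: "of_real b *\<^sub>C weak_deriv J (weak_deriv J (class_on J r)) = class_on J s'" .
  have 4: "- (of_real (k / \<tau>) *\<^sub>C weak_deriv I (class_on I t)) - of_real (1 / \<tau>) *\<^sub>C class_on I y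
      = - class_on I (\<lambda>x. of_real (k / \<tau>) * t' x + of_real (1 / \<tau>) * y x)"
    unfolding wdI[OF ac(3)] class_on_scale[OF sqI(6)] class_on_scale[OF sqI(7)]
      class_on_add[OF sq_on_scale[OF sqI(6)] sq_on_scale[OF sqI(7)], symmetric] by simp
  have A: "\<A> (dom_state r t y w) = (class_on I w, class_on J w, - class_on I (\<lambda>x. of_real k * y' x + of_real m * w' x),
      - class_on I (\<lambda>x. of_real (k / \<tau>) * t' x + of_real (1 / \<tau>) * y x), class_on I s', class_on J s')"
    unfolding gen_def Let_def dom_state_def by (simp only: prod.case 1 2 3 4)
  have e: "f - (- g) = f + g" for f g :: l2 by simp
  show ?thesis
    unfolding A
    unfolding dom_state_def scale_state_def
    by (simp only: prod.case diff_Pair e class_on_scale[OF sqI(1)] class_on_scale[OF sqI(5)] class_on_scale[OF sqI(7)]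
        class_on_scale[OF sqI(9)] class_on_scale[OF sqJ(1)] class_on_scale[OF sqJ(5)]
        class_on_add class_on_diff sq_on_add sq_on_scale sqI sqJ)
qed

lemma resolvent_in_space:
  assumes "U \<in> D"
  shows "shifted z U \<in> H"
proof -
  obtain r r' s s' t t' y y' w w' where d: "dom_data r r' s s' t t' y y' w w'" and U: "U = dom_state r t y w"
    by (rule domain_dom_data[OF assms])
  have ac: "ac_pair r r'" "ac_pair s s'" "ac_pair t t'" "ac_pair y y'" "ac_pair w w'"
    and bc: "r 0 = 0" "r L3 = 0" "w 0 = 0" "w L3 = 0"
    using d by (auto simp: dom_data_def)
  note sq = ac[THEN ac_pair_sq_IJ(1)] ac[THEN ac_pair_sq_IJ(2)]
    ac[THEN ac_pair_sq_IJ(3)] ac[THEN ac_pair_sq_IJ(4)]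
  show ?thesis
    unfolding U resolvent_dom_state[OF d]
    by (intro state_spaceI[OF ac_pair_diff[OF ac_pair_scale[OF ac(1)] ac(5)]]
        class_on_L2 sq_on_add sq_on_diff sq_on_scale sq) (simp_all add: bc)
qed

end

section \<open>Injectivity on the imaginary axis\<close>

lemma sq_on_0: "sq_on S (\<lambda>_. 0)"
  using square_integrable_0 by (simp add: sq_on_def)

lemma class_on_eq_0D: "class_on S f = 0 \<Longrightarrow> sq_on S f \<Longrightarrow> AE x in lborel. x \<in> S \<longrightarrow> f x = 0"
  using class_on_eqD[of S f "\<lambda>_. 0"] by (simp add: class_on_0 sq_on_0)

lemma class_on_diff_0:
  assumes "class_on S f = class_on S g" "sq_on S f" "sq_on S g" "\<And>x. h x = f x - g x"
  shows "class_on S h = 0"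
proof -
  have "h = (\<lambda>x. f x - g x)" using assms(4) by auto
  then have "class_on S h = class_on S f - class_on S g" using assms(2,3) by (simp add: class_on_diff)
  then show ?thesis using assms(1) by simp
qed

lemma class_on_cong_on: "(\<And>x. x \<in> S \<Longrightarrow> f x = g x) \<Longrightarrow> class_on S f = class_on S g"
  unfolding class_on_def by (intro arg_cong[of _ _ abs_l2]) auto

lemma sq_on_if:
  assumes "sq_on S f" "sq_on S g" "T \<in> sets borel"
  shows "sq_on S (\<lambda>x. if x \<in> T then f x else g x)"
proof -
  have "sq_on T (\<lambda>x. if x \<in> S then f x else 0)" "sq_on (- T) (\<lambda>x. if x \<in> S then g x else 0)"
    using assms by (auto simp: sq_on_def[of S] intro: square_integrable_imp_sq_on)
  then have "square_integrable (\<lambda>x. (if x \<in> T then if x \<in> S then f x else 0 else 0)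
      + (if x \<in> - T then if x \<in> S then g x else 0 else 0))"
    unfolding sq_on_def by (rule square_integrable_add)
  moreover have "(\<lambda>x. (if x \<in> T then if x \<in> S then f x else 0 else 0)
      + (if x \<in> - T then if x \<in> S then g x else 0 else 0))
    = (\<lambda>x. if x \<in> S then if x \<in> T then f x else g x else 0)" by auto
  ultimately show ?thesis by (simp add: sq_on_def)
qed

lemma primitive_on_const_eq:
  assumes "primitive_on c d r (\<lambda>_. v)" "c \<le> x" "x \<le> y" "y \<le> d"
  shows "r y = r x + (y - x) *\<^sub>R v"
  using has_integral_unique[OF primitive_onD[OF assms] has_integral_const_real[of v x y]] assms(3)
  by (simp add: algebra_simps)

lemma primitive_on_linear_function: "primitive_on c d (\<lambda>x. x *\<^sub>R v + C) (\<lambda>_. v)"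
  unfolding primitive_on_def
proof (intro allI impI)
  fix x y assume "c \<le> x" "x \<le> y" "y \<le> d"
  then show "((\<lambda>_. v) has_integral y *\<^sub>R v + C - (x *\<^sub>R v + C)) {x..y}"
    using has_integral_const_real[of v x y] by (simp add: algebra_simps)
qed

context transmission begin

lemma in_I_or_J: "0 < x \<Longrightarrow> x < L3 \<Longrightarrow> x \<noteq> L1 \<Longrightarrow> x \<noteq> L2 \<Longrightarrow> x \<in> I \<or> x \<in> J"
  by (auto simp: IJ_simps)

lemma IJ_disjoint: "x \<in> J \<Longrightarrow> x \<notin> I"
  using L_less by (auto simp: IJ_simps)

text \<open>\<open>dom_data\<close> leaves theta and q arbitrary outside \<open>[L1, L2]\<close>.
  Clamping imposes the constant extension, under which the values at 0 and \<open>L3\<close> are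
  those at \<open>L1\<close> and \<open>L2\<close>.\<close>

definition clamp :: "(real \<Rightarrow> complex) \<Rightarrow> real \<Rightarrow> complex" where
  "clamp f x = f (max L1 (min L2 x))"

lemma clamp_eq: "x \<in> {L1..L2} \<Longrightarrow> clamp f x = f x"
  by (simp add: clamp_def)

lemma primitive_on_clamp:
  assumes "ac_pair f f'"
  shows "primitive_on 0 L3 (clamp f) (\<lambda>x. if x \<in> I then f' x else 0)"
proof (rule primitive_on_glue[OF primitive_on_glue])
  have p: "primitive_on L1 L2 f f'"
    by (rule primitive_on_subset[of 0 L3]) (use assms L_less in \<open>auto simp: ac_pair_def\<close>)
  show "primitive_on 0 L1 (clamp f) (\<lambda>x. if x \<in> I then f' x else 0)"
    by (rule primitive_on_cong_AE[OF primitive_on_const[of 0 L1 "f L1"] _ AE_I2])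
      (use L_less in \<open>auto simp: clamp_def IJ_simps min_def max_def\<close>)
  show "primitive_on L2 L3 (clamp f) (\<lambda>x. if x \<in> I then f' x else 0)"
    by (rule primitive_on_cong_AE[OF primitive_on_const[of L2 L3 "f L2"] _ AE_I2])
      (use L_less in \<open>auto simp: clamp_def IJ_simps min_def max_def\<close>)
  show "primitive_on L1 L2 (clamp f) (\<lambda>x. if x \<in> I then f' x else 0)"
    by (rule primitive_on_cong_AE[OF p _ AE_I2]) (auto simp: clamp_eq IJ_simps)
qed

text \<open>The first two components give \<open>w = z * r\<close>; substituting this into the
  remaining ones eliminates \<open>w\<close>. The factor \<open>k\<close> makes the fourth unknown
  \<open>k q\<close>.\<close>

lemma dom_data_hom_sys:
  assumes d: "dom_data r r' s s' t t' y y' w w'"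
    and T: "shifted z (dom_state r t y w) = 0"
  shows "hom_sys z r s (clamp t) (\<lambda>x. of_real k * clamp y x)"
    and "AE x in lborel. x \<in> I \<union> J \<longrightarrow> w x = z * r x"
proof -
  have ac: "ac_pair r r'" "ac_pair s s'" "ac_pair t t'" "ac_pair y y'" "ac_pair w w'"
    and rI: "AE x in lborel. x \<in> I \<longrightarrow> r' x = (s x + of_real m * t x) / of_real a"
    and rJ: "AE x in lborel. x \<in> J \<longrightarrow> r' x = s x / of_real b"
    using d by (auto simp: dom_data_def)
  have IJ: "I \<in> {I, J}" "J \<in> {I, J}" by auto
  note sq = sq_on_add sq_on_diff sq_on_scale ac[THEN ac_pair_sq_IJ(1)] ac[THEN ac_pair_sq_IJ(2)]
    ac[THEN ac_pair_sq_IJ(3)] ac[THEN ac_pair_sq_IJ(4)]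
  have c: "class_on I (\<lambda>x. z * r x - w x) = 0" "class_on J (\<lambda>x. z * r x - w x) = 0"
     "class_on I (\<lambda>x. z * t x + (of_real k * y' x + of_real m * w' x)) = 0"
     "class_on I (\<lambda>x. z * y x + (of_real (k / \<tau>) * t' x + of_real (1 / \<tau>) * y x)) = 0"
     "class_on I (\<lambda>x. z * w x - s' x) = 0" "class_on J (\<lambda>x. z * w x - s' x) = 0"
    using T unfolding resolvent_dom_state[OF d] by (auto simp: zero_prod_def)
  note ae1 = class_on_eq_0D[OF c(1)] and ae2 = class_on_eq_0D[OF c(2)] and ae3 = class_on_eq_0D[OF c(3)]
    and ae4 = class_on_eq_0D[OF c(4)] and ae5 = class_on_eq_0D[OF c(5)] and ae6 = class_on_eq_0D[OF c(6)]
  have a1: "AE x in lborel. x \<in> I \<longrightarrow> z * r x - w x = 0" by (rule ae1) (intro sq)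
  have a2: "AE x in lborel. x \<in> J \<longrightarrow> z * r x - w x = 0" by (rule ae2) (intro sq)
  have a3: "AE x in lborel. x \<in> I \<longrightarrow> z * t x + (of_real k * y' x + of_real m * w' x) = 0" by (rule ae3) (intro sq)
  have a4: "AE x in lborel. x \<in> I \<longrightarrow> z * y x + (of_real (k / \<tau>) * t' x + of_real (1 / \<tau>) * y x) = 0" by (rule ae4) (intro sq)
  have a5: "AE x in lborel. x \<in> I \<longrightarrow> z * w x - s' x = 0" by (rule ae5) (intro sq)
  have a6: "AE x in lborel. x \<in> J \<longrightarrow> z * w x - s' x = 0" by (rule ae6) (intro sq)
  \<comment> \<open>The third component contains \<open>w'\<close>, so \<open>w = z * r\<close> must
    be differentiated: the class of \<open>z * r - w\<close> is zero, hence so is its weak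
    derivative.\<close>
  have "class_on I (\<lambda>x. z * r' x - w' x) = weak_deriv I (class_on I (\<lambda>x. z * r x - w x))"
    by (rule ac_pair_H1(2)[OF ac_pair_diff[OF ac_pair_scale[OF ac(1)] ac(5)] IJ(1), symmetric])
  also have "\<dots> = weak_deriv I (class_on I (\<lambda>x. 0))" by (simp only: c(1) class_on_0)
  also have "\<dots> = class_on I (\<lambda>x. 0)"
    by (rule ac_pair_H1(2)[OF _ IJ(1)]) (simp add: ac_pair_def primitive_on_const sq_on_0)
  finally have "class_on I (\<lambda>x. z * r' x - w' x) = 0" by (simp only: class_on_0)
  then have a7: "AE x in lborel. x \<in> I \<longrightarrow> z * r' x - w' x = 0" by (rule class_on_eq_0D) (intro sq)
  note ne = AE_lborel_singleton[of L1] AE_lborel_singleton[of L2]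
  show "AE x in lborel. x \<in> I \<union> J \<longrightarrow> w x = z * r x"
    using a1 a2 by eventually_elim auto
  show "hom_sys z r s (clamp t) (\<lambda>x. of_real k * clamp y x)"
    unfolding sys_def
  proof (intro conjI)
    show "primitive_on 0 L3 r (\<lambda>x. if x \<in> I then (s x + of_real m * clamp t x) / of_real a else s x / of_real b)"
    proof (rule primitive_on_cong_AE)
      show "primitive_on 0 L3 r r'" using ac(1) by (simp add: ac_pair_def)
      show "AE x in lborel. x \<in> {0<..<L3} \<longrightarrow>
          (if x \<in> I then (s x + of_real m * clamp t x) / of_real a else s x / of_real b) = r' x"
        using rI rJ ne
      proof eventually_elim
        case (elim x)
        then show ?case using in_I_or_J[of x] by (auto simp: clamp_eq IJ_simps)
      qed
    qed simp
    show "primitive_on 0 L3 s (\<lambda>x. z * z * r x + 0)"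
    proof (rule primitive_on_cong_AE)
      show "primitive_on 0 L3 s s'" using ac(2) by (simp add: ac_pair_def)
      show "AE x in lborel. x \<in> {0<..<L3} \<longrightarrow> z * z * r x + 0 = s' x"
        using a1 a2 a5 a6 ne
      proof eventually_elim
        case (elim x)
        then show ?case using in_I_or_J[of x] by (auto simp: mult.assoc)
      qed
    qed simp
    show "primitive_on 0 L3 (clamp t) (\<lambda>x. if x \<in> I
        then - ((of_real \<tau> * z + 1) / (of_real k * of_real k)) * (of_real k * clamp y x) + 0 else 0)"
    proof (rule primitive_on_cong_AE[OF primitive_on_clamp[OF ac(3)] refl])
      show "AE x in lborel. x \<in> {0<..<L3} \<longrightarrow> (if x \<in> I
        then - ((of_real \<tau> * z + 1) / (of_real k * of_real k)) * (of_real k * clamp y x) + 0 else 0)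
        = (if x \<in> I then t' x else 0)"
        using a4
      proof eventually_elim
        case (elim x)
        have "t' x = - ((of_real \<tau> * z + 1) / of_real k) * y x" if "x \<in> I"
        proof -
          have "of_real \<tau> * (z * y x + (of_real (k / \<tau>) * t' x + of_real (1 / \<tau>) * y x)) = 0"
            using elim that by simp
          then have "of_real \<tau> * (z * y x) + of_real k * t' x + y x = 0"
            using pos by (simp add: algebra_simps)
          then have "of_real k * t' x = - (of_real \<tau> * z + 1) * y x" by algebra
          then show ?thesis using pos by (simp add: field_simps)
        qed
        then show ?case using pos by (auto simp: clamp_eq IJ_simps)
      qed
    qed
    show "primitive_on 0 L3 (\<lambda>x. of_real k * clamp y x) (\<lambda>x. if x \<in> I
        then - z * (clamp t x + of_real m * (s x + of_real m * clamp t x) / of_real a) + 0 else 0)"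
    proof (rule primitive_on_cong_AE[OF primitive_on_scale[OF primitive_on_clamp[OF ac(4)]] refl])
      show "AE x in lborel. x \<in> {0<..<L3} \<longrightarrow> (if x \<in> I
        then - z * (clamp t x + of_real m * (s x + of_real m * clamp t x) / of_real a) + 0 else 0)
        = of_real k * (if x \<in> I then y' x else 0)"
        using a3 a7 rI
      proof eventually_elim
        case (elim x)
        show ?case
        proof (cases "x \<in> I")
          case True
          then have x: "x \<in> {L1..L2}" by (simp add: IJ_simps)
          have "- z * (t x + of_real m * r' x) = of_real k * y' x"
            using elim(1,2) True by algebra
          moreover have "r' x = (s x + of_real m * t x) / of_real a" using elim(3) True by blast
          ultimately show ?thesis using True by (simp add: clamp_eq[OF x])
        qed simp
      qed
    qed
  qed
qed

lemma resolvent_inj: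
  assumes z: "Re z = 0" "z \<noteq> 0"
  shows "inj_on (\<lambda>U. shifted z U) D"
proof (rule inj_onI)
  fix U V assume "U \<in> D" "V \<in> D" and eq: "shifted z U = shifted z V"
  obtain r r' s s' t t' y y' w w' where d: "dom_data r r' s s' t t' y y' w w'" and U: "U = dom_state r t y w"
    by (rule domain_dom_data[OF \<open>U \<in> D\<close>])
  obtain r2 r2' s2 s2' t2 t2' y2 y2' w2 w2' where d2: "dom_data r2 r2' s2 s2' t2 t2' y2 y2' w2 w2'"
    and V: "V = dom_state r2 t2 y2 w2"
    by (rule domain_dom_data[OF \<open>V \<in> D\<close>])
  have ac: "ac_pair r r'" "ac_pair s s'" "ac_pair t t'" "ac_pair y y'" "ac_pair w w'"
    using d by (auto simp: dom_data_def)
  have ac2: "ac_pair r2 r2'" "ac_pair s2 s2'" "ac_pair t2 t2'" "ac_pair y2 y2'" "ac_pair w2 w2'"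
    using d2 by (auto simp: dom_data_def)
  note sq = sq_on_add sq_on_diff sq_on_scale ac[THEN ac_pair_sq_IJ(1)] ac[THEN ac_pair_sq_IJ(2)]
    ac[THEN ac_pair_sq_IJ(3)] ac[THEN ac_pair_sq_IJ(4)]
    ac2[THEN ac_pair_sq_IJ(1)] ac2[THEN ac_pair_sq_IJ(2)]
    ac2[THEN ac_pair_sq_IJ(3)] ac2[THEN ac_pair_sq_IJ(4)]
  note e = eq[unfolded U V resolvent_dom_state[OF d] resolvent_dom_state[OF d2] prod.inject]
  note e' = e[THEN conjunct1] e[THEN conjunct2, THEN conjunct1] e[THEN conjunct2, THEN conjunct2, THEN conjunct1]
    e[THEN conjunct2, THEN conjunct2, THEN conjunct2, THEN conjunct1]
    e[THEN conjunct2, THEN conjunct2, THEN conjunct2, THEN conjunct2, THEN conjunct1]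
    e[THEN conjunct2, THEN conjunct2, THEN conjunct2, THEN conjunct2, THEN conjunct2]
  note dd = dom_data_comb[OF d d2, of "- 1"]
  have T: "shifted z (dom_state (\<lambda>x. r x + - 1 * r2 x) (\<lambda>x. t x + - 1 * t2 x) (\<lambda>x. y x + - 1 * y2 x) (\<lambda>x. w x + - 1 * w2 x)) = 0"
    unfolding resolvent_dom_state[OF dd] zero_prod_def prod.inject
    by (intro conjI; rule e'[THEN class_on_diff_0], intro sq, intro sq,
      (simp add: algebra_simps; fail | algebra))
  note hs = dom_data_hom_sys[OF dd T]
  \<comment> \<open>Clamped functions take their values at \<open>L1\<close> and \<open>L2\<close>
    here, where q vanishes.\<close>
  have bc: "r 0 + - 1 * r2 0 = 0" "of_real k * clamp (\<lambda>x. y x + - 1 * y2 x) 0 = 0" "r L3 + - 1 * r2 L3 = 0"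
    "of_real k * clamp (\<lambda>x. y x + - 1 * y2 x) L3 = 0"
    using d d2 L_less by (auto simp: dom_data_def clamp_def)
  have 0: "r x = r2 x" "clamp (\<lambda>x. t x + - 1 * t2 x) x = 0" "clamp (\<lambda>x. y x + - 1 * y2 x) x = 0" if "x \<in> {0..L3}" for x
    using hom_sys_zero[OF z hs(1) bc that] pos by auto
  have sub: "x \<in> {0..L3}" if "x \<in> I \<union> J" for x using that L_less by (auto simp: IJ_simps)
  have "class_on I r = class_on I r2" "class_on J r = class_on J r2"
    using 0(1) sub by (auto intro: class_on_cong_on)
  moreover have "class_on I t = class_on I t2" "class_on I y = class_on I y2"
  proof -
    have "t x = t2 x" "y x = y2 x" if "x \<in> I" for x
      using 0(2,3)[of x] sub[of x] that by (auto simp: clamp_eq IJ_simps)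
    then show "class_on I t = class_on I t2" "class_on I y = class_on I y2" by (auto intro: class_on_cong_on)
  qed
  moreover have "class_on I w = class_on I w2"
    by (rule class_on_cong; (intro sq)?) (use hs(2) 0(1) sub in \<open>auto elim!: eventually_mono\<close>)
  moreover have "class_on J w = class_on J w2"
    by (rule class_on_cong; (intro sq)?) (use hs(2) 0(1) sub in \<open>auto elim!: eventually_mono\<close>)
  ultimately show "U = V" by (simp add: U V dom_state_def)
qed

section \<open>The kernel\<close>

definition zeta_fun :: "real \<Rightarrow> real" where
  "zeta_fun x = (if x \<in> {L1..L2} then zeta1 L1 L2 L3 x else zeta2 L1 L2 L3 x)"

definition zeta_deriv :: "real \<Rightarrow> real" where
  "zeta_deriv x = (if x \<in> {L1..L2} then (L2 - L1 - L3) / (L1 * L3) else (L2 - L1) / (L1 * L3))"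

text \<open>The ranges overlap at \<open>L1\<close> and \<open>L2\<close> on purpose: that
  neighbouring formulas agree there is the matching of \<open>zeta1\<close> with
  \<open>zeta2\<close>.\<close>

lemma zeta_fun_eqs:
  "x \<le> L1 \<Longrightarrow> zeta_fun x = (L2 - L1) / (L1 * L3) * x"
  "x \<in> {L1..L2} \<Longrightarrow> zeta_fun x = (L2 - L1 - L3) / (L1 * L3) * x + 1"
  "x \<ge> L2 \<Longrightarrow> zeta_fun x = (L2 - L1) / (L1 * L3) * x - (L2 - L1) / L1"
  using L_less by (auto simp: zeta_fun_def zeta1_def zeta2_def divide_simps) (auto simp: algebra_simps)

lemma zeta_fun_primitive:
  "primitive_on 0 L3 (\<lambda>x. of_real (zeta_fun x) :: complex) (\<lambda>x. of_real (zeta_deriv x))"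
proof (rule primitive_on_glue[OF primitive_on_glue])
  note lin = primitive_on_cong_AE[OF primitive_on_linear_function _ AE_I2]
  show "primitive_on 0 L1 (\<lambda>x. of_real (zeta_fun x) :: complex) (\<lambda>x. of_real (zeta_deriv x))"
    by (rule lin[of _ _ _ "of_real ((L2 - L1) / (L1 * L3))" 0])
      (auto simp: zeta_fun_eqs zeta_deriv_def scaleR_conv_of_real)
  show "primitive_on L1 L2 (\<lambda>x. of_real (zeta_fun x) :: complex) (\<lambda>x. of_real (zeta_deriv x))"
    by (rule lin[of _ _ _ "of_real ((L2 - L1 - L3) / (L1 * L3))" 1])
      (auto simp: zeta_fun_eqs zeta_deriv_def scaleR_conv_of_real)
  show "primitive_on L2 L3 (\<lambda>x. of_real (zeta_fun x) :: complex) (\<lambda>x. of_real (zeta_deriv x))"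
    by (rule lin[of _ _ _ "of_real ((L2 - L1) / (L1 * L3))" "- of_real ((L2 - L1) / L1)"])
      (use L_less in \<open>auto simp: zeta_fun_eqs zeta_deriv_def scaleR_conv_of_real\<close>)
qed

text \<open>The flux is constant, namely \<open>b\<close> times the slope of \<open>zeta2\<close> on
  \<open>J\<close>. The value \<open>\<zeta>3\<close> is the temperature for which \<open>a\<close>
  times the slope of \<open>zeta1\<close>, minus \<open>m * \<zeta>3\<close>, equals this
  constant.\<close>

lemma zeta_dom_data:
  "dom_data (\<lambda>x. c * of_real (zeta_fun x)) (\<lambda>x. c * of_real (zeta_deriv x))
     (\<lambda>x. c * of_real (b * (L2 - L1) / (L1 * L3))) (\<lambda>x. 0)
     (\<lambda>x. c * of_real (\<zeta>3 x)) (\<lambda>x. 0) (\<lambda>x. 0) (\<lambda>x. 0) (\<lambda>x. 0) (\<lambda>x. 0)"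
proof -
  have const: "ac_pair (\<lambda>x. C) (\<lambda>x. 0)" for C
    by (simp add: ac_pair_def primitive_on_const sq_on_0)
  have cs: "sq_on {0..L3} (\<lambda>x. C)" for C
    by (rule sq_on_continuous[of 0 L3]) auto
  have "sq_on {0..L3} (\<lambda>x. if x \<in> {L1..L2} then of_real ((L2 - L1 - L3) / (L1 * L3)) else of_real ((L2 - L1) / (L1 * L3)))"
    by (intro sq_on_if cs atLeastAtMost_borel)
  also have "(\<lambda>x. if x \<in> {L1..L2} then of_real ((L2 - L1 - L3) / (L1 * L3)) else of_real ((L2 - L1) / (L1 * L3)))
      = (\<lambda>x. complex_of_real (zeta_deriv x))"
    by (auto simp: zeta_deriv_def)
  finally have ac: "ac_pair (\<lambda>x. of_real (zeta_fun x)) (\<lambda>x. of_real (zeta_deriv x))"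
    by (simp add: ac_pair_def zeta_fun_primitive)
  have 1: "zeta_deriv x = (b * (L2 - L1) / (L1 * L3) + m * \<zeta>3 x) / a" if "x \<in> I" for x
    using that pos L_less by (auto simp: IJ_simps zeta_deriv_def zeta3_def divide_simps)
  have 2: "zeta_deriv x = (b * (L2 - L1) / (L1 * L3)) / b" if "x \<in> J" for x
    using that pos L_less by (auto simp: IJ_simps zeta_deriv_def)
  have 3: "zeta_fun 0 = 0" "zeta_fun L3 = 0"
    using L_less by (simp_all add: zeta_fun_eqs)
  show ?thesis
    unfolding dom_data_def zeta3_def
  proof (intro conjI const ac_pair_scale ac AE_I2 impI)
    fix x assume x: "x \<in> I"
    show "c * of_real (zeta_deriv x) = (c * of_real (b * (L2 - L1) / (L1 * L3)) +
        of_real m * (c * of_real ((a * (L2 - L1 - L3) - b * (L2 - L1)) / (m * L1 * L3)))) / of_real a"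
      unfolding 1[OF x] zeta3_def by (simp add: algebra_simps add_divide_distrib)
  next
    fix x assume x: "x \<in> J"
    show "c * of_real (zeta_deriv x) = c * of_real (b * (L2 - L1) / (L1 * L3)) / of_real b"
      unfolding 2[OF x] by simp
  qed (simp_all add: 3)
qed

lemma zeta_state_eq:
  "dom_state (\<lambda>x. c * of_real (zeta_fun x)) (\<lambda>x. c * of_real (\<zeta>3 x)) (\<lambda>x. 0) (\<lambda>x. 0)
    = scale_state c (\<zeta>)"
proof -
  have IJ: "I \<in> {I, J}" "J \<in> {I, J}" by auto
  have d: "dom_data (\<lambda>x. of_real (zeta_fun x)) (\<lambda>x. of_real (zeta_deriv x))
     (\<lambda>x. of_real (b * (L2 - L1) / (L1 * L3))) (\<lambda>x. 0)
     (\<lambda>x. of_real (\<zeta>3 x)) (\<lambda>x. 0) (\<lambda>x. 0) (\<lambda>x. 0) (\<lambda>x. 0) (\<lambda>x. 0)"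
    using zeta_dom_data[of 1] by simp
  have sq: "sq_on I (\<lambda>x. of_real (zeta_fun x))" "sq_on J (\<lambda>x. of_real (zeta_fun x))"
    "sq_on I (\<lambda>x. of_real (\<zeta>3 x))"
    by (rule ac_pair_sq(1)[OF _ IJ(1)] ac_pair_sq(1)[OF _ IJ(2)], use d in \<open>unfold dom_data_def, blast\<close>)+
  have "class_on I (\<lambda>x. of_real (zeta1 L1 L2 L3 x)) = class_on I (\<lambda>x. of_real (zeta_fun x))"
    by (rule class_on_cong_on) (auto simp: zeta_fun_def IJ_simps)
  moreover have "class_on J (\<lambda>x. of_real (zeta2 L1 L2 L3 x)) = class_on J (\<lambda>x. of_real (zeta_fun x))"
    by (rule class_on_cong_on) (use L_less in \<open>auto simp: zeta_fun_def IJ_simps\<close>)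
  ultimately show ?thesis
    unfolding zeta_state_def scale_state_def dom_state_def
    by (simp add: class_on_scale[OF sq(1)] class_on_scale[OF sq(2)] class_on_scale[OF sq(3)] class_on_0)
qed

lemma zeta_in_kernel:
  "scale_state c (\<zeta>) \<in> D"
  "\<A> (scale_state c (\<zeta>)) = 0"
proof -
  note d = zeta_dom_data[of c]
  show "scale_state c (\<zeta>) \<in> D"
    using dom_data_domain[OF d] by (simp add: zeta_state_eq)
  have "shifted 0 (scale_state c (\<zeta>)) = 0"
    using resolvent_dom_state[OF d, of 0] unfolding zeta_state_eq
    by (simp add: class_on_0 flip: zero_prod_def)
  then show "\<A> (scale_state c (\<zeta>)) = 0" by simp
qed

text \<open>The trace of the second component at \<open>L1\<close> is \<open>(L2 - L1) / L3\<close>,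
  which is positive.\<close>

lemma zeta_state_nonzero: "\<zeta> \<noteq> 0"
proof
  assume "\<zeta> = 0"
  then have 0: "class_on J (\<lambda>x. of_real (zeta2 L1 L2 L3 x)) = 0"
    unfolding zeta_state_def zero_prod_def prod.inject by blast
  have "class_on J (\<lambda>x. of_real (zeta_fun x)) = class_on J (\<lambda>x. of_real (zeta2 L1 L2 L3 x))"
    by (rule class_on_cong_on) (use L_less in \<open>auto simp: zeta_fun_def IJ_simps\<close>)
  also have "\<dots> = class_on J (\<lambda>x. 0)" by (simp only: 0 class_on_0)
  finally have eq: "class_on J (\<lambda>x. of_real (zeta_fun x)) = class_on J (\<lambda>x. 0)" .
  have "continuous_on {0..L3} (\<lambda>x. complex_of_real (zeta_fun x))"
    by (rule primitive_on_continuous[OF zeta_fun_primitive])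
  from trace_class(2)[OF this, of L1] have "trace_on J (class_on J (\<lambda>x. 0)) L1 = of_real (zeta_fun L1)"
    by (simp add: eq)
  moreover have "trace_on J (class_on J (\<lambda>x. 0)) L1 = 0"
    by (rule trace_class(2)) auto
  ultimately show False using L_less by (simp add: zeta_fun_eqs)
qed

text \<open>For \<open>z = 0\<close> the system is triangular: the flux is a constant
  \<open>\<alpha>\<close>, q vanishes since it is constant and zero at \<open>L1\<close>, theta is
  then a constant \<open>\<beta>\<close>, and \<open>r\<close> is piecewise affine. The end
  conditions and continuity leave one free parameter.\<close>

lemma kernel_subset:
  assumes U: "U \<in> D" "\<A> U = 0"
  shows "\<exists>c. U = scale_state c (\<zeta>)"
proof -
  obtain r r' s s' t t' y y' w w' where d: "dom_data r r' s s' t t' y y' w w'" and Ud: "U = dom_state r t y w"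
    by (rule domain_dom_data[OF U(1)])
  have ac: "ac_pair w w'" and bc: "r 0 = 0" "r L3 = 0" "y L1 = 0"
    using d by (auto simp: dom_data_def)
  have "shifted 0 (dom_state r t y w) = 0"
    using U(2) by (simp add: Ud)
  note hs = dom_data_hom_sys[OF d this]
  note P = hom_sysD[OF hs(1)]
  define \<alpha> where "\<alpha> = s 0"
  define \<beta> where "\<beta> = clamp t 0"
  have s: "s x = \<alpha>" if "x \<in> {0..L3}" for x
    using primitive_on_const_eq[of 0 L3 s 0 0 x] P(2) that unfolding \<alpha>_def by simp
  have Py: "primitive_on 0 L3 (\<lambda>x. of_real k * clamp y x) (\<lambda>_. 0)"
    by (rule primitive_on_cong_AE[OF P(4) refl AE_I2]) simp
  have "clamp y 0 = 0" using bc(3) L_less by (simp add: clamp_def)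
  then have y: "clamp y x = 0" if "x \<in> {0..L3}" for x
    using primitive_on_const_eq[OF Py, of 0 x] that pos by simp
  have Pt: "primitive_on 0 L3 (clamp t) (\<lambda>_. 0)"
    by (rule primitive_on_cong_AE[OF P(3) refl AE_I2]) (simp add: y)
  have t: "clamp t x = \<beta>" if "x \<in> {0..L3}" for x
    using primitive_on_const_eq[OF Pt, of 0 x] that unfolding \<beta>_def by simp
  define \<sigma> where "\<sigma> = (\<alpha> + of_real m * \<beta>) / of_real a"
  define \<gamma> where "\<gamma> = (L2 - L1) / (L1 * L3)"
  \<comment> \<open>Since \<open>\<gamma>\<close> is the slope of \<open>zeta2\<close>, this is the
    multiple for which the slope \<open>\<alpha> / b\<close> of \<open>r\<close> on \<open>J\<close>
    is that of \<open>c * zeta2\<close>.\<close>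
  define c where "c = \<alpha> / of_real (b * \<gamma>)"
  have \<gamma>: "\<gamma> > 0" using L_less by (simp add: \<gamma>_def)
  have \<alpha>: "\<alpha> / of_real b = c * of_real \<gamma>" using \<gamma> pos by (simp add: c_def field_simps)
  have R1: "primitive_on 0 L1 r (\<lambda>_. c * of_real \<gamma>)"
    by (rule primitive_on_cong_AE[OF primitive_on_subset[OF P(1)] refl AE_I2])
      (use L_less in \<open>auto simp: IJ_simps s \<alpha>\<close>)
  have R2: "primitive_on L2 L3 r (\<lambda>_. c * of_real \<gamma>)"
    by (rule primitive_on_cong_AE[OF primitive_on_subset[OF P(1)] refl AE_I2])
      (use L_less in \<open>auto simp: IJ_simps s \<alpha>\<close>)
  have R3: "primitive_on L1 L2 r (\<lambda>_. \<sigma>)"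
    by (rule primitive_on_cong_AE[OF primitive_on_subset[OF P(1)] refl AE_I2])
      (use L_less in \<open>auto simp: IJ_simps s t \<sigma>_def\<close>)
  note R = primitive_on_const_eq[OF R1] primitive_on_const_eq[OF R2] primitive_on_const_eq[OF R3]
  have r1: "r x = x *\<^sub>R (c * of_real \<gamma>)" if "x \<in> {0..L1}" for x
    using R(1)[of 0 x] that bc by simp
  have r2: "r x = r L1 + (x - L1) *\<^sub>R \<sigma>" if "x \<in> {L1..L2}" for x
    using R(3)[of L1 x] that by simp
  have r3: "r x = (x - L3) *\<^sub>R (c * of_real \<gamma>)" if "x \<in> {L2..L3}" for x
    using R(2)[of x L3] that bc by (simp add: algebra_simps add_eq_0_iff)
  have \<sigma>: "\<sigma> = c * of_real ((L2 - L1 - L3) / (L1 * L3))"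
  proof -
    \<comment> \<open>Continuity at \<open>L2\<close>: the value reached from 0 through
      \<open>L1\<close> must equal the value reached backwards from \<open>L3\<close>.\<close>
    have "(L2 - L1) *\<^sub>R \<sigma> = (L2 - L3) *\<^sub>R (c * of_real \<gamma>) - L1 *\<^sub>R (c * of_real \<gamma>)"
      using r1[of L1] r2[of L2] r3[of L2] L_less by simp
    also have "\<dots> = (L2 - L1) *\<^sub>R (c * of_real ((L2 - L1 - L3) / (L1 * L3)))"
      by (simp add: \<gamma>_def scaleR_conv_of_real algebra_simps add_divide_distrib diff_divide_distrib)
    finally show ?thesis using L_less by simp
  qed
  have \<beta>: "\<beta> = c * of_real (\<zeta>3 x)" for x
  proof -
    have "of_real m * \<beta> = of_real a * \<sigma> - of_real b * (c * of_real \<gamma>)"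
      using pos \<alpha>[symmetric] by (simp add: \<sigma>_def field_simps)
    also have "\<dots> = of_real m * (c * of_real (\<zeta>3 x))"
      using pos by (simp add: \<sigma> zeta3_def \<gamma>_def) (simp add: divide_simps algebra_simps)
    finally show ?thesis using pos by simp
  qed
  have r: "r x = c * of_real (zeta_fun x)" if "x \<in> I \<union> J" for x
  proof -
    have L0: "L1 \<noteq> 0" "L3 \<noteq> 0" using L_less by auto
    consider "x \<in> {0..L1}" | "x \<in> {L1..L2}" | "x \<in> {L2..L3}" using \<open>x \<in> I \<union> J\<close> by (auto simp: IJ_simps)
    then show ?thesis
    proof cases
      case 1
      then show ?thesis by (simp add: r1 zeta_fun_eqs \<gamma>_def scaleR_conv_of_real)
    next
      case 2
      define \<delta> where "\<delta> = (L2 - L1 - L3) / (L1 * L3)"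
      have zx: "zeta_fun x = L1 * \<gamma> + (x - L1) * \<delta>"
        using L0 unfolding zeta_fun_eqs(2)[OF 2] \<gamma>_def \<delta>_def by (simp add: divide_simps) (simp add: algebra_simps)
      have rx: "r x = L1 *\<^sub>R (c * of_real \<gamma>) + (x - L1) *\<^sub>R (c * of_real \<delta>)"
        using r2[OF 2] r1[of L1] L_less by (simp add: \<sigma> \<delta>_def)
      show ?thesis
        unfolding zx rx by (simp add: scaleR_conv_of_real algebra_simps)
    next
      case 3
      then have "zeta_fun x = (x - L3) * \<gamma>"
        using L0 by (simp add: zeta_fun_eqs \<gamma>_def divide_simps) (simp add: algebra_simps)
      then show ?thesis using r3[OF 3] by (simp add: scaleR_conv_of_real)
    qed
  qed
  have sub: "x \<in> {0..L3}" if "x \<in> I" for x using that L_less by (auto simp: IJ_simps)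
  have "U = dom_state (\<lambda>x. c * of_real (zeta_fun x)) (\<lambda>x. c * of_real (\<zeta>3 x)) (\<lambda>x. 0) (\<lambda>x. 0)"
    unfolding Ud dom_state_def prod.inject
  proof (intro conjI)
    show "class_on I r = class_on I (\<lambda>x. c * of_real (zeta_fun x))" "class_on J r = class_on J (\<lambda>x. c * of_real (zeta_fun x))"
      using r by (auto intro: class_on_cong_on)
    show "class_on I t = class_on I (\<lambda>x. c * of_real (\<zeta>3 x))"
    proof (rule class_on_cong_on)
      fix x assume "x \<in> I"
      then show "t x = c * of_real (\<zeta>3 x)"
        using t[OF sub, of x] \<beta>[of x] clamp_eq[of x t] by (simp add: IJ_simps)
    qed
    show "class_on I y = class_on I (\<lambda>x. 0)"
    proof (rule class_on_cong_on)
      fix x assume "x \<in> I"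
      then show "y x = 0"
        using y[OF sub, of x] clamp_eq[of x y] by (simp add: IJ_simps)
    qed
    show "class_on I w = class_on I (\<lambda>x. 0)" "class_on J w = class_on J (\<lambda>x. 0)"
      by (rule class_on_cong[OF ac_pair_sq(1)[OF ac] sq_on_0]; use hs(2) in auto)+
  qed
  then show ?thesis using zeta_state_eq by auto
qed

lemma kernel_eq_span: "gen_kernel L1 L2 L3 a b m k \<tau> = state.span {\<zeta>}"
  using kernel_subset zeta_in_kernel unfolding gen_kernel_def state.span_singleton by blast

lemma zero_in_spectrum: "0 \<in> gen_spectrum L1 L2 L3 a b m k \<tau>"
proof -
  have "\<not> inj_on (\<lambda>U. shifted 0 U) D"
  proof
    assume inj: "inj_on (\<lambda>U. shifted 0 U) D"
    have "scale_state 1 (\<zeta>) = scale_state 0 (\<zeta>)"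
      by (rule inj_onD[OF inj _ zeta_in_kernel(1) zeta_in_kernel(1)]) (simp only: zeta_in_kernel(2), simp only: state.scale_zero_left)
    then show False using zeta_state_nonzero by simp
  qed
  then show ?thesis
    by (simp add: gen_spectrum_def spectrum_def resolvent_set_def bij_betw_def)
qed

end

section \<open>Bounds for the resolvent\<close>

definition nsq :: "l2 \<Rightarrow> real" where
  "nsq f = (LINT x|lborel. (cmod (rep_l2 f x))\<^sup>2)"

lemma nsq_nonneg: "0 \<le> nsq f"
  by (simp add: nsq_def)

lemma rep_sq_set_integrable:
  assumes "S \<in> sets borel"
  shows "set_integrable lborel S (\<lambda>x. (cmod (rep_l2 f x))\<^sup>2)"
  using integrable_mult_indicator[of S lborel "\<lambda>x. (cmod (rep_l2 f x))\<^sup>2"] assms square_integrable_rep[of f]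
  by (simp add: set_integrable_def square_integrable_def)

lemma nsq_L2_on:
  assumes "f \<in> L2_on S" and [measurable]: "S \<in> sets borel"
  shows "(LINT x:S|lborel. (cmod (rep_l2 f x))\<^sup>2) = nsq f"
  unfolding set_lebesgue_integral_def nsq_def
proof (rule integral_cong_AE)
  show "AE x in lborel. indicat_real S x *\<^sub>R (cmod (rep_l2 f x))\<^sup>2 = (cmod (rep_l2 f x))\<^sup>2"
    using assms(1) unfolding L2_on_def mem_Collect_eq by (rule eventually_mono) (auto simp: indicator_def)
qed measurable

text \<open>Young's inequality \<open>|y| <= e/2 + |y|^2 / (2 e)\<close> with \<open>e = N\<close>
  gives a bound linear in \<open>N\<close>, without square roots.\<close>

lemma L1_norm_le:
  assumes l: "0 \<le> l" and N: "0 \<le> N" and f: "nsq f \<le> c * N\<^sup>2"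
  shows "integral {0..l} (\<lambda>x. cmod (rep_l2 f x)) \<le> (l + c) / 2 * N"
proof -
  have si: "set_integrable lborel {0..l} (\<lambda>x. cmod (rep_l2 f x))"
    by (rule set_integrable_norm[OF rep_l2_set_integrable])
  have le: "integral {0..l} (\<lambda>x. cmod (rep_l2 f x)) \<le> e * l / 2 + nsq f / (2 * e)" if e: "e > 0" for e
  proof -
    have "integral {0..l} (\<lambda>x. cmod (rep_l2 f x)) = (LINT x:{0..l}|lborel. cmod (rep_l2 f x))"
      by (rule set_borel_integral_eq_integral(2)[OF si, symmetric])
    also have "\<dots> \<le> (LINT x|lborel. indicat_real {0..l} x * (e / 2) + (cmod (rep_l2 f x))\<^sup>2 * (1 / (2 * e)))"
      unfolding set_lebesgue_integral_def
    proof (rule integral_mono)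
      show "integrable lborel (\<lambda>x. indicat_real {0..l} x *\<^sub>R cmod (rep_l2 f x))"
        using si by (simp add: set_integrable_def)
      have "integrable lborel (indicat_real {0..l})" by (simp add: integrable_indicator_iff emeasure_lborel_Icc_eq)
      then show "integrable lborel (\<lambda>x. indicat_real {0..l} x * (e / 2) + (cmod (rep_l2 f x))\<^sup>2 * (1 / (2 * e)))"
        using square_integrable_rep[of f]
        by (intro Bochner_Integration.integrable_add integrable_mult_left) (simp_all add: square_integrable_def)
      fix x
      have "0 \<le> (cmod (rep_l2 f x) - e)\<^sup>2 / (2 * e)" using e by simp
      also have "\<dots> = e / 2 + (cmod (rep_l2 f x))\<^sup>2 * (1 / (2 * e)) - cmod (rep_l2 f x)"
        using e by (simp add: power2_eq_square field_simps)
      finally show "indicat_real {0..l} x *\<^sub>R cmod (rep_l2 f x) \<le> indicat_real {0..l} x * (e / 2) + (cmod (rep_l2 f x))\<^sup>2 * (1 / (2 * e))"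
        using e by (simp add: indicator_def)
    qed
    also have "\<dots> = (LINT x|lborel. indicat_real {0..l} x * (e / 2)) + (LINT x|lborel. (cmod (rep_l2 f x))\<^sup>2 * (1 / (2 * e)))"
      using square_integrable_rep[of f]
      by (intro Bochner_Integration.integral_add integrable_mult_left)
        (simp_all add: square_integrable_def integrable_indicator_iff emeasure_lborel_Icc_eq)
    also have "\<dots> = e * l / 2 + nsq f / (2 * e)"
      using l by (simp add: nsq_def)
    finally show ?thesis .
  qed
  show ?thesis
  proof (cases "N = 0")
    case True
    have "integral {0..l} (\<lambda>x. cmod (rep_l2 f x)) \<le> 0 + e" if e: "e > 0" for e
    proof -
      \<comment> \<open>For \<open>N = 0\<close> the choice \<open>e = N\<close> is impossible; an
        arbitrarily small parameter is used, with \<open>l + 1\<close> avoiding division by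
        zero.\<close>
      define d where "d = e / (l + 1)"
      have d: "d > 0" using e l by (simp add: d_def)
      have "integral {0..l} (\<lambda>x. cmod (rep_l2 f x)) \<le> d * l / 2 + nsq f / (2 * d)" by (rule le[OF d])
      also have "nsq f / (2 * d) \<le> 0" using f True d by (simp add: divide_le_0_iff)
      also have "d * l / 2 \<le> e"
        using e l by (simp add: d_def field_simps)
      finally show ?thesis by simp
    qed
    then have "integral {0..l} (\<lambda>x. cmod (rep_l2 f x)) \<le> 0" by (rule field_le_epsilon)
    then show ?thesis using True by simp
  next
    case False
    then have "N > 0" using N by simp
    have "integral {0..l} (\<lambda>x. cmod (rep_l2 f x)) \<le> N * l / 2 + nsq f / (2 * N)" by (rule le[OF \<open>N > 0\<close>])
    also have "nsq f / (2 * N) \<le> c * N\<^sup>2 / (2 * N)" using f \<open>N > 0\<close> by (intro divide_right_mono) auto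
    also have "N * l / 2 + c * N\<^sup>2 / (2 * N) = (l + c) / 2 * N"
      using \<open>N > 0\<close> by (simp add: field_simps power2_eq_square)
    finally show ?thesis by simp
  qed
qed

context transmission begin

lemma nsq_class_on_le:
  assumes S: "S \<in> {I, J}" and f: "sq_on S f" and M: "\<And>x. x \<in> S \<Longrightarrow> cmod (f x) \<le> M"
  shows "nsq (class_on S f) \<le> L3 * M\<^sup>2"
proof -
  have "nsq (class_on S f) \<le> (LINT x|lborel. indicat_real {0..L3} x * M\<^sup>2)"
    unfolding nsq_def
  proof (rule integral_mono_AE)
    show "integrable lborel (\<lambda>x. (cmod (rep_l2 (class_on S f) x))\<^sup>2)"
      using square_integrable_rep[of "class_on S f"] by (simp add: square_integrable_def)
    have "integrable lborel (indicat_real {0..L3})" by (simp add: integrable_indicator_iff emeasure_lborel_Icc_eq)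
    then show "integrable lborel (\<lambda>x. indicat_real {0..L3} x * M\<^sup>2)" by (rule integrable_mult_left)
    show "AE x in lborel. (cmod (rep_l2 (class_on S f) x))\<^sup>2 \<le> indicat_real {0..L3} x * M\<^sup>2"
      using rep_class_on[OF f]
    proof eventually_elim
      case (elim x)
      show ?case
      proof (cases "x \<in> S")
        case True
        then have "x \<in> {0..L3}" using IJ_subset[OF S] by auto
        moreover have "(cmod (f x))\<^sup>2 \<le> M\<^sup>2" by (intro power_mono M[OF True]) simp
        ultimately show ?thesis using elim True by (simp add: indicator_def)
      qed (use elim in simp)
    qed
  qed
  also have "\<dots> = L3 * M\<^sup>2" using L_less by simp
  finally show ?thesis .
qed

text \<open>The supports allow the integrals over \<open>I\<close> and \<open>J\<close> to be
  replaced by integrals over the line, and each product with its conjugate is a squared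
  modulus.\<close>

lemma state_norm_eq:
  assumes "weak_deriv I u1 \<in> L2_on I" "weak_deriv J v1 \<in> L2_on J" "\<theta> \<in> L2_on I" "q \<in> L2_on I" "u2 \<in> L2_on I" "v2 \<in> L2_on J"
  shows "(nrm (u1, v1, \<theta>, q, u2, v2))\<^sup>2 =
      a * nsq (weak_deriv I u1) + nsq u2 + nsq \<theta> + \<tau> * nsq q + b * nsq (weak_deriv J v1) + nsq v2"
    and "0 \<le> nrm (u1, v1, \<theta>, q, u2, v2)"
proof -
  have sq: "w * cnj w = of_real ((cmod w)\<^sup>2)" for w by (rule complex_norm_square[symmetric])
  note si = rep_sq_set_integrable[OF IJ_borel(1)] rep_sq_set_integrable[OF IJ_borel(2)]
  have 1: "(LINT x:I|lborel. of_real a * rep_l2 (weak_deriv I u1) x * cnj (rep_l2 (weak_deriv I u1) x)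
          + rep_l2 u2 x * cnj (rep_l2 u2 x) + rep_l2 \<theta> x * cnj (rep_l2 \<theta> x)
          + of_real \<tau> * rep_l2 q x * cnj (rep_l2 q x))
      = of_real (a * nsq (weak_deriv I u1) + nsq u2 + nsq \<theta> + \<tau> * nsq q)"
  proof -
    have "(LINT x:I|lborel. of_real a * rep_l2 (weak_deriv I u1) x * cnj (rep_l2 (weak_deriv I u1) x)
          + rep_l2 u2 x * cnj (rep_l2 u2 x) + rep_l2 \<theta> x * cnj (rep_l2 \<theta> x)
          + of_real \<tau> * rep_l2 q x * cnj (rep_l2 q x))
      = (LINT x:I|lborel. of_real (a * (cmod (rep_l2 (weak_deriv I u1) x))\<^sup>2 + (cmod (rep_l2 u2 x))\<^sup>2
          + (cmod (rep_l2 \<theta> x))\<^sup>2 + \<tau> * (cmod (rep_l2 q x))\<^sup>2))"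
      by (simp only: mult.assoc sq of_real_add of_real_mult)
    also have "\<dots> = of_real (LINT x:I|lborel. a * (cmod (rep_l2 (weak_deriv I u1) x))\<^sup>2 + (cmod (rep_l2 u2 x))\<^sup>2
          + (cmod (rep_l2 \<theta> x))\<^sup>2 + \<tau> * (cmod (rep_l2 q x))\<^sup>2)"
      by (rule set_integral_complex_of_real)
    also have "(LINT x:I|lborel. a * (cmod (rep_l2 (weak_deriv I u1) x))\<^sup>2 + (cmod (rep_l2 u2 x))\<^sup>2
          + (cmod (rep_l2 \<theta> x))\<^sup>2 + \<tau> * (cmod (rep_l2 q x))\<^sup>2)
        = a * nsq (weak_deriv I u1) + nsq u2 + nsq \<theta> + \<tau> * nsq q"
      using assms by (simp add: set_integral_add si set_integrable_mult_right nsq_L2_on)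
    finally show ?thesis .
  qed
  have 2: "(LINT x:J|lborel. of_real b * rep_l2 (weak_deriv J v1) x * cnj (rep_l2 (weak_deriv J v1) x)
          + rep_l2 v2 x * cnj (rep_l2 v2 x)) = of_real (b * nsq (weak_deriv J v1) + nsq v2)"
  proof -
    have "(LINT x:J|lborel. of_real b * rep_l2 (weak_deriv J v1) x * cnj (rep_l2 (weak_deriv J v1) x)
          + rep_l2 v2 x * cnj (rep_l2 v2 x))
      = (LINT x:J|lborel. of_real (b * (cmod (rep_l2 (weak_deriv J v1) x))\<^sup>2 + (cmod (rep_l2 v2 x))\<^sup>2))"
      by (simp only: mult.assoc sq of_real_add of_real_mult)
    also have "\<dots> = of_real (LINT x:J|lborel. b * (cmod (rep_l2 (weak_deriv J v1) x))\<^sup>2 + (cmod (rep_l2 v2 x))\<^sup>2)"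
      by (rule set_integral_complex_of_real)
    also have "(LINT x:J|lborel. b * (cmod (rep_l2 (weak_deriv J v1) x))\<^sup>2 + (cmod (rep_l2 v2 x))\<^sup>2)
        = b * nsq (weak_deriv J v1) + nsq v2"
      using assms by (simp add: set_integral_add si set_integrable_mult_right nsq_L2_on)
    finally show ?thesis .
  qed
  have nn: "0 \<le> a * nsq (weak_deriv I u1) + nsq u2 + nsq \<theta> + \<tau> * nsq q + b * nsq (weak_deriv J v1) + nsq v2"
    using pos by (intro add_nonneg_nonneg mult_nonneg_nonneg nsq_nonneg) auto
  have "nrm (u1, v1, \<theta>, q, u2, v2)
      = sqrt (a * nsq (weak_deriv I u1) + nsq u2 + nsq \<theta> + \<tau> * nsq q + b * nsq (weak_deriv J v1) + nsq v2)"
    unfolding state_norm_def state_inner_def Let_def prod.case 1 2 by (simp add: add.assoc)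
  then show "(nrm (u1, v1, \<theta>, q, u2, v2))\<^sup>2 =
      a * nsq (weak_deriv I u1) + nsq u2 + nsq \<theta> + \<tau> * nsq q + b * nsq (weak_deriv J v1) + nsq v2"
    and "0 \<le> nrm (u1, v1, \<theta>, q, u2, v2)"
    using nn by simp_all
qed

text \<open>Converse of the reduction to the system: \<open>\<phi>\<close> is the glued first pair
  of the right-hand side and \<open>p\<close> the glued last pair. The sources result from
  eliminating \<open>w = z * y1 - \<phi>\<close>; the term \<open>m * \<psi>\<close> in the fourth
  comes from the derivative of \<open>w\<close>.\<close>

lemma sys_dom_data:
  assumes S: "sys z (\<lambda>x. - z * \<phi> x - p x) (\<lambda>x. of_real (\<tau> / k) * p4 x) (\<lambda>x. p3 x + of_real m * \<psi> x) y1 y2 y3 y4"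
    and bc: "y1 0 = 0" "y4 0 = 0" "y1 L3 = 0" "y4 L3 = 0"
    and \<phi>: "ac_pair \<phi> \<psi>" "\<phi> 0 = 0" "\<phi> L3 = 0"
    and p: "sq_on {0..L3} p" "sq_on {0..L3} p3" "sq_on {0..L3} p4"
  defines "w \<equiv> \<lambda>x. z * y1 x - \<phi> x"
  shows "dom_state y1 y3 (\<lambda>x. (1 / of_real k) * y4 x) w \<in> D"
    and "shifted z (dom_state y1 y3 (\<lambda>x. (1 / of_real k) * y4 x) w)
      = (class_on I \<phi>, class_on J \<phi>, class_on I p3, class_on I p4, class_on I p, class_on J p)"
    and "weak_deriv I (class_on I y1) = class_on I (\<lambda>x. (1 / of_real a) * (y2 x + of_real m * y3 x))"
    and "weak_deriv J (class_on J y1) = class_on J (\<lambda>x. (1 / of_real b) * y2 x)"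
proof -
  define r' where "r' x = (if x \<in> I then (y2 x + of_real m * y3 x) / of_real a else y2 x / of_real b)" for x
  define s' where "s' x = z * z * y1 x + (- z * \<phi> x - p x)" for x
  define t' where "t' x = (if x \<in> I then - ((of_real \<tau> * z + 1) / (of_real k * of_real k)) * y4 x + of_real (\<tau> / k) * p4 x else 0)" for x
  define q' where "q' x = (if x \<in> I then - z * (y3 x + of_real m * (y2 x + of_real m * y3 x) / of_real a) + (p3 x + of_real m * \<psi> x) else 0)" for x
  have P: "primitive_on 0 L3 y1 r'" "primitive_on 0 L3 y2 s'" "primitive_on 0 L3 y3 t'" "primitive_on 0 L3 y4 q'"
    using S by (simp_all only: sys_def r'_def[abs_def] s'_def[abs_def] t'_def[abs_def] q'_def[abs_def])
  have c: "sq_on {0..L3} y1" "sq_on {0..L3} y2" "sq_on {0..L3} y3" "sq_on {0..L3} y4" "sq_on {0..L3} \<phi>"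
    using sys_continuous[OF S] ac_pair_continuous[OF \<phi>(1)] by (auto intro: sq_on_continuous)
  have \<psi>: "sq_on {0..L3} \<psi>" using \<phi>(1) by (simp add: ac_pair_def)
  note sq = sq_on_if[OF _ _ IJ_borel(1)] sq_on_add sq_on_diff sq_on_scale sq_on_divide sq_on_0 c \<psi> p
  have ac: "ac_pair y1 r'" "ac_pair y2 s'" "ac_pair y3 t'" "ac_pair y4 q'"
  proof -
    have "sq_on {0..L3} r'" unfolding r'_def[abs_def] by (intro sq)
    moreover have "sq_on {0..L3} s'" unfolding s'_def[abs_def] by (intro sq)
    moreover have "sq_on {0..L3} t'" unfolding t'_def[abs_def] by (intro sq)
    moreover have "sq_on {0..L3} q'"
      unfolding q'_def[abs_def] times_divide_eq_right[symmetric] by (intro sq)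
    ultimately show "ac_pair y1 r'" "ac_pair y2 s'" "ac_pair y3 t'" "ac_pair y4 q'"
      using P by (simp_all add: ac_pair_def)
  qed
  \<comment> \<open>\<open>y4\<close> is constant on either side of \<open>I\<close>, which carries
    its zeros at 0 and \<open>L3\<close> to the interfaces, where the domain requires q to
    vanish.\<close>
  have "primitive_on 0 L1 y4 (\<lambda>_. 0)"
    by (rule primitive_on_cong_AE[OF primitive_on_subset[OF P(4)] refl AE_I2])
      (use L_less in \<open>auto simp: q'_def IJ_simps\<close>)
  then have y4L1: "y4 L1 = 0" using primitive_on_const_eq[of 0 L1 y4 0 0 L1] bc L_less by simp
  have "primitive_on L2 L3 y4 (\<lambda>_. 0)"
    by (rule primitive_on_cong_AE[OF primitive_on_subset[OF P(4)] refl AE_I2])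
      (use L_less in \<open>auto simp: q'_def IJ_simps\<close>)
  then have y4L2: "y4 L2 = 0" using primitive_on_const_eq[of L2 L3 y4 0 L2 L3] bc L_less by simp
  have d: "dom_data y1 r' y2 s' y3 t' (\<lambda>x. (1 / of_real k) * y4 x) (\<lambda>x. (1 / of_real k) * q' x) w (\<lambda>x. z * r' x - \<psi> x)"
    unfolding dom_data_def
  proof (intro conjI ac AE_I2 impI)
    show "ac_pair w (\<lambda>x. z * r' x - \<psi> x)"
      unfolding w_def by (intro ac_pair_diff ac_pair_scale ac \<phi>)
    show "ac_pair (\<lambda>x. (1 / of_real k) * y4 x) (\<lambda>x. (1 / of_real k) * q' x)"
      by (intro ac_pair_scale ac)
    show "r' x = (y2 x + of_real m * y3 x) / of_real a" if "x \<in> I" for x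
      using that by (simp add: r'_def)
    show "r' x = y2 x / of_real b" if "x \<in> J" for x
      using IJ_disjoint[OF that] by (simp add: r'_def)
  qed (simp_all add: bc y4L1 y4L2 w_def \<phi>)
  show "dom_state y1 y3 (\<lambda>x. (1 / of_real k) * y4 x) w \<in> D"
    by (rule dom_data_domain[OF d])
  show "weak_deriv I (class_on I y1) = class_on I (\<lambda>x. (1 / of_real a) * (y2 x + of_real m * y3 x))"
    and "weak_deriv J (class_on J y1) = class_on J (\<lambda>x. (1 / of_real b) * y2 x)"
    by (rule dom_data_classes[OF d])+
  show "shifted z (dom_state y1 y3 (\<lambda>x. (1 / of_real k) * y4 x) w)
      = (class_on I \<phi>, class_on J \<phi>, class_on I p3, class_on I p4, class_on I p, class_on J p)"
    unfolding resolvent_dom_state[OF d] prod.inject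
  proof (intro conjI class_on_cong_on)
    show "z * y1 x - w x = \<phi> x" "z * y1 x - w x = \<phi> x" for x by (simp_all add: w_def)
    show "z * w x - s' x = p x" "z * w x - s' x = p x" for x by (simp_all add: w_def s'_def algebra_simps)
    have k: "complex_of_real k \<noteq> 0" "complex_of_real \<tau> \<noteq> 0" using pos by auto
    show "z * y3 x + (of_real k * ((1 / of_real k) * q' x) + of_real m * (z * r' x - \<psi> x)) = p3 x" if "x \<in> I" for x
      using that k by (simp add: q'_def r'_def algebra_simps add_divide_distrib diff_divide_distrib)
    show "z * ((1 / of_real k) * y4 x) + (of_real (k / \<tau>) * t' x + of_real (1 / \<tau>) * ((1 / of_real k) * y4 x)) = p4 x" if "x \<in> I" for x
      using that k by (simp add: t'_def divide_simps) (simp add: algebra_simps)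
  qed
qed

lemma datum_integrable:
  assumes "g2 integrable_on {0..L3}" "(\<lambda>x. if x \<in> I then g3 x else 0) integrable_on {0..L3}"
    "(\<lambda>x. if x \<in> I then g4 x else 0) integrable_on {0..L3}"
  shows "datum g2 g3 g4 integrable_on {0..L3}"
proof -
  have bl: "bounded_linear (\<lambda>v::complex. (0::complex, v, 0::complex, 0::complex))"
    "bounded_linear (\<lambda>v::complex. (0::complex, 0::complex, v, 0::complex))"
    "bounded_linear (\<lambda>v::complex. (0::complex, 0::complex, 0::complex, v))"
    by (intro bounded_linear_Pair bounded_linear_zero bounded_linear_ident)+
  have "(\<lambda>x. (0 :: complex, g2 x, 0 :: complex, 0 :: complex) + ((0, 0, if x \<in> I then g3 x else 0, 0) + (0, 0, 0, if x \<in> I then g4 x else 0))) integrable_on {0..L3}"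
    using integrable_linear[OF assms(1) bl(1)] integrable_linear[OF assms(2) bl(2)] integrable_linear[OF assms(3) bl(3)]
    by (intro integrable_add) (simp_all add: o_def)
  then show ?thesis by (simp add: datum_def[abs_def])
qed

lemma norm_datum_le: "norm (datum g2 g3 g4 x) \<le> norm (g2 x) + norm (g3 x) + norm (g4 x)"
proof -
  have "norm (0::complex, u::complex, v::complex, w::complex) \<le> norm u + norm v + norm w" for u v w
    using norm_Pair_le[of "0::complex" "(u, v, w)"] norm_Pair_le[of u "(v, w)"] norm_Pair_le[of v w] by simp
  from this[of "g2 x" "if x \<in> I then g3 x else 0" "if x \<in> I then g4 x else 0"]
  have "norm (datum g2 g3 g4 x) \<le> norm (g2 x) + norm (if x \<in> I then g3 x else 0) + norm (if x \<in> I then g4 x else 0)"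
    by (simp only: datum_def)
  also have "\<dots> \<le> norm (g2 x) + norm (g3 x) + norm (g4 x)"
    by (intro add_mono) auto
  finally show ?thesis .
qed

text \<open>Dominates the reciprocals of all the weights \<open>a\<close>, \<open>b\<close>,
  \<open>\<tau>\<close> and 1 in the norm, so each squared component is at most this multiple of the
  squared norm.\<close>

definition data_const :: real where
  "data_const = 1 / a + 1 / b + 1 / \<tau> + 1"

text \<open>One integrable majorant \<open>\<sigma>\<close> serves all components of the data. It is
  a sum of six terms, each with integral at most \<open>(L3 + data_const) / 2\<close> times the
  norm, hence the factor 3.\<close>

lemma state_space_bounds:
  assumes F: "F \<in> H"
  obtains f1 f2 f3 f4 f5 f6 \<phi> \<psi> \<sigma> X where "F = (f1, f2, f3, f4, f5, f6)"
    "ac_pair \<phi> \<psi>" "\<phi> 0 = 0" "\<phi> L3 = 0" "f1 = class_on I \<phi>" "f2 = class_on J \<phi>"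
    "(\<sigma> has_integral X) {0..L3}" "X \<le> 3 * (L3 + data_const) * nrm F"
    "\<And>x. cmod (\<psi> x) + cmod (rep_l2 f3 x) + cmod (rep_l2 f4 x) + cmod (rep_l2 f5 x) + cmod (rep_l2 f6 x) \<le> \<sigma> x"
proof -
  have L3: "0 \<le> L3" using L_less by auto
  have c: "1 / a \<le> data_const" "1 / b \<le> data_const" "1 / \<tau> \<le> data_const" "1 / 1 \<le> data_const"
    using pos by (auto simp: data_const_def)
  have IJ: "I \<in> {I, J}" "J \<in> {I, J}" by auto
  obtain f1 f2 f3 f4 f5 f6 where Feq: "F = (f1, f2, f3, f4, f5, f6)" by (cases F)
  obtain \<phi> \<phi>' where \<phi>: "ac_pair \<phi> \<phi>'" "\<phi> 0 = 0" "\<phi> L3 = 0" "f1 = class_on I \<phi>" "f2 = class_on J \<phi>"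
    and f: "f3 \<in> L2_on I" "f4 \<in> L2_on I" "f5 \<in> L2_on I" "f6 \<in> L2_on J"
    by (rule state_spaceE[OF F[unfolded Feq]])
  define d1 where "d1 = weak_deriv I f1"
  define d2 where "d2 = weak_deriv J f2"
  have d1: "d1 = class_on I \<phi>'" and d2: "d2 = class_on J \<phi>'"
    unfolding d1_def d2_def \<phi>(4,5) by (rule ac_pair_H1(2)[OF \<phi>(1)]; simp)+
  note \<phi>sq = ac_pair_sq[OF \<phi>(1) IJ(1)] ac_pair_sq[OF \<phi>(1) IJ(2)]
  have d: "d1 \<in> L2_on I" "d2 \<in> L2_on J"
    unfolding d1 d2 by (intro class_on_L2 \<phi>sq)+
  have N: "(nrm F)\<^sup>2 = a * nsq d1 + nsq f5 + nsq f3 + \<tau> * nsq f4 + b * nsq d2 + nsq f6" "0 \<le> nrm F"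
    unfolding Feq d1_def d2_def by (rule state_norm_eq; fact d[unfolded d1_def d2_def] f)+
  have nn: "0 \<le> a * nsq d1" "0 \<le> \<tau> * nsq f4" "0 \<le> b * nsq d2" "0 \<le> nsq f5" "0 \<le> nsq f3" "0 \<le> nsq f6"
    using pos nsq_nonneg by auto
  have le: "integral {0..L3} (\<lambda>x. cmod (rep_l2 g x)) \<le> (L3 + data_const) / 2 * nrm F"
    if "e * nsq g \<le> (nrm F)\<^sup>2" "e > 0" "1 / e \<le> data_const" for g e
  proof (rule L1_norm_le[OF L3 N(2)])
    have "nsq g \<le> 1 / e * (nrm F)\<^sup>2" using that by (simp add: field_simps)
    also have "\<dots> \<le> data_const * (nrm F)\<^sup>2" by (intro mult_right_mono that) simp
    finally show "nsq g \<le> data_const * (nrm F)\<^sup>2" .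
  qed
  have ri: "(\<lambda>x. cmod (rep_l2 g x)) integrable_on {0..L3}" for g
    by (rule set_borel_integral_eq_integral(1)[OF set_integrable_norm[OF rep_l2_set_integrable]])
  \<comment> \<open>The two weak derivatives live on disjoint sets, so their sum is a derivative of
    \<open>\<phi>\<close> on \<open>[0, L3]\<close>. Using the representatives themselves makes the
    majorant valid at every point.\<close>
  define \<psi> where "\<psi> x = rep_l2 d1 x + rep_l2 d2 x" for x
  have \<phi>\<psi>: "ac_pair \<phi> \<psi>"
    unfolding ac_pair_def
  proof
    show "primitive_on 0 L3 \<phi> \<psi>"
    proof (rule primitive_on_cong_AE)
      show "primitive_on 0 L3 \<phi> \<phi>'" using \<phi>(1) by (simp add: ac_pair_def)
      show "AE x in lborel. x \<in> {0<..<L3} \<longrightarrow> \<psi> x = \<phi>' x"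
        using rep_class_on[OF \<phi>sq(2)] rep_class_on[OF \<phi>sq(4)] AE_lborel_singleton[of L1] AE_lborel_singleton[of L2]
      proof eventually_elim
        case (elim x)
        then show ?case using in_I_or_J[of x] IJ_disjoint[of x] by (auto simp: \<psi>_def d1 d2)
      qed
    qed simp
    show "sq_on {0..L3} \<psi>"
      unfolding \<psi>_def[abs_def] by (intro sq_on_add square_integrable_imp_sq_on[OF square_integrable_rep]) auto
  qed
  define \<sigma> where "\<sigma> x = cmod (rep_l2 d1 x) + cmod (rep_l2 d2 x) + cmod (rep_l2 f3 x) + cmod (rep_l2 f4 x)
    + cmod (rep_l2 f5 x) + cmod (rep_l2 f6 x)" for x
  define P where "P g = integral {0..L3} (\<lambda>x. cmod (rep_l2 g x))" for g
  have "(\<sigma> has_integral (P d1 + P d2 + P f3 + P f4 + P f5 + P f6)) {0..L3}"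
    unfolding \<sigma>_def[abs_def] P_def by (intro has_integral_add integrable_integral ri)
  moreover have "P d1 + P d2 + P f3 + P f4 + P f5 + P f6 \<le> 3 * (L3 + data_const) * nrm F"
  proof -
    have "P d1 \<le> (L3 + data_const) / 2 * nrm F" "P d2 \<le> (L3 + data_const) / 2 * nrm F" "P f4 \<le> (L3 + data_const) / 2 * nrm F"
      unfolding P_def
      by (rule le[OF _ pos(1) c(1)] le[OF _ pos(2) c(2)] le[OF _ pos(5) c(3)]; use N nn in linarith)+
    moreover have "P f3 \<le> (L3 + data_const) / 2 * nrm F" "P f5 \<le> (L3 + data_const) / 2 * nrm F" "P f6 \<le> (L3 + data_const) / 2 * nrm F"
      unfolding P_def by (rule le[OF _ zero_less_one c(4)]; use N nn in linarith)+
    ultimately show ?thesis by (simp add: algebra_simps)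
  qed
  moreover have "cmod (\<psi> x) + cmod (rep_l2 f3 x) + cmod (rep_l2 f4 x) + cmod (rep_l2 f5 x) + cmod (rep_l2 f6 x) \<le> \<sigma> x" for x
    using norm_triangle_ineq[of "rep_l2 d1 x" "rep_l2 d2 x"] by (simp add: \<psi>_def \<sigma>_def)
  ultimately show ?thesis by (rule that[OF Feq \<phi>\<psi> \<phi>(2-5)])
qed

text \<open>The weights in the constant are \<open>(1 + m)^2 / a\<close> from
  \<open>u1_x = (y2 + m y3) / a\<close>, \<open>\<tau> / k^2\<close> from \<open>q = y4 / k\<close>,
  \<open>1 / b\<close> from \<open>v1_x = y2 / b\<close>, and 3 for theta, \<open>u2\<close> and
  \<open>v2\<close>.\<close>

lemma dom_state_norm_le:
  assumes wd: "weak_deriv I (class_on I y1) = class_on I (\<lambda>x. (1 / of_real a) * (y2 x + of_real m * y3 x))"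
      "weak_deriv J (class_on J y1) = class_on J (\<lambda>x. (1 / of_real b) * y2 x)"
    and c: "continuous_on {0..L3} y2" "continuous_on {0..L3} y3" "continuous_on {0..L3} y4" "continuous_on {0..L3} w"
    and M: "\<And>x. x \<in> {0..L3} \<Longrightarrow> bounded4 M y2 y3 y4 w x"
  shows "nrm (dom_state y1 y3 (\<lambda>x. (1 / of_real k) * y4 x) w)
    \<le> sqrt (((1 + m)\<^sup>2 / a + \<tau> / k\<^sup>2 + 1 / b + 3) * L3) * M"
proof (rule power2_le_imp_le)
  have IJ: "I \<in> {I, J}" "J \<in> {I, J}" by auto
  have M0: "0 \<le> M" using M[of 0] L_less order_trans[OF norm_ge_zero[of "y2 0"]] by simp
  have sq: "sq_on S y2" "sq_on S y3" "sq_on S y4" "sq_on S w" if "S \<in> {I, J}" for S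
    using c that by (auto intro: sq_on_continuous[OF _ _ IJ_subset])
  have b: "bounded4 M y2 y3 y4 w x" if "x \<in> S" "S \<in> {I, J}" for x S
    using M IJ_subset[OF that(2)] that(1) by blast
  have n1: "nsq (class_on I (\<lambda>x. (1 / of_real a) * (y2 x + of_real m * y3 x))) \<le> L3 * ((1 + m) / a * M)\<^sup>2"
  proof (rule nsq_class_on_le[OF IJ(1) sq_on_scale[OF sq_on_add[OF sq(1)[OF IJ(1)] sq_on_scale[OF sq(2)[OF IJ(1)]]]]])
    fix x assume "x \<in> I"
    have "cmod (y2 x + of_real m * y3 x) \<le> M + m * M"
      using b[OF \<open>x \<in> I\<close> IJ(1)] pos by (intro norm_triangle_le add_mono) (simp_all add: norm_mult)
    then show "cmod ((1 / of_real a) * (y2 x + of_real m * y3 x)) \<le> (1 + m) / a * M"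
      using pos by (simp add: norm_divide field_simps)
  qed
  have n2: "nsq (class_on J (\<lambda>x. (1 / of_real b) * y2 x)) \<le> L3 * (1 / b * M)\<^sup>2"
    by (rule nsq_class_on_le[OF IJ(2) sq_on_scale[OF sq(1)[OF IJ(2)]]])
      (use b[OF _ IJ(2)] pos in \<open>simp add: norm_divide divide_right_mono\<close>)
  have n3: "nsq (class_on I (\<lambda>x. (1 / of_real k) * y4 x)) \<le> L3 * (1 / k * M)\<^sup>2"
    by (rule nsq_class_on_le[OF IJ(1) sq_on_scale[OF sq(3)[OF IJ(1)]]])
      (use b[OF _ IJ(1)] pos in \<open>simp add: norm_divide divide_right_mono\<close>)
  have n4: "nsq (class_on I y3) \<le> L3 * M\<^sup>2"
    by (rule nsq_class_on_le[OF IJ(1) sq(2)[OF IJ(1)]]) (use b[OF _ IJ(1)] in simp)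
  have n5: "nsq (class_on S w) \<le> L3 * M\<^sup>2" if "S \<in> {I, J}" for S
    by (rule nsq_class_on_le[OF that sq(4)[OF that]]) (use b[OF _ that] in simp)
  have "(nrm (dom_state y1 y3 (\<lambda>x. (1 / of_real k) * y4 x) w))\<^sup>2
      = a * nsq (class_on I (\<lambda>x. (1 / of_real a) * (y2 x + of_real m * y3 x)))
      + nsq (class_on I w) + nsq (class_on I y3) + \<tau> * nsq (class_on I (\<lambda>x. (1 / of_real k) * y4 x))
      + b * nsq (class_on J (\<lambda>x. (1 / of_real b) * y2 x)) + nsq (class_on J w)"
    unfolding dom_state_def wd[symmetric]
    by (rule state_norm_eq(1); (unfold wd)?; intro class_on_L2 sq_on_scale sq_on_add sq IJ)
  also have "\<dots> \<le> a * (L3 * ((1 + m) / a * M)\<^sup>2) + L3 * M\<^sup>2 + L3 * M\<^sup>2 + \<tau> * (L3 * (1 / k * M)\<^sup>2)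
      + b * (L3 * (1 / b * M)\<^sup>2) + L3 * M\<^sup>2"
    using pos by (intro add_mono mult_left_mono n1 n2 n3 n4 n5 IJ) auto
  also have "\<dots> = (((1 + m)\<^sup>2 / a + \<tau> / k\<^sup>2 + 1 / b + 3) * L3) * M\<^sup>2"
  proof -
    have "a * (L3 * (n / a * M)\<^sup>2) + L3 * M\<^sup>2 + L3 * M\<^sup>2 + \<tau> * (L3 * (1 / k * M)\<^sup>2) + b * (L3 * (1 / b * M)\<^sup>2) + L3 * M\<^sup>2
        = ((n\<^sup>2 / a + \<tau> / k\<^sup>2 + 1 / b + 3) * L3) * M\<^sup>2" for n
      using pos by (simp add: power_mult_distrib power_divide power2_eq_square[of a] power2_eq_square[of b] algebra_simps)
    then show ?thesis .
  qed
  also have "\<dots> = (sqrt (((1 + m)\<^sup>2 / a + \<tau> / k\<^sup>2 + 1 / b + 3) * L3) * M)\<^sup>2"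
    using pos L_less by (simp add: power_mult_distrib)
  finally show "(nrm (dom_state y1 y3 (\<lambda>x. (1 / of_real k) * y4 x) w))\<^sup>2
    \<le> (sqrt (((1 + m)\<^sup>2 / a + \<tau> / k\<^sup>2 + 1 / b + 3) * L3) * M)\<^sup>2" .
  show "0 \<le> sqrt (((1 + m)\<^sup>2 / a + \<tau> / k\<^sup>2 + 1 / b + 3) * L3) * M"
    using pos L_less M0 by simp
qed

text \<open>The constant multiplies three estimates: \<open>\<kappa>\<close> bounds the integral of
  the data by their norm, \<open>K2\<close> the supremum of the solution by that integral, and
  \<open>K3\<close> the norm of the state by the supremum.\<close>

lemma resolvent_surj_bounded:
  assumes z: "Re z = 0" "z \<noteq> 0"
  shows "\<exists>C. \<forall>F\<in>H. \<exists>U\<in>D. shifted z U = F \<and> nrm U \<le> C * nrm F"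
proof -
  obtain C where C: "C \<ge> 0" "\<forall>g2 g3 g4 B. datum g2 g3 g4 integrable_on {0..L3} \<longrightarrow>
    (\<forall>x\<in>{0..L3}. norm (integral {0..x} (datum g2 g3 g4)) \<le> B) \<longrightarrow>
    (\<exists>y1 y2 y3 y4. sys z g2 g3 g4 y1 y2 y3 y4 \<and> y1 0 = 0 \<and> y4 0 = 0 \<and> y1 L3 = 0 \<and> y4 L3 = 0 \<and>
      (\<forall>x\<in>{0..L3}. bounded4 (B * C) y1 y2 y3 y4 x))"
    using boundary_value_solution[OF z] by blast
  define \<kappa> where "\<kappa> = 3 * (L3 + data_const)"
  \<comment> \<open>Exceeds each of the factors 1, \<open>\<tau> / k\<close> and \<open>m\<close>
    with which the components of the right-hand side enter the source.\<close>
  define e where "e = 1 + \<tau> / k + m"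
  define K1 where "K1 = cmod z * L3 + e"
  \<comment> \<open>Besides the components of the system, this must bound
    \<open>w = z * y1 - \<phi>\<close>, which adds the factor \<open>cmod z\<close> and the summand
    1 for \<open>\<phi>\<close>.\<close>
  define K2 where "K2 = (1 + cmod z) * (K1 * C) + 1"
  define K3 where "K3 = sqrt (((1 + m)\<^sup>2 / a + \<tau> / k\<^sup>2 + 1 / b + 3) * L3)"
  have e: "1 \<le> e" "\<tau> / k \<le> e" "m \<le> e" using pos by (auto simp: e_def)
  have K: "0 \<le> K1" "0 \<le> K2" "0 \<le> K3"
    using pos C(1) e L_less by (auto simp: K1_def K2_def K3_def)
  have IJ: "I \<in> {I, J}" "J \<in> {I, J}" by auto
  show ?thesis
  proof (intro exI[of _ "K3 * (K2 * \<kappa>)"] ballI)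
    fix F assume F: "F \<in> H"
    obtain f1 f2 f3 f4 f5 f6 \<phi> \<psi> \<sigma> X where Feq: "F = (f1, f2, f3, f4, f5, f6)"
      and \<phi>: "ac_pair \<phi> \<psi>" "\<phi> 0 = 0" "\<phi> L3 = 0" "f1 = class_on I \<phi>" "f2 = class_on J \<phi>"
      and \<sigma>: "(\<sigma> has_integral X) {0..L3}" "X \<le> 3 * (L3 + data_const) * nrm F"
      and \<sigma>le: "\<And>x. cmod (\<psi> x) + cmod (rep_l2 f3 x) + cmod (rep_l2 f4 x) + cmod (rep_l2 f5 x) + cmod (rep_l2 f6 x) \<le> \<sigma> x"
      by (rule state_space_bounds[OF F]) (rule that)
    have f: "f3 \<in> L2_on I" "f4 \<in> L2_on I" "f5 \<in> L2_on I" "f6 \<in> L2_on J"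
      using F by (auto simp: Feq state_space_def Let_def)
    have \<sigma>0: "0 \<le> \<sigma> x" for x by (rule order_trans[OF _ \<sigma>le]) simp
    have \<sigma>i: "\<sigma> integrable_on {0..L3}" using \<sigma>(1) by (rule has_integral_integrable)
    have \<sigma>X: "integral {0..x} \<sigma> \<le> X" if "x \<in> {0..L3}" for x
      unfolding integral_unique[OF \<sigma>(1), symmetric]
      by (rule integral_subset_le) (use that in \<open>auto intro!: \<sigma>i \<sigma>0 integrable_on_subinterval[OF \<sigma>i]\<close>)
    have X0: "0 \<le> X" using \<sigma>(1) by (rule has_integral_nonneg) (rule \<sigma>0)
    have rsq: "sq_on {0..L3} (rep_l2 g)" for g
      by (rule square_integrable_imp_sq_on[OF square_integrable_rep]) simp
    have \<psi>: "primitive_on 0 L3 \<phi> \<psi>" "sq_on {0..L3} \<psi>" using \<phi>(1) by (simp_all add: ac_pair_def)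
    \<comment> \<open>The norm has no term for \<open>\<phi>\<close> itself; the bound comes from
      \<open>\<phi> 0 = 0\<close> and the integral of \<open>\<psi>\<close>.\<close>
    have \<phi>le: "cmod (\<phi> x) \<le> X" if x: "x \<in> {0..L3}" for x
    proof -
      have h: "(\<psi> has_integral \<phi> x) {0..x}" using primitive_onD[OF \<psi>(1), of 0 x] x \<phi>(2) by simp
      have "cmod (integral {0..x} \<psi>) \<le> integral {0..x} \<sigma>"
      proof (rule integral_norm_bound_integral[OF has_integral_integrable[OF h]])
        show "\<sigma> integrable_on {0..x}" by (rule integrable_on_subinterval[OF \<sigma>i]) (use x in auto)
        show "cmod (\<psi> t) \<le> \<sigma> t" for t by (rule order_trans[OF _ \<sigma>le]) simp
      qed
      then show ?thesis using \<sigma>X[OF x] by (simp add: integral_unique[OF h])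
    qed
    \<comment> \<open>A plain sum glues the two: each summand vanishes almost everywhere outside its
      own domain.\<close>
    define p where "p x = rep_l2 f5 x + rep_l2 f6 x" for x
    define g2 where "g2 x = - z * \<phi> x - p x" for x
    define g3 where "g3 x = of_real (\<tau> / k) * rep_l2 f4 x" for x
    define g4 where "g4 x = rep_l2 f3 x + of_real m * \<psi> x" for x
    have \<phi>c: "continuous_on {0..L3} \<phi>" by (rule ac_pair_continuous[OF \<phi>(1)])
    have gi: "(\<lambda>x. if x \<in> I then g x else 0) integrable_on {0..L3}" if "sq_on {0..L3} g" for g
    proof -
      have "sq_on {0..L3} (\<lambda>x. if x \<in> I then g x else 0)" by (intro sq_on_if that sq_on_0) simp
      then have "set_integrable lborel {0..L3} (\<lambda>x. if x \<in> {0..L3} then if x \<in> I then g x else 0 else 0)"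
        unfolding sq_on_def by (rule square_integrable_set_integrable) (auto simp: emeasure_lborel_Icc_eq)
      from set_borel_integral_eq_integral(1)[OF this] show ?thesis
        by (rule integrable_eq) simp
    qed
    have Gi: "datum g2 g3 g4 integrable_on {0..L3}"
    proof (rule datum_integrable[OF _ gi gi])
      show "g2 integrable_on {0..L3}"
        unfolding g2_def[abs_def] p_def[abs_def]
        by (intro integrable_diff integrable_add set_borel_integral_eq_integral(1)[OF rep_l2_set_integrable]
            integrable_continuous_real continuous_intros \<phi>c)
      show "sq_on {0..L3} g3" unfolding g3_def[abs_def] by (intro sq_on_scale rsq)
      show "sq_on {0..L3} g4" unfolding g4_def[abs_def] by (intro sq_on_scale sq_on_add rsq \<psi>(2))
    qed
    have G\<sigma>: "norm (datum g2 g3 g4 x) \<le> cmod z * X + e * \<sigma> x" if x: "x \<in> {0..L3}" for x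
    proof -
      have "norm (g2 x) \<le> cmod z * X + (cmod (rep_l2 f5 x) + cmod (rep_l2 f6 x))"
        unfolding g2_def p_def
        by (rule order_trans[OF norm_triangle_ineq4], intro add_mono norm_triangle_ineq)
          (simp add: norm_mult mult_left_mono \<phi>le[OF x])
      also have "\<dots> \<le> cmod z * X + e * (cmod (rep_l2 f5 x) + cmod (rep_l2 f6 x))"
        using mult_right_mono[OF e(1), of "cmod (rep_l2 f5 x) + cmod (rep_l2 f6 x)"] by simp
      finally have 2: "norm (g2 x) \<le> cmod z * X + e * (cmod (rep_l2 f5 x) + cmod (rep_l2 f6 x))" .
      have 3: "norm (g3 x) \<le> e * cmod (rep_l2 f4 x)"
        using mult_right_mono[OF e(2), of "cmod (rep_l2 f4 x)"] pos by (simp add: g3_def norm_mult norm_divide)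
      have "norm (g4 x) \<le> cmod (rep_l2 f3 x) + m * cmod (\<psi> x)"
        unfolding g4_def using pos by (intro norm_triangle_le) (simp add: norm_mult)
      then have 4: "norm (g4 x) \<le> e * cmod (rep_l2 f3 x) + e * cmod (\<psi> x)"
        using mult_right_mono[OF e(1), of "cmod (rep_l2 f3 x)"] mult_right_mono[OF e(3), of "cmod (\<psi> x)"] by simp
      have "e * (cmod (\<psi> x) + cmod (rep_l2 f3 x) + cmod (rep_l2 f4 x) + cmod (rep_l2 f5 x) + cmod (rep_l2 f6 x)) \<le> e * \<sigma> x"
        using e(1) by (intro mult_left_mono \<sigma>le) simp
      then show ?thesis
        using norm_datum_le[of g2 g3 g4 x] 2 3 4 by (simp add: distrib_left)
    qed
    have "norm (integral {0..x} (datum g2 g3 g4)) \<le> K1 * X" if x: "x \<in> {0..L3}" for x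
    proof -
      have i: "\<sigma> integrable_on {0..x}" by (rule integrable_on_subinterval[OF \<sigma>i]) (use x in auto)
      have "norm (integral {0..x} (datum g2 g3 g4)) \<le> integral {0..x} (\<lambda>x. cmod z * X + e * \<sigma> x)"
        by (rule integral_norm_bound_integral)
          (use x in \<open>auto intro!: G\<sigma> integrable_on_subinterval[OF Gi] integrable_add integrable_on_mult_right i\<close>)
      also have "\<dots> = x * (cmod z * X) + e * integral {0..x} \<sigma>"
        using x has_integral_add[OF has_integral_const_real[of "cmod z * X" 0 x]
            has_integral_mult_right[OF integrable_integral[OF i], of e]] by (simp add: integral_unique)
      also have "\<dots> \<le> L3 * (cmod z * X) + e * X"
        using x e(1) X0 by (intro add_mono mult_right_mono mult_left_mono \<sigma>X) auto
      finally show ?thesis by (simp add: K1_def algebra_simps)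
    qed
    then obtain y1 y2 y3 y4 where y: "sys z g2 g3 g4 y1 y2 y3 y4" "y1 0 = 0" "y4 0 = 0" "y1 L3 = 0" "y4 L3 = 0"
      and yb: "\<And>x. x \<in> {0..L3} \<Longrightarrow> bounded4 (K1 * X * C) y1 y2 y3 y4 x"
      using C(2)[rule_format, OF Gi, of "K1 * X"] by blast
    define w where "w x = z * y1 x - \<phi> x" for x
    define U where "U = dom_state y1 y3 (\<lambda>x. (1 / of_real k) * y4 x) w"
    have sqp: "sq_on {0..L3} p" unfolding p_def[abs_def] by (intro sq_on_add rsq)
    note S = sys_dom_data[OF y(1)[unfolded g2_def[abs_def] g3_def[abs_def] g4_def[abs_def]] y(2-5) \<phi>(1-3) sqp rsq rsq,
        folded w_def[abs_def], folded U_def]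
    have eqF: "shifted z U = F"
    proof -
      have "f5 = class_on I p"
      proof (rule class_on_eqI[OF sq_on_subset[OF sqp IJ(1)] f(3)])
        show "AE x in lborel. x \<in> I \<longrightarrow> rep_l2 f5 x = p x"
          using f(4) IJ_disjoint unfolding L2_on_def mem_Collect_eq by (auto simp: p_def elim!: eventually_mono)
      qed
      moreover have "f6 = class_on J p"
      proof (rule class_on_eqI[OF sq_on_subset[OF sqp IJ(2)] f(4)])
        show "AE x in lborel. x \<in> J \<longrightarrow> rep_l2 f6 x = p x"
          using f(3) IJ_disjoint unfolding L2_on_def mem_Collect_eq by (auto simp: p_def elim!: eventually_mono)
      qed
      moreover have "f3 = class_on I (rep_l2 f3)" "f4 = class_on I (rep_l2 f4)"
        by (intro L2_eq_class_on f IJ_borel)+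
      ultimately show ?thesis using S(2) \<phi>(4,5) by (simp add: Feq)
    qed
    define Y where "Y = K1 * X * C"
    have Y0: "0 \<le> Y" using K X0 C(1) by (simp add: Y_def)
    have "nrm U \<le> K3 * (K2 * X)"
      unfolding U_def K3_def
    proof (rule dom_state_norm_le[OF S(3,4) sys_continuous(2-4)[OF y(1)]])
      show "continuous_on {0..L3} w"
        unfolding w_def[abs_def] by (intro continuous_intros \<phi>c sys_continuous(1)[OF y(1)])
      fix x assume x: "x \<in> {0..L3}"
      have "K2 * X = Y + (cmod z * Y + X)" by (simp add: K2_def Y_def algebra_simps)
      moreover have "cmod (w x) \<le> cmod z * Y + X"
        unfolding w_def using yb[OF x, folded Y_def] \<phi>le[OF x]
        by (intro order_trans[OF norm_triangle_ineq4] add_mono) (auto simp: norm_mult intro!: mult_left_mono)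
      moreover have "0 \<le> cmod z * Y" using Y0 by simp
      ultimately show "bounded4 (K2 * X) y2 y3 y4 w x"
        using yb[OF x, folded Y_def] Y0 X0 by linarith
    qed
    also have "\<dots> \<le> K3 * (K2 * (\<kappa> * nrm F))"
      using K \<sigma>(2) by (intro mult_left_mono) (auto simp: \<kappa>_def)
    finally show "\<exists>U\<in>D. shifted z U = F \<and> nrm U \<le> K3 * (K2 * \<kappa>) * nrm F"
      using S(1) eqF by (auto simp: mult.assoc)
  qed
qed

text \<open>By injectivity \<open>inv_into\<close> returns the solution that was constructed, so the
  constructed bound is a bound for the inverse.\<close>

lemma imaginary_in_resolvent_set:
  assumes z: "Re z = 0" "z \<noteq> 0"
  shows "z \<in> gen_resolvent_set L1 L2 L3 a b m k \<tau>"
proof -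
  let ?T = "\<lambda>U. shifted z U"
  obtain C where C: "\<And>F. F \<in> H \<Longrightarrow> \<exists>U\<in>D. ?T U = F \<and>
    nrm U \<le> C * nrm F"
    using resolvent_surj_bounded[OF z] by blast
  have inj: "inj_on ?T D" by (rule resolvent_inj[OF z])
  have "?T ` D = H"
  proof
    show "?T ` D \<subseteq> H" using resolvent_in_space by blast
    show "H \<subseteq> ?T ` D"
    proof
      fix F assume "F \<in> H"
      then obtain U where "U \<in> D" "?T U = F" using C by blast
      then show "F \<in> ?T ` D" by blast
    qed
  qed
  moreover have "\<forall>F\<in>H. nrm (inv_into D ?T F) \<le> C * nrm F"
  proof
    fix F assume "F \<in> H"
    then obtain U where U: "U \<in> D" "?T U = F" "nrm U \<le> C * nrm F"
      using C by blast
    then have "inv_into D ?T F = U" using inv_into_f_f[OF inj U(1)] by simp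
    then show "nrm (inv_into D ?T F) \<le> C * nrm F"
      using U(3) by simp
  qed
  ultimately show ?thesis
    using inj unfolding gen_resolvent_set_def resolvent_set_def bij_betw_def by blast
qed

end

theorem proposition2p2:
  fixes L1 L2 L3 a b m k \<tau> :: real
  assumes "0 < L1" "L1 < L2" "L2 < L3"
    and "a > 0" "b > 0" "m > 0" "k > 0" "\<tau> > 0"
  shows "0 \<in> gen_spectrum L1 L2 L3 a b m k \<tau> \<and>
    gen_kernel L1 L2 L3 a b m k \<tau> = state.span {zeta_state L1 L2 L3 a b m} \<and>
    {z. Re z = 0} - {0} \<subseteq> gen_resolvent_set L1 L2 L3 a b m k \<tau> \<and>
    {z. Re z = 0} \<inter> gen_spectrum L1 L2 L3 a b m k \<tau> = {0}"
proof -
  interpret transmission L1 L2 L3 a b m k \<tau>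
    by unfold_locales (use assms in auto)
  have r: "{z. Re z = 0} - {0} \<subseteq> gen_resolvent_set L1 L2 L3 a b m k \<tau>"
    using imaginary_in_resolvent_set by blast
  moreover have "gen_spectrum L1 L2 L3 a b m k \<tau> = - gen_resolvent_set L1 L2 L3 a b m k \<tau>"
    by (simp add: gen_spectrum_def gen_resolvent_set_def spectrum_def)
  ultimately have "{z. Re z = 0} \<inter> gen_spectrum L1 L2 L3 a b m k \<tau> = {0}"
    using zero_in_spectrum by auto
  then show ?thesis
    using r zero_in_spectrum kernel_eq_span by blast
qed

end
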